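(* Let $\zeta$ be the Riemann zeta function and $\beta$ the Dirichlet beta function, and let $f_{k,s,v}$, $g_{k,s,v}$ be the functions defined in the context (where $s\notin\mathbb{N}$). The following statements hold. (a) For $\mathrm{Re}\,s\in(1,2)$, $$\zeta(s)=\frac{1}{\Gamma(s)}\lim_{|y|\to\infty}\frac{f_{0,s,1}(y)-g_{0,s,1}(y)}{\sin y}=\frac{\pi 2^{s-2}}{\Gamma(s)}\lim_{|y|\to\infty}\frac{1}{\sin y}\left(-\frac{|y|^s\sin y}{\sin(\pi s/2)}-\frac{|y|^s\,\mathrm{sgn}(y)\cos y}{\cos(\pi s/2)}+\frac{2y^{2}\sin y}{\cos(\pi s/2)}\sum_{n=1}^\infty\frac{(\pi n)^{s-1}}{y^2-(\pi n)^2}\right).$$ (b) For $\mathrm{Re}\,s\in(1,3)$, $$\zeta(s)=\frac{1}{(2^s-1)\Gamma(s)}\lim_{|y|\to\infty}\frac{f_{0,s,1/2}(y)-g_{0,s,1/2}(y)}{\sin y}=\frac{\pi 2^{s-2}}{(2^s-1)\Gamma(s)\cos(\pi s/2)}\lim_{|y|\to\infty}\frac{1}{\sin y}\left(-|y|^s\,\mathrm{sgn}(y)+2y^{2}\sin y\sum_{n=1}^\infty\frac{(-1)^n(\pi n)^{s-1}}{y^2-(\pi n)^2}\right).$$ (c) For $\mathrm{Re}\,s\in(0,2)$, $$\zeta(s)=\frac{1}{(1-2^{1-s})\Gamma(s)}\lim_{|y|\to\infty}\frac{f_{1,s,1}(y)-g_{1,s,1}(y)}{\cos y}=\frac{\pi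 2^{s-2}}{(1-2^{1-s})\Gamma(s)}\lim_{|y|\to\infty}\frac{1}{\cos y}\left(\frac{|y|^s\cos y}{\sin(\pi s/2)}-\frac{|y|^s\,\mathrm{sgn}(y)\sin y}{\cos(\pi s/2)}-\frac{2y^{2}\cos y}{\cos(\pi s/2)}\sum_{n=0}^\infty\frac{[\pi(n+1/2)]^{s-1}}{y^2-[\pi(n+1/2)]^2}\right).$$ (d) For $\mathrm{Re}\,s\in(0,2)$, $$\beta(s)=\frac{1}{2^s\Gamma(s)}\lim_{|y|\to\infty}\frac{f_{1,s,1/2}(y)-g_{1,s,1/2}(y)}{\cos y}=\frac{\pi}{4\,\Gamma(s)\sin(\pi s/2)}\lim_{|y|\to\infty}\frac{1}{\cos y}\left(|y|^s+2y^{2}\cos y\sum_{n=0}^\infty\frac{(-1)^n[\pi(n+1/2)]^{s-1}}{y^2-[\pi(n+1/2)]^2}\right).$$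
   Context: $\mathbb{N}=\{1,2,\ldots\}$ and $\beta(s)=\sum_{n=0}^\infty(-1)^n(2n+1)^{-s}$ for $\mathrm{Re}\,s>0$. For $k\in\{0,1\}$, $v\in(0,1]$, $s\notin\mathbb{N}$ and $y\in\mathbb{R}$, $$f_{k,s,v}(y):=-\pi 2^{s-2}\left(\frac{|y|^s\sin[(2v-1)y-\pi k/2]}{\sin(\pi s/2)}+\frac{|y|^s\,\mathrm{sgn}(y)\cos[(2v-1)y-\pi k/2]}{\cos(\pi s/2)}\right),$$ and, for the values of $s$ occurring in (a)–(d) (for which the polynomial part of the general definition of $g_{k,s,v}$ is an empty sum), $$g_{k,s,v}(y):=-\sin(y+\pi k/2)\,\frac{\pi 2^{s}y^{2}}{\sin(\pi s)}\sum_{n=1-k}^\infty\frac{[\pi(n+k/2)]^{s-1}\sin[\pi(2n+k)v+\pi s/2]}{y^2-[\pi(n+k/2)]^2}.$$ Complex powers of positive reals are principal; series are limits of partial sums; in the limits, $y$ runs over real numbers at which the denominator ($\sin y$ or $\cos y$) does not vanish.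
   Formalization: In (c) the points with 2^{1-s} = 1, i.e. s = 1 + 2πi m/log 2 (m an integer), all on Re s = 1, are excluded, because the prefactor 1/(1-2^{1-s}) is undefined there. *)

theory Defs
  imports "HOL-Complex_Analysis.Complex_Analysis"
begin

text \<open>
  The value at \<open>s \<noteq> 1\<close> of the Riemann zeta function: the analytic continuation of the Dirichlet
  series from \<open>Re z > 1\<close> to some open right half-plane, punctured at \<open>1\<close>, that contains \<open>s\<close>.
  By the identity theorem the value depends neither on the abscissa \<open>c\<close> nor on \<open>F\<close>.
\<close>
definition riemann_zeta :: "complex \<Rightarrow> complex" where
  "riemann_zeta s = (THE w. \<exists>c\<le>1. \<exists>F. c < Re s
      \<and> F holomorphic_on {z. c < Re z} - {1}
      \<and> (\<forall>z. 1 < Re z \<longrightarrow> (\<lambda>n. of_nat (Suc n) powr (- z)) sums F z)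
      \<and> w = F s)"

text \<open>Meaningful for \<open>Re s > 0\<close>, where the series converges (in general only conditionally).\<close>
definition dirichlet_beta :: "complex \<Rightarrow> complex" where
  "dirichlet_beta s = (\<Sum>n. (-1) ^ n * of_nat (2 * n + 1) powr (- s))"

definition f_ksv :: "nat \<Rightarrow> complex \<Rightarrow> real \<Rightarrow> real \<Rightarrow> complex" where
  "f_ksv k s v y = - of_real pi * 2 powr (s - 2) *
     (of_real \<bar>y\<bar> powr s * of_real (sin ((2 * v - 1) * y - pi * real k / 2))
        / sin (of_real pi * s / 2)
      + of_real \<bar>y\<bar> powr s * of_real (sgn y) * of_real (cos ((2 * v - 1) * y - pi * real k / 2))
        / cos (of_real pi * s / 2))"

text \<open>
  This is \<open>g\<close> with indices \<open>k, s, v\<close>, restricted to those values for which the polynomial part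
  of the general definition is an empty sum.
  The summation variable is \<open>n = m + (1 - k)\<close>, so it starts at \<open>1\<close> for \<open>k = 0\<close> and at \<open>0\<close> for
  \<open>k = 1\<close>.
\<close>
definition g_ksv :: "nat \<Rightarrow> complex \<Rightarrow> real \<Rightarrow> real \<Rightarrow> complex" where
  "g_ksv k s v y = - of_real (sin (y + pi * real k / 2)) *
     (of_real pi * 2 powr s * of_real (y\<^sup>2) / sin (of_real pi * s)) *
     (\<Sum>m. let n = m + (1 - k) in
        of_real (pi * (real n + real k / 2)) powr (s - 1)
        * sin (of_real (pi * (2 * real n + real k) * v) + of_real pi * s / 2)
        / of_real (y\<^sup>2 - (pi * (real n + real k / 2))\<^sup>2))"

text \<open>The limit \<open>\<bar>y\<bar> \<rightarrow> \<infinity>\<close> along the real \<open>y\<close> with \<open>d y \<noteq> 0\<close>.\<close>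
abbreviation at_infinity_off_zeros :: "(real \<Rightarrow> real) \<Rightarrow> real filter" where
  "at_infinity_off_zeros d \<equiv> inf at_infinity (principal {y. d y \<noteq> 0})"

end

theory Submission
  imports Defs
begin

text \<open>
  Each of the kernels \<open>coth t - 1\<close>, \<open>1 / sinh t\<close>, \<open>1 - tanh t\<close>, \<open>1 / cosh t\<close> is a geometric series in
  \<open>exp (- t)\<close>, so its Mellin transform at \<open>s\<close> is \<open>Gamma s\<close> times a Dirichlet series for \<open>\<zeta>\<close> or \<open>\<beta>\<close>.
  This transform is the limit for \<open>\<bar>y\<bar> \<rightarrow> \<infinity>\<close> of the one damped by the factor \<open>y\<^sup>2 / (t\<^sup>2 + y\<^sup>2)\<close>. The damped
  transform can be computed exactly: the Mittag-Leffler expansion of the kernel in the terms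
  \<open>1 / (t\<^sup>2 + b\<^sup>2)\<close> is integrated term by term, with
  \<open>\<integral> t powr (z - 1) / ((t\<^sup>2 + b\<^sup>2) * (t\<^sup>2 + y\<^sup>2)) dt
    = (b powr (z - 2) - y powr (z - 2)) / (y\<^sup>2 - b\<^sup>2) * \<pi> / (2 * sin (\<pi> * z / 2))\<close>.
  The parts with \<open>b powr (z - 2)\<close> form the series of the theorem, and the parts with \<open>y powr (z - 2)\<close> are
  summed by the same Mittag-Leffler expansion, now at the real point \<open>y\<close>.
\<close>

subsection \<open>Mittag-Leffler expansions\<close>

text \<open>The obstacle is that the Mittag-Leffler sums are not quite the kernels: they give
  \<open>coth t - 1 / t\<close>, \<open>1 / sinh t - 1 / t\<close>, \<open>tanh t\<close> and
  \<open>1 / cosh t\<close>, and the first three differ, up to sign, from the kernels by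
  combinations of \<open>1\<close> and \<open>1 / t\<close>. A pure power has no Mellin transform on
  the whole half-line; divided by \<open>t^2 + y^2\<close> it has an explicit one. The resulting
  identity is exact for each admissible \<open>y\<close>, so the only limit in \<open>y\<close> is
  the removal of the damping. Sums and integrals are interchanged by dominated convergence for the
  partial sums, with bounds uniform in the number of terms, because the alternating series need not
  converge absolutely.\<close>

lemma sums_even_partial_sums:
  fixes f :: "nat \<Rightarrow> 'a::real_normed_vector"
  assumes "(\<lambda>m. \<Sum>n<2*m. f n) \<longlonglongrightarrow> L" and "f \<longlonglongrightarrow> 0"
  shows "f sums L"
proof -
  have "(\<lambda>m. (\<Sum>n<2*m. f n) + f (2*m)) \<longlonglongrightarrow> L + 0"
    using LIMSEQ_subseq_LIMSEQ[OF assms(2), of "\<lambda>m. 2*m"]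
    by (intro tendsto_add assms(1)) (auto simp: strict_mono_def o_def)
  then have odd: "(\<lambda>m. \<Sum>n<2*m+1. f n) \<longlonglongrightarrow> L" by simp
  show ?thesis
    unfolding sums_def
  proof (rule topological_tendstoI)
    fix S :: "'a set"
    assume "open S" "L \<in> S"
    then have "\<forall>\<^sub>F m in sequentially. (\<Sum>n<2*m. f n) \<in> S \<and> (\<Sum>n<2*m+1. f n) \<in> S"
      using topological_tendstoD[OF assms(1)] topological_tendstoD[OF odd] by (simp add: eventually_conj)
    then obtain N where N: "\<And>m. m \<ge> N \<Longrightarrow> (\<Sum>n<2*m. f n) \<in> S \<and> (\<Sum>n<2*m+1. f n) \<in> S"
      by (auto simp: eventually_sequentially)
    have "(\<Sum>n<k. f n) \<in> S" if "k \<ge> 2 * N" for k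
      using N[of "k div 2"] that by (cases "even k") (auto elim!: evenE oddE)
    then show "\<forall>\<^sub>F k in sequentially. (\<Sum>n<k. f n) \<in> S"
      by (auto simp: eventually_sequentially)
  qed
qed

lemma sin_pi_mult_neq_0:
  fixes z :: complex
  assumes "z \<notin> \<int>"
  shows "sin (of_real pi * z) \<noteq> 0"
proof
  assume "sin (of_real pi * z) = 0"
  then obtain k :: int where "of_real pi * z = of_real (of_int k * pi)"
    using sin_eq_0 by blast
  then have "of_real pi * z = of_real pi * of_int k" by simp
  then have "z = of_int k" by simp
  then show False using assms by simp
qed

text \<open>Differentiating the reflection formula
  \<open>Gamma z * Gamma (1 - z) = pi / sin (pi * z)\<close> gives
  \<open>Digamma (1 - z) - Digamma z = pi * cot (pi * z)\<close>. In the difference of the two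
  limits that represent Digamma the logarithms cancel and only the reciprocals remain.\<close>

lemma cot_LIMSEQ:
  fixes z :: complex
  assumes z: "z \<notin> \<int>"
  shows "(\<lambda>m. \<Sum>n<m. 1 / (z + of_nat n) + 1 / (z - of_nat (Suc n))) \<longlonglongrightarrow> of_real pi * cot (of_real pi * z)"
proof -
  have z': "1 - z \<notin> \<int>"
  proof
    assume "1 - z \<in> \<int>"
    then have "1 - (1 - z) \<in> \<int>" by (intro Ints_diff) auto
    then show False using z by simp
  qed
  have nz: "z \<notin> \<int>\<^sub>\<le>\<^sub>0" "1 - z \<notin> \<int>\<^sub>\<le>\<^sub>0"
    using z z' nonpos_Ints_subset_Ints by auto
  have sin: "sin (of_real pi * z) \<noteq> 0"
    by (rule sin_pi_mult_neq_0[OF z])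
  have "((\<lambda>w. Gamma w * Gamma (1 - w)) has_field_derivative
      Gamma z * Digamma z * Gamma (1 - z) - Gamma z * (Gamma (1 - z) * Digamma (1 - z))) (at z)"
    using nz by (auto intro!: derivative_eq_intros)
  moreover have "((\<lambda>w. of_real pi / sin (of_real pi * w)) has_field_derivative
      - (of_real pi * (cos (of_real pi * z) * of_real pi)) / (sin (of_real pi * z))^2) (at z)"
    using sin by (auto intro!: derivative_eq_intros simp: power2_eq_square)
  ultimately have "Gamma z * Digamma z * Gamma (1 - z) - Gamma z * (Gamma (1 - z) * Digamma (1 - z))
      = - (of_real pi * (cos (of_real pi * z) * of_real pi)) / (sin (of_real pi * z))^2"
    unfolding Gamma_reflection_complex using DERIV_unique by blast
  then have "Gamma z * Gamma (1 - z) * (Digamma z - Digamma (1 - z))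
      = - (of_real pi * (cos (of_real pi * z) * of_real pi)) / (sin (of_real pi * z))^2"
    by (simp add: algebra_simps)
  then have "of_real pi * ((Digamma z - Digamma (1 - z)) * sin (of_real pi * z))
      = of_real pi * (- (of_real pi * cos (of_real pi * z)))"
    using sin unfolding Gamma_reflection_complex
    by (simp add: divide_simps power2_eq_square)
  then have "(Digamma z - Digamma (1 - z)) * sin (of_real pi * z) = - (of_real pi * cos (of_real pi * z))"
    unfolding mult_cancel_left by simp
  then have "Digamma z - Digamma (1 - z) = - (of_real pi * cot (of_real pi * z))"
    using sin by (simp add: cot_def divide_simps)
  then have *: "Digamma (1 - z) - Digamma z = of_real pi * cot (of_real pi * z)"
    by (metis minus_diff_eq minus_minus)
  have "z \<noteq> 0" "1 - z \<noteq> 0" using nz by auto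
  from tendsto_diff[OF Digamma_LIMSEQ[OF this(2)] Digamma_LIMSEQ[OF this(1)]]
  have "(\<lambda>m. (\<Sum>n<m. inverse (z + of_nat n)) - (\<Sum>n<m. inverse (1 - z + of_nat n))) \<longlonglongrightarrow>
     Digamma (1 - z) - Digamma z" by simp
  moreover have "inverse (z + of_nat n) - inverse (1 - z + of_nat n) =
      1 / (z + of_nat n) + 1 / (z - of_nat (Suc n))" for n
  proof -
    have "z - of_nat (Suc n) = - (1 - z + of_nat n)" by simp
    then show ?thesis by (simp only: minus_divide_right[symmetric] inverse_eq_divide) simp
  qed
  ultimately show ?thesis
    by (simp only: sum_subtractf[symmetric] *)
qed

text \<open>This rests on \<open>1 / sin (2 * w) = cot w - cot (2 * w)\<close>: the cotangent sum at
  \<open>z / 2\<close> supplies every second pole of the sum at \<open>z\<close> with weight two, so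
  the difference alternates in sign. As \<open>m\<close> terms at \<open>z / 2\<close> correspond to
  \<open>2 * m\<close> terms at \<open>z\<close>, only even partial sums are reached.\<close>

lemma csc_LIMSEQ:
  fixes z :: complex
  assumes z: "z \<notin> \<int>"
  shows "(\<lambda>m. \<Sum>n<2*m. (-1)^n * (1 / (z + of_nat n) - 1 / (z - of_nat (Suc n)))) \<longlonglongrightarrow>
           of_real pi / sin (of_real pi * z)"
proof -
  have z2: "z / 2 \<notin> \<int>"
  proof
    assume "z / 2 \<in> \<int>"
    then have "2 * (z / 2) \<in> \<int>" by (intro Ints_mult) auto
    then show False using z by simp
  qed
  define w where "w = of_real pi * z / 2"
  have sin: "sin (2 * w) \<noteq> 0"
    using sin_pi_mult_neq_0[OF z] unfolding w_def by simp
  have "cot w - cot (2 * w) = 1 / sin (2 * w)"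
  proof -
    have "sin w \<noteq> 0" "cos w \<noteq> 0" using sin unfolding sin_double by auto
    then have "cot w - cot (2 * w) = (2 * (cos w)\<^sup>2 - cos (2 * w)) / sin (2 * w)"
      unfolding cot_def sin_double by (simp add: divide_simps power2_eq_square)
    also have "2 * (cos w)\<^sup>2 - cos (2 * w) = 1"
      unfolding cos_double using sin_cos_squared_add[of w] by (simp add: algebra_simps)
    finally show ?thesis .
  qed
  then have cot: "of_real pi * cot (of_real pi * (z / 2)) - of_real pi * cot (of_real pi * z)
      = of_real pi / sin (of_real pi * z)"
    unfolding w_def by (simp add: right_diff_distrib[symmetric])
  have "(\<lambda>m. (\<Sum>n<m. 1 / (z / 2 + of_nat n) + 1 / (z / 2 - of_nat (Suc n)))
           - (\<Sum>n<2*m. 1 / (z + of_nat n) + 1 / (z - of_nat (Suc n)))) \<longlonglongrightarrow>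
        of_real pi / sin (of_real pi * z)"
    unfolding cot[symmetric]
    using LIMSEQ_subseq_LIMSEQ[OF cot_LIMSEQ[OF z], of "\<lambda>m. 2*m"]
    by (intro tendsto_diff cot_LIMSEQ[OF z2]) (auto simp: strict_mono_def o_def)
  moreover have "(\<Sum>n<m. 1 / (z / 2 + of_nat n) + 1 / (z / 2 - of_nat (Suc n)))
           - (\<Sum>n<2*m. 1 / (z + of_nat n) + 1 / (z - of_nat (Suc n)))
      = (\<Sum>n<2*m. (-1)^n * (1 / (z + of_nat n) - 1 / (z - of_nat (Suc n))))" for m
  proof (induction m)
    case (Suc m)
    have "1 / (z / 2 + of_nat m) = 2 / (z + of_nat (2*m))"
         "1 / (z / 2 - of_nat (Suc m)) = 2 / (z - of_nat (Suc (2*m+1)))"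
      by (simp_all add: field_simps)
    then show ?case using Suc by (simp add: algebra_simps del: of_nat_Suc)
  qed simp
  ultimately show ?thesis by simp
qed

lemma tendsto_inverse_linear_0:
  fixes c z :: complex
  assumes "c \<noteq> 0"
  shows "(\<lambda>n. 1 / (c * of_nat n + z)) \<longlonglongrightarrow> 0"
proof -
  have "filterlim (\<lambda>n. c * of_nat n + z) at_infinity sequentially"
    by (rule tendsto_add_filterlim_at_infinity' tendsto_mult_filterlim_at_infinity[OF tendsto_const] assms
        tendsto_of_nat tendsto_const)+
  then show ?thesis
    by (rule tendsto_divide_0[OF tendsto_const])
qed

lemma not_Ints_div_pi:
  fixes w :: complex
  assumes "sin w \<noteq> 0"
  shows "w / of_real pi \<notin> \<int>"
proof
  assume "w / of_real pi \<in> \<int>"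
  then obtain k where "w / of_real pi = of_int k" by (auto elim: Ints_cases)
  then have "w = of_real (real_of_int k * pi)" by (simp add: field_simps)
  then show False using assms by (simp only: sin_eq_0) auto
qed

lemma cot_sums:
  fixes w :: complex
  assumes "sin w \<noteq> 0"
  shows "(\<lambda>n. 2 * w / (w\<^sup>2 - (of_real (pi * real (Suc n)))\<^sup>2)) sums (cot w - 1 / w)"
proof -
  define z where "z = w / of_real pi"
  have z: "z \<notin> \<int>" using not_Ints_div_pi[OF assms] by (simp add: z_def)
  \<comment> \<open>Shifting the poles at \<open>- n\<close> by one pairs \<open>Suc n\<close> with
    \<open>- Suc n\<close>. The pole at \<open>0\<close> splits off, and a boundary term remains
    that vanishes in the limit.\<close>
  have eq: "(\<Sum>n<m. 1 / (z + of_nat n) + 1 / (z - of_nat (Suc n))) = 1 / z - 1 / (z + of_nat m)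
      + (\<Sum>n<m. 1 / (z + of_nat (Suc n)) + 1 / (z - of_nat (Suc n)))" for m
    by (induction m) (simp_all add: algebra_simps)
  have lim: "(\<lambda>m. 1 / (z + of_nat m)) \<longlonglongrightarrow> 0"
    using tendsto_inverse_linear_0[of 1 z] by (simp add: add.commute)
  have "(\<lambda>m. (\<Sum>n<m. 1 / (z + of_nat n) + 1 / (z - of_nat (Suc n))) - 1 / z + 1 / (z + of_nat m))
      \<longlonglongrightarrow> of_real pi * cot (of_real pi * z) - 1 / z + 0"
    by (intro tendsto_intros cot_LIMSEQ[OF z] lim)
  then have "(\<lambda>n. 1 / (z + of_nat (Suc n)) + 1 / (z - of_nat (Suc n))) sums (of_real pi * cot (of_real pi * z) - 1 / z)"
    unfolding sums_def eq by simp
  then have "(\<lambda>n. (1 / of_real pi) * (1 / (z + of_nat (Suc n)) + 1 / (z - of_nat (Suc n))))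
      sums ((1 / of_real pi) * (of_real pi * cot (of_real pi * z) - 1 / z))"
    by (rule sums_mult)
  moreover have "(1 / of_real pi) * (1 / (z + of_nat (Suc n)) + 1 / (z - of_nat (Suc n)))
      = 2 * w / (w\<^sup>2 - (of_real (pi * real (Suc n)))\<^sup>2)" for n
  proof -
    define a :: complex where "a = of_nat (Suc n)"
    have "z \<noteq> a" "z \<noteq> - a" using z unfolding a_def by (auto simp del: of_nat_Suc)
    then have "z + a \<noteq> 0" "z - a \<noteq> 0" by (auto simp: add_eq_0_iff2)
    moreover have "w = of_real pi * z" by (simp add: z_def)
    moreover have "w\<^sup>2 - (of_real (pi * real (Suc n)))\<^sup>2 = (of_real pi)\<^sup>2 * ((z + a) * (z - a))"
      unfolding a_def \<open>w = of_real pi * z\<close> by (simp add: algebra_simps power2_eq_square)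
    ultimately show ?thesis unfolding a_def[symmetric]
      by (simp add: divide_simps power2_eq_square)
  qed
  moreover have "(1 / of_real pi) * (of_real pi * cot (of_real pi * z) - 1 / z) = cot w - 1 / w"
    by (simp add: z_def field_simps)
  ultimately show ?thesis by simp
qed

lemma csc_sums:
  fixes w :: complex
  assumes "sin w \<noteq> 0"
  shows "(\<lambda>n. (-1) ^ Suc n * (2 * w) / (w\<^sup>2 - (of_real (pi * real (Suc n)))\<^sup>2)) sums (1 / sin w - 1 / w)"
proof -
  define z where "z = w / of_real pi"
  have z: "z \<notin> \<int>" using not_Ints_div_pi[OF assms] by (simp add: z_def)
  define f where "f = (\<lambda>n. (-1) ^ Suc n * (1 / (z + of_nat (Suc n)) + 1 / (z - of_nat (Suc n))))"
  \<comment> \<open>The same regrouping; the boundary term now carries the sign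
    \<open>(-1) ^ m\<close>, which is \<open>1\<close> along the even indices used below.\<close>
  have eq: "(\<Sum>n<m. (-1) ^ n * (1 / (z + of_nat n) - 1 / (z - of_nat (Suc n)))) =
       1 / z - (-1) ^ m * (1 / (z + of_nat m)) + (\<Sum>n<m. f n)" for m
    by (induction m) (simp_all add: algebra_simps f_def)
  have lim: "(\<lambda>m. 1 / (z + of_nat m)) \<longlonglongrightarrow> 0"
    using tendsto_inverse_linear_0[of 1 z] by (simp add: add.commute)
  have lim': "(\<lambda>m. 1 / (z - of_nat (Suc m))) \<longlonglongrightarrow> 0"
    using tendsto_inverse_linear_0[of "-1" "z - 1"] by (simp add: algebra_simps)
  have "(\<lambda>m. (\<Sum>n<2*m. (-1) ^ n * (1 / (z + of_nat n) - 1 / (z - of_nat (Suc n)))) - 1 / z + (1 / (z + of_nat (2*m))))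
      \<longlonglongrightarrow> of_real pi / sin (of_real pi * z) - 1 / z + 0"
    using LIMSEQ_subseq_LIMSEQ[OF lim, of "\<lambda>m. 2*m"]
    by (intro tendsto_add tendsto_diff tendsto_const csc_LIMSEQ[OF z]) (auto simp: strict_mono_def o_def)
  then have "(\<lambda>m. \<Sum>n<2*m. f n) \<longlonglongrightarrow> of_real pi / sin (of_real pi * z) - 1 / z"
    unfolding eq by simp
  moreover have "f \<longlonglongrightarrow> 0"
  proof (rule tendsto_norm_zero_cancel)
    have "(\<lambda>n. 1 / (z + of_nat (Suc n)) + 1 / (z - of_nat (Suc n))) \<longlonglongrightarrow> 0 + 0"
      by (intro tendsto_add lim' LIMSEQ_Suc[OF lim])
    then have "(\<lambda>n. norm (1 / (z + of_nat (Suc n)) + 1 / (z - of_nat (Suc n)))) \<longlonglongrightarrow> 0"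
      using tendsto_norm_zero by fastforce
    then show "(\<lambda>n. norm (f n)) \<longlonglongrightarrow> 0" by (simp add: f_def norm_mult norm_power)
  qed
  ultimately have "f sums (of_real pi / sin (of_real pi * z) - 1 / z)"
    by (rule sums_even_partial_sums)
  then have "(\<lambda>n. (1 / of_real pi) * f n)
      sums ((1 / of_real pi) * (of_real pi / sin (of_real pi * z) - 1 / z))"
    by (rule sums_mult)
  moreover have "(1 / of_real pi) * f n
      = (-1) ^ Suc n * (2 * w) / (w\<^sup>2 - (of_real (pi * real (Suc n)))\<^sup>2)" for n
  proof -
    define a :: complex where "a = of_nat (Suc n)"
    have "z \<noteq> a" "z \<noteq> - a" using z unfolding a_def by (auto simp del: of_nat_Suc)
    then have "z + a \<noteq> 0" "z - a \<noteq> 0" by (auto simp: add_eq_0_iff2)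
    moreover have "w = of_real pi * z" by (simp add: z_def)
    moreover have "w\<^sup>2 - (of_real (pi * real (Suc n)))\<^sup>2 = (of_real pi)\<^sup>2 * ((z + a) * (z - a))"
      unfolding a_def \<open>w = of_real pi * z\<close> by (simp add: algebra_simps power2_eq_square)
    ultimately show ?thesis unfolding a_def[symmetric] f_def
      by (simp add: divide_simps power2_eq_square)
  qed
  moreover have "(1 / of_real pi) * (of_real pi / sin (of_real pi * z) - 1 / z) = 1 / sin w - 1 / w"
    by (simp add: z_def field_simps)
  ultimately show ?thesis by simp
qed

lemma sin_plus_half_pi: "sin (w + of_real pi / 2) = cos (w::complex)"
  by (simp add: sin_add)

lemma cos_plus_half_pi: "cos (w + of_real pi / 2) = - sin (w::complex)"
  by (simp add: cos_add)

lemma half_pi_shift: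
  fixes w :: complex
  assumes "cos w \<noteq> 0" and "z = w / of_real pi + 1 / 2"
  shows "z \<notin> \<int>" "of_real pi * z = w + of_real pi / 2"
    "z + of_nat n = (w + of_real (pi * (real n + 1/2))) / of_real pi"
    "z - of_nat (Suc n) = (w - of_real (pi * (real n + 1/2))) / of_real pi"
    "w + of_real (pi * (real n + 1/2)) \<noteq> 0" "w - of_real (pi * (real n + 1/2)) \<noteq> 0"
proof -
  show *: "of_real pi * z = w + of_real pi / 2" by (simp add: assms field_simps)
  then have **: "z = (w + of_real pi / 2) / of_real pi" by (simp add: field_simps)
  show z: "z \<notin> \<int>"
    unfolding ** using assms by (intro not_Ints_div_pi) (simp add: sin_plus_half_pi)
  show 1: "z + of_nat n = (w + of_real (pi * (real n + 1/2))) / of_real pi"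
    and 2: "z - of_nat (Suc n) = (w - of_real (pi * (real n + 1/2))) / of_real pi"
    by (simp_all add: assms field_simps)
  have "z + of_nat n \<noteq> 0" using z by (metis Ints_minus Ints_of_nat add_eq_0_iff2)
  then show "w + of_real (pi * (real n + 1/2)) \<noteq> 0" unfolding 1 by auto
  have "z - of_nat (Suc n) \<noteq> 0" using z by (metis Ints_of_nat eq_iff_diff_eq_0)
  then show "w - of_real (pi * (real n + 1/2)) \<noteq> 0" unfolding 2 by auto
qed

lemma tan_sums:
  fixes w :: complex
  assumes "cos w \<noteq> 0"
  shows "(\<lambda>n. 2 * w / (w\<^sup>2 - (of_real (pi * (real n + 1/2)))\<^sup>2)) sums (- tan w)"
proof -
  define z where "z = w / of_real pi + 1 / 2"
  note shift = half_pi_shift[OF assms z_def]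
  have "(\<lambda>n. 1 / (z + of_nat n) + 1 / (z - of_nat (Suc n))) sums (of_real pi * cot (of_real pi * z))"
    unfolding sums_def by (rule cot_LIMSEQ[OF shift(1)])
  then have "(\<lambda>n. (1 / of_real pi) * (1 / (z + of_nat n) + 1 / (z - of_nat (Suc n))))
      sums ((1 / of_real pi) * (of_real pi * cot (of_real pi * z)))"
    by (rule sums_mult)
  moreover have "(1 / of_real pi) * (1 / (z + of_nat n) + 1 / (z - of_nat (Suc n)))
      = 2 * w / (w\<^sup>2 - (of_real (pi * (real n + 1/2)))\<^sup>2)" for n
  proof -
    define a where "a = complex_of_real (pi * (real n + 1/2))"
    have "w\<^sup>2 - a\<^sup>2 = (w + a) * (w - a)" by (simp add: algebra_simps power2_eq_square)
    then show ?thesis using shift(5,6)[of n] unfolding shift(3,4) a_def[symmetric]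
      by (simp add: divide_simps) (simp add: algebra_simps)
  qed
  ultimately show ?thesis
    unfolding shift(2) by (simp add: cot_def tan_def sin_plus_half_pi cos_plus_half_pi)
qed

text \<open>The two reciprocals are subtracted here instead of added, so the numerator is the pole
  and not \<open>w\<close>. The terms decay only like \<open>1 / n\<close> and the convergence is
  conditional.\<close>

lemma sec_sums:
  fixes w :: complex
  assumes "cos w \<noteq> 0"
  shows "(\<lambda>n. (-1) ^ n * (2 * of_real (pi * (real n + 1/2))) / (w\<^sup>2 - (of_real (pi * (real n + 1/2)))\<^sup>2))
           sums (- 1 / cos w)"
proof -
  define z where "z = w / of_real pi + 1 / 2"
  note shift = half_pi_shift[OF assms z_def]
  define f where "f = (\<lambda>n. (-1) ^ n * (1 / (z + of_nat n) - 1 / (z - of_nat (Suc n))))"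
  have lim: "(\<lambda>m. 1 / (z + of_nat m)) \<longlonglongrightarrow> 0"
    using tendsto_inverse_linear_0[of 1 z] by (simp add: add.commute)
  have lim': "(\<lambda>m. 1 / (z - of_nat (Suc m))) \<longlonglongrightarrow> 0"
    using tendsto_inverse_linear_0[of "-1" "z - 1"] by (simp add: algebra_simps)
  have "f \<longlonglongrightarrow> 0"
  proof (rule tendsto_norm_zero_cancel)
    have "(\<lambda>n. 1 / (z + of_nat n) - 1 / (z - of_nat (Suc n))) \<longlonglongrightarrow> 0 - 0"
      by (intro tendsto_diff lim' lim)
    then have "(\<lambda>n. norm (1 / (z + of_nat n) - 1 / (z - of_nat (Suc n)))) \<longlonglongrightarrow> 0"
      using tendsto_norm_zero by fastforce
    then show "(\<lambda>n. norm (f n)) \<longlonglongrightarrow> 0" by (simp add: f_def norm_mult norm_power)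
  qed
  with csc_LIMSEQ[OF shift(1)] have "f sums (of_real pi / sin (of_real pi * z))"
    unfolding f_def by (rule sums_even_partial_sums)
  then have "(\<lambda>n. (- 1 / of_real pi) * f n) sums ((- 1 / of_real pi) * (of_real pi / sin (of_real pi * z)))"
    by (rule sums_mult)
  moreover have "(- 1 / of_real pi) * f n
      = (-1) ^ n * (2 * of_real (pi * (real n + 1/2))) / (w\<^sup>2 - (of_real (pi * (real n + 1/2)))\<^sup>2)" for n
  proof -
    define a where "a = complex_of_real (pi * (real n + 1/2))"
    have "w\<^sup>2 - a\<^sup>2 = (w + a) * (w - a)" by (simp add: algebra_simps power2_eq_square)
    then show ?thesis using shift(5,6)[of n] unfolding f_def shift(3,4) a_def[symmetric]
      by (simp add: divide_simps) (simp add: algebra_simps)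
  qed
  ultimately show ?thesis
    unfolding shift(2) by (simp add: sin_plus_half_pi)
qed

subsection \<open>Mellin transforms of rational functions\<close>

lemma has_integral_Ioi_iff_Ici:
  fixes f :: "real \<Rightarrow> 'a::banach"
  shows "(f has_integral I) {a<..} \<longleftrightarrow> (f has_integral I) {a..}"
proof (rule has_integral_spike_set_eq)
  show "negligible {x \<in> {a<..} - {a..}. f x \<noteq> 0}"
    by (rule negligible_subset[of "{}"]) auto
  show "negligible {x \<in> {a..} - {a<..}. f x \<noteq> 0}"
    by (rule negligible_subset[of "{a}"]) auto
qed

lemma has_integral_Ioi_split:
  fixes f :: "real \<Rightarrow> 'a::banach"
  assumes "(f has_integral I) {a<..<b}" "(f has_integral J) {b<..}" "a \<le> b"
  shows "(f has_integral (I + J)) {a<..}"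
proof -
  have "(f has_integral (I + J)) ({a..b} \<union> {b..})"
    using assms(1,2) unfolding has_integral_Icc_iff_Ioo[symmetric] has_integral_Ioi_iff_Ici
    by (rule has_integral_Un) (rule negligible_subset[of "{b}"], auto)
  moreover have "{a..b} \<union> {b..} = {a..}" using assms(3) by auto
  ultimately show ?thesis by (simp add: has_integral_Ioi_iff_Ici)
qed

lemma powr_add_of_nat:
  assumes "t > 0"
  shows "complex_of_real t powr (z + of_nat n) = of_real t powr z * of_real t ^ n"
  using assms by (simp add: powr_add powr_nat')

lemma powr_diff_of_nat:
  assumes "t > 0"
  shows "complex_of_real t powr (z - of_nat n) = of_real t powr z / of_real t ^ n"
  using assms by (simp add: powr_diff powr_nat')

lemma norm_of_real_powr:
  assumes "t > 0"
  shows "norm (complex_of_real t powr z) = t powr Re z"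
  using assms by (simp add: norm_powr_real_powr)

lemma has_vector_derivative_powr_complex:
  assumes "t > 0" "e \<noteq> -1"
  shows "((\<lambda>t. complex_of_real t powr (e + 1) / (e + 1)) has_vector_derivative of_real t powr e) (at t within A)"
proof -
  have "e + 1 \<noteq> 0" using assms(2) by (metis add_eq_0_iff2)
  then show ?thesis using assms(1)
    by (auto intro!: derivative_eq_intros has_vector_derivative_real_field)
qed

text \<open>The integrand may be unbounded at \<open>0\<close>, but its antiderivative is continuous
  there, so the interior form of the fundamental theorem applies.\<close>

lemma has_integral_powr_complex_from_0:
  assumes "Re e > -1" "c > 0"
  shows "((\<lambda>t. complex_of_real t powr e) has_integral of_real c powr (e + 1) / (e + 1)) {0<..<c}"
proof -
  have e: "e \<noteq> -1" using assms(1) by auto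
  have "((\<lambda>t. complex_of_real t powr e) has_integral
       (of_real c powr (e + 1) / (e + 1) - of_real 0 powr (e + 1) / (e + 1))) {0..c}"
  proof (rule fundamental_theorem_of_calculus_interior)
    show "continuous_on {0..c} (\<lambda>t. complex_of_real t powr (e + 1) / (e + 1))"
      using assms by (auto intro!: continuous_intros simp: complex_eq_iff)
  qed (use assms e in \<open>auto intro!: has_vector_derivative_powr_complex\<close>)
  then show ?thesis by (simp add: has_integral_Icc_iff_Ioo)
qed

lemma has_integral_powr_complex_to_inf:
  assumes "Re e < -1" "c > 0"
  shows "((\<lambda>t. complex_of_real t powr e) has_integral - (of_real c powr (e + 1) / (e + 1))) {c<..}"
  unfolding has_integral_Ioi_iff_Ici
proof (rule has_integral_dominated_convergence)
  have e: "e \<noteq> -1" using assms(1) by auto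
  show "((\<lambda>t. if t \<in> {c..c + real k} then complex_of_real t powr e else 0) has_integral
      (of_real (c + real k) powr (e + 1) / (e + 1) - of_real c powr (e + 1) / (e + 1))) {c..}" for k
  proof (subst has_integral_restrict)
    show "((\<lambda>t. complex_of_real t powr e) has_integral
      (of_real (c + real k) powr (e + 1) / (e + 1) - of_real c powr (e + 1) / (e + 1))) {c..c + real k}"
      using assms e by (intro fundamental_theorem_of_calculus has_vector_derivative_powr_complex) auto
  qed auto
  show "(\<lambda>t. t powr Re e) integrable_on {c..}"
    using has_integral_powr_to_inf[OF assms] by blast
  show "\<forall>t\<in>{c..}. norm (if t \<in> {c..c + real k} then complex_of_real t powr e else 0) \<le> t powr Re e" for k
    using assms by (auto simp: norm_of_real_powr)
  show "\<forall>t\<in>{c..}. (\<lambda>k. if t \<in> {c..c + real k} then complex_of_real t powr e else 0) \<longlonglongrightarrow> complex_of_real t powr e"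
  proof
    fix t assume "t \<in> {c..}"
    moreover obtain N where "t - c \<le> real N" using real_arch_simple by blast
    ultimately have "\<forall>k\<ge>N. (if t \<in> {c..c + real k} then complex_of_real t powr e else 0) = complex_of_real t powr e"
      by auto
    then show "(\<lambda>k. if t \<in> {c..c + real k} then complex_of_real t powr e else 0) \<longlonglongrightarrow> complex_of_real t powr e"
      by (intro tendsto_eventually) (rule eventually_sequentiallyI[of N], blast)
  qed
  have "filterlim (\<lambda>k. c + real k) at_top sequentially"
    by (intro filterlim_tendsto_add_at_top[OF tendsto_const] filterlim_real_sequentially)
  then have "(\<lambda>k. complex_of_real (c + real k) powr (e + 1)) \<longlonglongrightarrow> 0"
    using assms(1) by (intro tendsto_neg_powr_complex_of_real) auto
  then have "(\<lambda>k. of_real (c + real k) powr (e + 1) / (e + 1) - of_real c powr (e + 1) / (e + 1))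
     \<longlonglongrightarrow> 0 / (e + 1) - of_real c powr (e + 1) / (e + 1)"
    using e by (intro tendsto_intros) (auto simp: add_eq_0_iff2)
  then show "(\<lambda>k. of_real (c + real k) powr (e + 1) / (e + 1) - of_real c powr (e + 1) / (e + 1))
     \<longlonglongrightarrow> - (of_real c powr (e + 1) / (e + 1))"
    by simp
qed

lemma minus_square_power: "(- (x\<^sup>2)) ^ n = (-1) ^ n * x ^ (2 * n)" for x :: real
  by (simp add: power_minus[of "x\<^sup>2"] power_mult)

lemma geometric_alternating_partial_sum:
  fixes x :: "'a::real_normed_field"
  assumes "1 + x \<noteq> 0"
  shows "(\<Sum>n<N. (- x) ^ n) = (1 - (- x) ^ N) / (1 + x)"
  using geometric_sum[of "- x" N] assms
  by (simp add: add_eq_0_iff2 divide_simps) (simp add: algebra_simps)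

text \<open>The bound does not deteriorate as \<open>x\<close> approaches \<open>1\<close>. This is
  what allows termwise integration up to the point \<open>t = b\<close>, where the geometric series
  itself ceases to converge.\<close>

lemma abs_alternating_geometric_le:
  fixes x :: real
  assumes "0 \<le> x" "x < 1"
  shows "\<bar>\<Sum>n<N. (- x) ^ n\<bar> \<le> 2"
proof -
  have "\<bar>x\<bar> ^ N \<le> 1" using assms by (simp add: power_le_one)
  then have "\<bar>1 - (- x) ^ N\<bar> \<le> 2"
    using abs_triangle_ineq4[of 1 "(- x) ^ N"] by (simp add: power_abs)
  moreover have "\<bar>1 - (- x) ^ N\<bar> / (1 + x) \<le> \<bar>1 - (- x) ^ N\<bar> / 1"
    using assms by (intro divide_left_mono) auto
  ultimately show ?thesis
    using assms by (subst geometric_alternating_partial_sum) (auto simp: abs_divide)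
qed

lemma alternating_geometric_LIMSEQ:
  fixes x :: real
  assumes "0 \<le> x" "x < 1"
  shows "(\<lambda>N. \<Sum>n<N. (- x) ^ n) \<longlonglongrightarrow> 1 / (1 + x)"
  using geometric_sums[of "- x"] assms by (simp add: sums_def)

text \<open>For \<open>t < b\<close> the integrand is expanded in powers of \<open>(t / b)^2\<close>
  and integrated term by term. The value is left as a limit of partial sums: that series converges
  only conditionally, and it has a closed form only together with its counterpart for
  \<open>t > b\<close>.\<close>

lemma
  fixes e :: complex and b :: real
  assumes e: "Re e > -1" and b: "b > 0"
  shows powr_over_quadratic_integrable_below: "(\<lambda>t. of_real t powr e / of_real (t\<^sup>2 + b\<^sup>2)) integrable_on {0<..<b}"
    and powr_over_quadratic_LIMSEQ_below: "(\<lambda>N. of_real b powr (e - 1) * (\<Sum>n<N. (-1) ^ n / (e + 1 + 2 * of_nat n))) \<longlonglongrightarrow>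
        integral {0<..<b} (\<lambda>t. of_real t powr e / of_real (t\<^sup>2 + b\<^sup>2))"
proof -
  define f where "f N t = complex_of_real t powr e / of_real (b\<^sup>2) * of_real (\<Sum>n<N. (- ((t / b)\<^sup>2)) ^ n)" for N t
  have f: "(f N has_integral (of_real b powr (e - 1) * (\<Sum>n<N. (-1) ^ n / (e + 1 + 2 * of_nat n)))) {0<..<b}" for N
  proof -
    have "((\<lambda>t. \<Sum>n<N. (-1) ^ n / of_real (b ^ (2 * n + 2)) * complex_of_real t powr (e + of_nat (2 * n))) has_integral
      (\<Sum>n<N. (-1) ^ n / of_real (b ^ (2 * n + 2)) *
         (of_real b powr (e + of_nat (2 * n) + 1) / (e + of_nat (2 * n) + 1)))) {0<..<b}"
      using e b by (intro has_integral_sum has_integral_mult_right has_integral_powr_complex_from_0) auto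
    moreover have "(-1) ^ n / of_real (b ^ (2 * n + 2)) *
         (of_real b powr (e + of_nat (2 * n) + 1) / (e + of_nat (2 * n) + 1)) =
         of_real b powr (e - 1) * ((-1) ^ n / (e + 1 + 2 * of_nat n))" for n
    proof -
      have "e + of_nat (2 * n) + 1 = (e - 1) + of_nat (2 * n + 2)" by simp
      then have "complex_of_real b powr (e + of_nat (2 * n) + 1) = of_real b powr (e - 1) * of_real b ^ (2 * n + 2)"
        using powr_add_of_nat[OF b] by presburger
      then show ?thesis using b by (simp add: add_ac)
    qed
    ultimately have "((\<lambda>t. \<Sum>n<N. (-1) ^ n / of_real (b ^ (2 * n + 2)) * complex_of_real t powr (e + of_nat (2 * n))) has_integral
      (of_real b powr (e - 1) * (\<Sum>n<N. (-1) ^ n / (e + 1 + 2 * of_nat n)))) {0<..<b}"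
      by (simp only: sum_distrib_left[symmetric])
    then show ?thesis
    proof (rule has_integral_eq[rotated])
      fix t assume "t \<in> {0<..<b}"
      then have t: "t > 0" by simp
      show "(\<Sum>n<N. (-1) ^ n / of_real (b ^ (2 * n + 2)) * complex_of_real t powr (e + of_nat (2 * n))) = f N t"
        unfolding f_def minus_square_power of_real_sum sum_distrib_left powr_add_of_nat[OF t]
        by (intro sum.cong refl)
           (simp add: power_divide power_add power2_eq_square mult_ac)
    qed
  qed
  have dom: "(\<lambda>t. 2 / b\<^sup>2 * (t powr Re e)) integrable_on {0<..<b}"
    using integrable_on_powr_from_0[OF e, of b] b
    by (intro integrable_on_mult_right) (auto simp: integrable_on_Icc_iff_Ioo)
  have le: "norm (f N t) \<le> 2 / b\<^sup>2 * (t powr Re e)" if "t \<in> {0<..<b}" for N t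
  proof -
    have "norm (f N t) = t powr Re e / b\<^sup>2 * \<bar>\<Sum>n<N. (- ((t / b)\<^sup>2)) ^ n\<bar>"
      using that unfolding f_def norm_mult norm_divide by (simp add: norm_of_real_powr norm_power del: of_real_sum)
    also have "\<dots> \<le> t powr Re e / b\<^sup>2 * 2"
      using that by (intro mult_left_mono abs_alternating_geometric_le) (auto simp: power_less_one_iff abs_square_less_1)
    finally show ?thesis by (simp add: mult.commute)
  qed
  have conv: "(\<lambda>N. f N t) \<longlonglongrightarrow> of_real t powr e / of_real (t\<^sup>2 + b\<^sup>2)" if "t \<in> {0<..<b}" for t
  proof -
    have "(\<lambda>N. f N t) \<longlonglongrightarrow> complex_of_real t powr e / of_real (b\<^sup>2) * of_real (1 / (1 + (t / b)\<^sup>2))"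
      unfolding f_def using that
      by (intro tendsto_intros alternating_geometric_LIMSEQ) (auto simp: power_less_one_iff abs_square_less_1)
    also have "complex_of_real t powr e / of_real (b\<^sup>2) * of_real (1 / (1 + (t / b)\<^sup>2))
        = complex_of_real t powr e * of_real (1 / b\<^sup>2 * (1 / (1 + (t / b)\<^sup>2)))"
      by simp
    also have "1 / b\<^sup>2 * (1 / (1 + (t / b)\<^sup>2)) = 1 / (t\<^sup>2 + b\<^sup>2)"
      using b by (simp add: field_simps power2_eq_square)
    finally show ?thesis by simp
  qed
  note dc = dominated_convergence[OF has_integral_integrable[OF f] dom le conv]
  show "(\<lambda>t. of_real t powr e / of_real (t\<^sup>2 + b\<^sup>2)) integrable_on {0<..<b}"
    by (rule dc(1))
  show "(\<lambda>N. of_real b powr (e - 1) * (\<Sum>n<N. (-1) ^ n / (e + 1 + 2 * of_nat n))) \<longlonglongrightarrow>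
        integral {0<..<b} (\<lambda>t. of_real t powr e / of_real (t\<^sup>2 + b\<^sup>2))"
    using dc(2) unfolding integral_unique[OF f] .
qed

text \<open>The counterpart for \<open>t > b\<close>, with the expansion in powers of
  \<open>(b / t)^2\<close>.\<close>

lemma
  fixes e :: complex and b :: real
  assumes e: "Re e < 1" and b: "b > 0"
  shows powr_over_quadratic_integrable_above: "(\<lambda>t. of_real t powr e / of_real (t\<^sup>2 + b\<^sup>2)) integrable_on {b<..}"
    and powr_over_quadratic_LIMSEQ_above: "(\<lambda>N. of_real b powr (e - 1) * (\<Sum>n<N. (-1) ^ n / (2 * of_nat n + 1 - e))) \<longlonglongrightarrow>
        integral {b<..} (\<lambda>t. of_real t powr e / of_real (t\<^sup>2 + b\<^sup>2))"
proof -
  define f where "f N t = complex_of_real t powr (e - 2) * of_real (\<Sum>n<N. (- ((b / t)\<^sup>2)) ^ n)" for N t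
  have f: "(f N has_integral (of_real b powr (e - 1) * (\<Sum>n<N. (-1) ^ n / (2 * of_nat n + 1 - e)))) {b<..}" for N
  proof -
    have "((\<lambda>t. \<Sum>n<N. (-1) ^ n * of_real (b ^ (2 * n)) * complex_of_real t powr (e - 2 - of_nat (2 * n))) has_integral
      (\<Sum>n<N. (-1) ^ n * of_real (b ^ (2 * n)) *
         (- (of_real b powr (e - 2 - of_nat (2 * n) + 1) / (e - 2 - of_nat (2 * n) + 1))))) {b<..}"
      using e b by (intro has_integral_sum has_integral_mult_right has_integral_powr_complex_to_inf) auto
    moreover have "(-1) ^ n * of_real (b ^ (2 * n)) *
         (- (of_real b powr (e - 2 - of_nat (2 * n) + 1) / (e - 2 - of_nat (2 * n) + 1))) =
         of_real b powr (e - 1) * ((-1) ^ n / (2 * of_nat n + 1 - e))" for n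
    proof -
      have 1: "e - 2 - of_nat (2 * n) + 1 = (e - 1) - of_nat (2 * n)" by simp
      have "complex_of_real b powr ((e - 1) - of_nat (2 * n)) = of_real b powr (e - 1) / of_real b ^ (2 * n)"
        using powr_diff_of_nat[OF b] by presburger
      moreover have "2 * of_nat n + 1 - e = - ((e - 1) - of_nat (2 * n))" by simp
      ultimately show ?thesis unfolding 1 using b by (simp only: minus_divide_right[symmetric]) simp
    qed
    ultimately have "((\<lambda>t. \<Sum>n<N. (-1) ^ n * of_real (b ^ (2 * n)) * complex_of_real t powr (e - 2 - of_nat (2 * n))) has_integral
      (of_real b powr (e - 1) * (\<Sum>n<N. (-1) ^ n / (2 * of_nat n + 1 - e)))) {b<..}"
      by (simp only: sum_distrib_left[symmetric])
    then show ?thesis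
    proof (rule has_integral_eq[rotated])
      fix t assume "t \<in> {b<..}"
      then have t: "t > 0" using b by simp
      show "(\<Sum>n<N. (-1) ^ n * of_real (b ^ (2 * n)) * complex_of_real t powr (e - 2 - of_nat (2 * n))) = f N t"
        unfolding f_def minus_square_power of_real_sum sum_distrib_left powr_diff_of_nat[OF t]
        by (intro sum.cong refl)
           (simp add: power_divide power_add power2_eq_square mult_ac)
    qed
  qed
  have dom: "(\<lambda>t. 2 * (t powr (Re e - 2))) integrable_on {b<..}"
  proof (intro integrable_on_mult_right)
    have "((\<lambda>t. t powr (Re e - 2)) has_integral - (b powr (Re e - 2 + 1)) / (Re e - 2 + 1)) {b..}"
      using e b by (intro has_integral_powr_to_inf) auto
    then show "(\<lambda>t. t powr (Re e - 2)) integrable_on {b<..}"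
      unfolding has_integral_Ioi_iff_Ici[symmetric] by blast
  qed
  have le: "norm (f N t) \<le> 2 * (t powr (Re e - 2))" if "t \<in> {b<..}" for N t
  proof -
    have "norm (f N t) = t powr (Re e - 2) * \<bar>\<Sum>n<N. (- ((b / t)\<^sup>2)) ^ n\<bar>"
      using that b unfolding f_def norm_mult norm_divide by (simp add: norm_of_real_powr norm_power del: of_real_sum)
    also have "\<dots> \<le> t powr (Re e - 2) * 2"
      using that b by (intro mult_left_mono abs_alternating_geometric_le) (auto simp: power_less_one_iff abs_square_less_1)
    finally show ?thesis by simp
  qed
  have conv: "(\<lambda>N. f N t) \<longlonglongrightarrow> of_real t powr e / of_real (t\<^sup>2 + b\<^sup>2)" if "t \<in> {b<..}" for t
  proof -
    have t: "t > 0" using that b by simp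
    have "(\<lambda>N. f N t) \<longlonglongrightarrow> complex_of_real t powr (e - 2) * of_real (1 / (1 + (b / t)\<^sup>2))"
      unfolding f_def using that b
      by (intro tendsto_intros alternating_geometric_LIMSEQ) (auto simp: power_less_one_iff abs_square_less_1)
    also have "complex_of_real t powr (e - 2) = of_real t powr e / of_real (t\<^sup>2)"
      using powr_diff_of_nat[OF t, of e 2] by simp
    also have "of_real t powr e / of_real (t\<^sup>2) * of_real (1 / (1 + (b / t)\<^sup>2)) =
        of_real t powr e * of_real (1 / t\<^sup>2 * (1 / (1 + (b / t)\<^sup>2)))"
      by simp
    also have "1 / t\<^sup>2 * (1 / (1 + (b / t)\<^sup>2)) = 1 / (t\<^sup>2 + b\<^sup>2)"
      using t by (simp add: field_simps power2_eq_square)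
    finally show ?thesis by simp
  qed
  note dc = dominated_convergence[OF has_integral_integrable[OF f] dom le conv]
  show "(\<lambda>t. of_real t powr e / of_real (t\<^sup>2 + b\<^sup>2)) integrable_on {b<..}"
    by (rule dc(1))
  show "(\<lambda>N. of_real b powr (e - 1) * (\<Sum>n<N. (-1) ^ n / (2 * of_nat n + 1 - e))) \<longlonglongrightarrow>
        integral {b<..} (\<lambda>t. of_real t powr e / of_real (t\<^sup>2 + b\<^sup>2))"
    using dc(2) unfolding integral_unique[OF f] .
qed

text \<open>For \<open>0 < Re z < 2\<close> this is the Mellin transform of
  \<open>1 / (t^2 + 1)\<close> at \<open>z\<close>. The closed form also makes sense outside this
  strip, where it is used after the integral has ceased to converge.\<close>

definition mellin_const :: "complex \<Rightarrow> complex" where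
  "mellin_const z = of_real pi / (2 * sin (of_real pi * z / 2))"

text \<open>The integrals below and above \<open>b\<close> contribute the terms
  \<open>1 / (z + 2 * n)\<close> and \<open>1 / (2 * n + 2 - z)\<close> with alternating signs;
  together they are the partial fractions of \<open>pi / sin\<close> at \<open>z / 2\<close>. Even
  partial sums suffice to identify the limit.\<close>

lemma has_integral_powr_over_quadratic:
  fixes z :: complex and b :: real
  assumes z: "0 < Re z" "Re z < 2" and b: "b > 0"
  shows "((\<lambda>t. of_real t powr (z - 1) / of_real (t\<^sup>2 + b\<^sup>2)) has_integral
           of_real b powr (z - 2) * mellin_const z) {0<..}"
proof -
  let ?g = "\<lambda>t. complex_of_real t powr (z - 1) / of_real (t\<^sup>2 + b\<^sup>2)"
  have e: "Re (z - 1) > -1" "Re (z - 1) < 1" using z by auto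
  have "(?g has_integral (integral {0<..<b} ?g + integral {b<..} ?g)) {0<..}"
    using powr_over_quadratic_integrable_below[OF e(1) b] powr_over_quadratic_integrable_above[OF e(2) b] b
    by (intro has_integral_Ioi_split integrable_integral) auto
  moreover have "integral {0<..<b} ?g + integral {b<..} ?g = of_real b powr (z - 2) * mellin_const z"
  proof (rule LIMSEQ_unique)
    let ?F = "\<lambda>N. of_real b powr (z - 1 - 1) * (\<Sum>n<N. (-1) ^ n / (z - 1 + 1 + 2 * of_nat n))
       + of_real b powr (z - 1 - 1) * (\<Sum>n<N. (-1) ^ n / (2 * of_nat n + 1 - (z - 1)))"
    have "?F \<longlonglongrightarrow> integral {0<..<b} ?g + integral {b<..} ?g"
      by (intro tendsto_add powr_over_quadratic_LIMSEQ_below powr_over_quadratic_LIMSEQ_above e b)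
    then show "(\<lambda>N. ?F (2 * N)) \<longlonglongrightarrow> integral {0<..<b} ?g + integral {b<..} ?g"
      using LIMSEQ_subseq_LIMSEQ[of ?F _ "\<lambda>N. 2 * N"] by (simp add: strict_mono_def o_def)
    have "z / 2 \<notin> \<int>"
    proof
      assume "z / 2 \<in> \<int>"
      then obtain k where "z / 2 = of_int k" by (auto elim: Ints_cases)
      then have "z = of_int (2 * k)" by simp
      then have "0 < k" "k < 1" using z by simp_all
      then show False by linarith
    qed
    from csc_LIMSEQ[OF this]
    have "(\<lambda>N. (of_real b powr (z - 2) / 2) * (\<Sum>n<2 * N. (-1) ^ n * (1 / (z / 2 + of_nat n) - 1 / (z / 2 - of_nat (Suc n)))))
        \<longlonglongrightarrow> (of_real b powr (z - 2) / 2) * (of_real pi / sin (of_real pi * (z / 2)))"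
      by (intro tendsto_mult tendsto_const)
    moreover have "(of_real b powr (z - 2) / 2) * (\<Sum>n<M. (-1) ^ n * (1 / (z / 2 + of_nat n) - 1 / (z / 2 - of_nat (Suc n))))
        = ?F M" for M
    proof -
      have "(-1) ^ n * (1 / (z / 2 + of_nat n) - 1 / (z / 2 - of_nat (Suc n))) =
          2 * ((-1) ^ n / (z - 1 + 1 + 2 * of_nat n) + (-1) ^ n / (2 * of_nat n + 1 - (z - 1)))" for n
      proof -
        have "1 / (z / 2 + of_nat n) = 2 / (z - 1 + 1 + 2 * of_nat n)" by (simp add: field_simps)
        moreover have "1 / (z / 2 - of_nat (Suc n)) = - (2 / (2 * of_nat n + 1 - (z - 1)))"
        proof -
          have "z / 2 - of_nat (Suc n) = - ((2 * of_nat n + 1 - (z - 1)) / 2)" by (simp add: field_simps)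
          then show ?thesis by (simp only: minus_divide_right[symmetric]) simp
        qed
        ultimately show ?thesis by (simp add: algebra_simps)
      qed
      then show ?thesis
        by (simp only: sum.distrib sum_distrib_left[symmetric]) (simp add: distrib_left)
    qed
    ultimately have "(\<lambda>N. ?F (2 * N)) \<longlonglongrightarrow> (of_real b powr (z - 2) / 2) * (of_real pi / sin (of_real pi * (z / 2)))"
      by (simp only:)
    then show "(\<lambda>N. ?F (2 * N)) \<longlonglongrightarrow> of_real b powr (z - 2) * mellin_const z"
      by (simp add: mellin_const_def)
  qed
  ultimately show ?thesis by simp
qed

lemma integrable_powr_over_quadratic:
  fixes x b :: real
  assumes "0 < x" "x < 2" "b > 0"
  shows "(\<lambda>t. t powr (x - 1) / (t\<^sup>2 + b\<^sup>2)) integrable_on {0<..}"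
proof -
  have "((\<lambda>t. Re (of_real t powr (of_real x - 1) / of_real (t\<^sup>2 + b\<^sup>2))) has_integral
           Re (of_real b powr (of_real x - 2) * mellin_const (of_real x))) {0<..}"
    using assms by (intro has_integral_Re has_integral_powr_over_quadratic) auto
  moreover have "Re (of_real t powr (of_real x - 1) / of_real (t\<^sup>2 + b\<^sup>2)) = t powr (x - 1) / (t\<^sup>2 + b\<^sup>2)"
    if "t \<in> {0<..}" for t
  proof -
    have "complex_of_real t powr (of_real x - 1) = of_real (t powr (x - 1))"
      using that powr_of_real[of t "x - 1"] by simp
    then show ?thesis by (simp only: of_real_divide[symmetric] Re_complex_of_real)
  qed
  ultimately show ?thesis
    by (rule has_integral_integrable[OF has_integral_eq[rotated]])
qed

lemma mellin_const_minus_2: "mellin_const (z - 2) = - mellin_const z"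
proof -
  have "of_real pi * (z - 2) / 2 = of_real pi * z / 2 - of_real pi" by (simp add: field_simps)
  then show ?thesis unfolding mellin_const_def by (simp only: sin_diff) simp
qed

lemma sin_half_pi_mult_neq_0:
  fixes z :: complex
  assumes "0 < Re z" "Re z < 4" "z \<noteq> 2"
  shows "sin (of_real pi * z / 2) \<noteq> 0"
proof
  assume "sin (of_real pi * z / 2) = 0"
  then obtain k :: int where "of_real pi * z / 2 = of_real (of_int k * pi)"
    using sin_eq_0 by blast
  then have "of_real pi * z = of_real pi * (2 * of_int k)" by (simp add: field_simps)
  then have z: "z = 2 * of_int k" by simp
  then have "0 < k" "k < 2" using assms by simp_all
  then have "k = 1" by linarith
  then show False using z assms(3) by simp
qed

lemma mellin_const_neq_0:
  assumes "0 < Re z" "Re z < 4" "z \<noteq> 2"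
  shows "mellin_const z \<noteq> 0"
  using sin_half_pi_mult_neq_0[OF assms] by (simp add: mellin_const_def)

text \<open>Partial fractions in \<open>t^2\<close>. For \<open>Re z < 2\<close> the two quadratics
  can be integrated separately. For \<open>Re z > 2\<close> those integrals diverge, and a factor
  \<open>t^2\<close> is moved into the weights, which replaces \<open>z\<close> by
  \<open>z - 2\<close>; the sign change of \<open>mellin_const\<close> restores the same formula. On
  the line \<open>Re z = 2\<close> neither decomposition converges and the value is a limit from the
  right. At \<open>z = 2\<close> itself the difference of powers vanishes and the sine in
  \<open>mellin_const\<close> is zero.\<close>

lemma has_integral_powr_over_two_quadratics:
  fixes z :: complex and b y :: real
  assumes z: "0 < Re z" "Re z < 4" "z \<noteq> 2" and b: "b > 0" and y: "y > 0" and ne_y: "b \<noteq> y"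
  shows "((\<lambda>t. of_real t powr (z - 1) / of_real ((t\<^sup>2 + b\<^sup>2) * (t\<^sup>2 + y\<^sup>2))) has_integral
           (of_real b powr (z - 2) - of_real y powr (z - 2)) / of_real (y\<^sup>2 - b\<^sup>2) * mellin_const z) {0<..}"
proof -
  have ne: "y\<^sup>2 - b\<^sup>2 \<noteq> 0" using b y ne_y by (simp add: power2_eq_iff)
  have pos: "t\<^sup>2 + b\<^sup>2 > 0" "t\<^sup>2 + y\<^sup>2 > 0" for t :: real
    using b y by (auto intro: add_nonneg_pos)
  have gt: "((\<lambda>t. of_real t powr (z - 1) / of_real ((t\<^sup>2 + b\<^sup>2) * (t\<^sup>2 + y\<^sup>2))) has_integral
           (of_real b powr (z - 2) - of_real y powr (z - 2)) / of_real (y\<^sup>2 - b\<^sup>2) * mellin_const z) {0<..}"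
    if z: "2 < Re z" "Re z < 4" for z
  proof -
    have "((\<lambda>t. 1 / of_real (y\<^sup>2 - b\<^sup>2) *
        (of_real (y\<^sup>2) * (of_real t powr (z - 2 - 1) / of_real (t\<^sup>2 + y\<^sup>2)) - of_real (b\<^sup>2) * (of_real t powr (z - 2 - 1) / of_real (t\<^sup>2 + b\<^sup>2)))) has_integral
        1 / of_real (y\<^sup>2 - b\<^sup>2) * (of_real (y\<^sup>2) * (of_real y powr (z - 2 - 2) * mellin_const (z - 2)) - of_real (b\<^sup>2) * (of_real b powr (z - 2 - 2) * mellin_const (z - 2)))) {0<..}"
      using z y b by (intro has_integral_mult_right has_integral_diff has_integral_powr_over_quadratic) auto
    moreover have "of_real (c\<^sup>2) * (of_real c powr (z - 2 - 2) * mellin_const (z - 2)) = - (of_real c powr (z - 2) * mellin_const z)"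
      if "c > 0" for c
      using powr_diff_of_nat[OF that, of "z - 2" 2] that by (simp add: mellin_const_minus_2)
    ultimately have "((\<lambda>t. 1 / of_real (y\<^sup>2 - b\<^sup>2) *
        (of_real (y\<^sup>2) * (of_real t powr (z - 2 - 1) / of_real (t\<^sup>2 + y\<^sup>2)) - of_real (b\<^sup>2) * (of_real t powr (z - 2 - 1) / of_real (t\<^sup>2 + b\<^sup>2)))) has_integral
        1 / of_real (y\<^sup>2 - b\<^sup>2) * (- (of_real y powr (z - 2) * mellin_const z) - - (of_real b powr (z - 2) * mellin_const z))) {0<..}"
      using b y by simp
    also have "1 / of_real (y\<^sup>2 - b\<^sup>2) * (- (of_real y powr (z - 2) * mellin_const z) - - (of_real b powr (z - 2) * mellin_const z))
        = (of_real b powr (z - 2) - of_real y powr (z - 2)) / of_real (y\<^sup>2 - b\<^sup>2) * mellin_const z"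
      by (simp add: algebra_simps diff_divide_distrib)
    finally show ?thesis
    proof (rule has_integral_eq[rotated])
      fix t :: real assume "t \<in> {0<..}"
      then have t: "t > 0" by simp
      have "complex_of_real t powr (z - 2 - 1) = of_real t powr (z - 1) / of_real (t\<^sup>2)"
        using powr_diff_of_nat[OF t, of "z - 1" 2] by (simp add: algebra_simps)
      then have "1 / of_real (y\<^sup>2 - b\<^sup>2) *
        (of_real (y\<^sup>2) * (of_real t powr (z - 2 - 1) / of_real (t\<^sup>2 + y\<^sup>2)) - of_real (b\<^sup>2) * (of_real t powr (z - 2 - 1) / of_real (t\<^sup>2 + b\<^sup>2)))
        = of_real t powr (z - 1) * of_real (1 / (y\<^sup>2 - b\<^sup>2) * (y\<^sup>2 / (t\<^sup>2 * (t\<^sup>2 + y\<^sup>2)) - b\<^sup>2 / (t\<^sup>2 * (t\<^sup>2 + b\<^sup>2))))"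
        by (simp add: algebra_simps)
      also have "1 / (y\<^sup>2 - b\<^sup>2) * (y\<^sup>2 / (t\<^sup>2 * (t\<^sup>2 + y\<^sup>2)) - b\<^sup>2 / (t\<^sup>2 * (t\<^sup>2 + b\<^sup>2))) = 1 / ((t\<^sup>2 + b\<^sup>2) * (t\<^sup>2 + y\<^sup>2))"
      proof -
        have "y\<^sup>2 / (t\<^sup>2 * (t\<^sup>2 + y\<^sup>2)) - b\<^sup>2 / (t\<^sup>2 * (t\<^sup>2 + b\<^sup>2)) = (t\<^sup>2 * (y\<^sup>2 - b\<^sup>2)) / (t\<^sup>2 * ((t\<^sup>2 + b\<^sup>2) * (t\<^sup>2 + y\<^sup>2)))"
          using pos[of t] t by (simp add: divide_simps) (simp add: algebra_simps)
        then show ?thesis using t ne by simp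
      qed
      finally show "1 / of_real (y\<^sup>2 - b\<^sup>2) *
        (of_real (y\<^sup>2) * (of_real t powr (z - 2 - 1) / of_real (t\<^sup>2 + y\<^sup>2)) - of_real (b\<^sup>2) * (of_real t powr (z - 2 - 1) / of_real (t\<^sup>2 + b\<^sup>2)))
        = of_real t powr (z - 1) / of_real ((t\<^sup>2 + b\<^sup>2) * (t\<^sup>2 + y\<^sup>2))" by simp
    qed
  qed
  consider "Re z < 2" | "Re z > 2" | "Re z = 2" by linarith
  then show ?thesis
  proof cases
    case 1
    have "((\<lambda>t. 1 / of_real (y\<^sup>2 - b\<^sup>2) *
        (of_real t powr (z - 1) / of_real (t\<^sup>2 + b\<^sup>2) - of_real t powr (z - 1) / of_real (t\<^sup>2 + y\<^sup>2))) has_integral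
        1 / of_real (y\<^sup>2 - b\<^sup>2) * (of_real b powr (z - 2) * mellin_const z - of_real y powr (z - 2) * mellin_const z)) {0<..}"
      using z y b 1 by (intro has_integral_mult_right has_integral_diff has_integral_powr_over_quadratic) auto
    also have "1 / of_real (y\<^sup>2 - b\<^sup>2) * (of_real b powr (z - 2) * mellin_const z - of_real y powr (z - 2) * mellin_const z)
        = (of_real b powr (z - 2) - of_real y powr (z - 2)) / of_real (y\<^sup>2 - b\<^sup>2) * mellin_const z"
      by (simp add: algebra_simps diff_divide_distrib)
    finally show ?thesis
    proof (rule has_integral_eq[rotated])
      fix t :: real assume "t \<in> {0<..}"
      have "1 / of_real (y\<^sup>2 - b\<^sup>2) *
        (of_real t powr (z - 1) / of_real (t\<^sup>2 + b\<^sup>2) - of_real t powr (z - 1) / of_real (t\<^sup>2 + y\<^sup>2))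
        = of_real t powr (z - 1) * of_real (1 / (y\<^sup>2 - b\<^sup>2) * (1 / (t\<^sup>2 + b\<^sup>2) - 1 / (t\<^sup>2 + y\<^sup>2)))"
        by (simp add: algebra_simps)
      also have "1 / (y\<^sup>2 - b\<^sup>2) * (1 / (t\<^sup>2 + b\<^sup>2) - 1 / (t\<^sup>2 + y\<^sup>2)) = 1 / ((t\<^sup>2 + b\<^sup>2) * (t\<^sup>2 + y\<^sup>2))"
      proof -
        have "1 / (t\<^sup>2 + b\<^sup>2) - 1 / (t\<^sup>2 + y\<^sup>2) = (y\<^sup>2 - b\<^sup>2) / ((t\<^sup>2 + b\<^sup>2) * (t\<^sup>2 + y\<^sup>2))"
          by (subst diff_frac_eq) (use b y in auto)
        then show ?thesis using ne by simp
      qed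
      finally show "1 / of_real (y\<^sup>2 - b\<^sup>2) *
        (of_real t powr (z - 1) / of_real (t\<^sup>2 + b\<^sup>2) - of_real t powr (z - 1) / of_real (t\<^sup>2 + y\<^sup>2))
        = of_real t powr (z - 1) / of_real ((t\<^sup>2 + b\<^sup>2) * (t\<^sup>2 + y\<^sup>2))" by simp
    qed
  next
    case 2
    then show ?thesis using gt z by blast
  next
    case 3
    \<comment> \<open>The points approach \<open>z\<close> from the half-plane covered by
      \<open>gt\<close>. The offset \<open>2\<close> keeps their real parts between \<open>2\<close>
      and \<open>3\<close>, so that the powers of \<open>t\<close> below are at most
      \<open>t + t^2\<close>.\<close>
    define u where "u k = z + of_real (1 / real (k + 2))" for k :: nat
    have u: "2 < Re (u k)" "Re (u k) < 3" for k
      using 3 by (auto simp: u_def field_simps)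
    have "(\<lambda>k. 1 / real (k + 2)) \<longlonglongrightarrow> 0"
      using LIMSEQ_ignore_initial_segment[OF lim_1_over_n, of 2] .
    then have "u \<longlonglongrightarrow> z + of_real 0"
      unfolding u_def by (intro tendsto_intros)
    then have lim: "u \<longlonglongrightarrow> z" by simp
    show ?thesis
    proof (rule has_integral_dominated_convergence)
      show "((\<lambda>t. of_real t powr (u k - 1) / of_real ((t\<^sup>2 + b\<^sup>2) * (t\<^sup>2 + y\<^sup>2))) has_integral
           (of_real b powr (u k - 2) - of_real y powr (u k - 2)) / of_real (y\<^sup>2 - b\<^sup>2) * mellin_const (u k)) {0<..}" for k
        using u[of k] by (intro gt) auto
      \<comment> \<open>The constant is chosen so that \<open>1 + 2 * t^2\<close> is at most
        \<open>(2 + 1 / b^2) * (t^2 + b^2)\<close>: one quadratic cancels, and the integrable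
        function \<open>1 / (t^2 + y^2)\<close> dominates for all \<open>k\<close>.\<close>
      have "(\<lambda>t. (2 + 1 / b\<^sup>2) * (t powr (1 - 1) / (t\<^sup>2 + y\<^sup>2))) integrable_on {0<..}"
        using y by (intro integrable_on_mult_right integrable_powr_over_quadratic) auto
      then show "(\<lambda>t. (2 + 1 / b\<^sup>2) / (t\<^sup>2 + y\<^sup>2)) integrable_on {0<..}"
        by (rule integrable_eq) auto
      show "\<forall>t\<in>{0<..}. norm (of_real t powr (u k - 1) / of_real ((t\<^sup>2 + b\<^sup>2) * (t\<^sup>2 + y\<^sup>2)) :: complex)
          \<le> (2 + 1 / b\<^sup>2) / (t\<^sup>2 + y\<^sup>2)" for k
      proof
        fix t :: real assume "t \<in> {0<..}"
        then have t: "t > 0" by simp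
        have "t powr (Re (u k) - 1) \<le> t + t\<^sup>2"
        proof (cases "t \<le> 1")
          case True
          then have "t powr (Re (u k) - 1) \<le> t powr 1" using u[of k] t by (intro powr_mono') auto
          then show ?thesis using t by (auto intro: order_trans)
        next
          case False
          then have "t powr (Re (u k) - 1) \<le> t powr 2" using u[of k] t by (intro powr_mono) auto
          then show ?thesis using t by simp
        qed
        also have "t + t\<^sup>2 \<le> 1 + 2 * t\<^sup>2"
          using zero_le_power2[of "t - 1 / 2"] by (simp add: power2_eq_square algebra_simps)
        also have "\<dots> \<le> (2 + 1 / b\<^sup>2) * (t\<^sup>2 + b\<^sup>2)"
          using b by (simp add: algebra_simps)
        finally have "t powr (Re (u k) - 1) / ((t\<^sup>2 + b\<^sup>2) * (t\<^sup>2 + y\<^sup>2)) \<le> (2 + 1 / b\<^sup>2) * (t\<^sup>2 + b\<^sup>2) / ((t\<^sup>2 + b\<^sup>2) * (t\<^sup>2 + y\<^sup>2))"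
          using pos[of t] by (intro divide_right_mono) auto
        also have "\<dots> = (2 + 1 / b\<^sup>2) / (t\<^sup>2 + y\<^sup>2)" using b by simp
        finally show "norm (of_real t powr (u k - 1) / of_real ((t\<^sup>2 + b\<^sup>2) * (t\<^sup>2 + y\<^sup>2)) :: complex)
          \<le> (2 + 1 / b\<^sup>2) / (t\<^sup>2 + y\<^sup>2)"
          using t pos[of t] unfolding norm_divide norm_of_real by (simp add: norm_of_real_powr abs_mult)
      qed
      show "\<forall>t\<in>{0<..}. (\<lambda>k. of_real t powr (u k - 1) / of_real ((t\<^sup>2 + b\<^sup>2) * (t\<^sup>2 + y\<^sup>2)))
         \<longlonglongrightarrow> complex_of_real t powr (z - 1) / of_real ((t\<^sup>2 + b\<^sup>2) * (t\<^sup>2 + y\<^sup>2))"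
      proof
        fix t :: real assume "t \<in> {0<..}"
        then show "(\<lambda>k. of_real t powr (u k - 1) / of_real ((t\<^sup>2 + b\<^sup>2) * (t\<^sup>2 + y\<^sup>2)))
         \<longlonglongrightarrow> complex_of_real t powr (z - 1) / of_real ((t\<^sup>2 + b\<^sup>2) * (t\<^sup>2 + y\<^sup>2))"
          using pos[of t] by (intro tendsto_intros lim) (auto simp: complex_eq_iff)
      qed
      show "(\<lambda>k. (of_real b powr (u k - 2) - of_real y powr (u k - 2)) / of_real (y\<^sup>2 - b\<^sup>2) * mellin_const (u k))
         \<longlonglongrightarrow> (of_real b powr (z - 2) - of_real y powr (z - 2)) / of_real (y\<^sup>2 - b\<^sup>2) * mellin_const z"
        unfolding mellin_const_def
        using b y ne sin_half_pi_mult_neq_0[OF z]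
        by (intro tendsto_intros lim) (auto simp: complex_eq_iff)
    qed
  qed
qed

section \<open>Gamma integrals and termwise Mellin transforms\<close>

lemma Gamma_neq_0: "Re s > 0 \<Longrightarrow> Gamma s \<noteq> 0" for s :: complex
  by (auto simp: Gamma_eq_zero_iff elim!: nonpos_Ints_cases)

lemma has_integral_Gamma_scaled:
  fixes s :: complex and a :: real
  assumes s: "Re s > 0" and a: "a > 0"
  shows "((\<lambda>t. of_real t powr (s - 1) * of_real (exp (- (a * t)))) has_integral Gamma s * of_real a powr (- s)) {0<..}"
proof -
  define F where "F = (\<lambda>t. complex_of_real t powr (s - 1) / of_real (exp t))"
  have F: "F absolutely_integrable_on {0<..}"
    using absolutely_integrable_Gamma_integral'[OF s] by (simp add: F_def)
  have int: "integral {0<..} F = Gamma s"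
    using Gamma_integral_complex'[OF s] unfolding F_def by (rule integral_unique)
  have img: "(\<lambda>t. a * t) ` {0<..} = {0<..}"
  proof
    show "{0<..} \<subseteq> (\<lambda>t. a * t) ` {0<..}"
    proof
      fix x :: real assume "x \<in> {0<..}"
      then show "x \<in> (\<lambda>t. a * t) ` {0<..}" using a by (intro image_eqI[of _ _ "x / a"]) auto
    qed
  qed (use a in auto)
  \<comment> \<open>The substitution \<open>a * t\<close> is carried out on the real and imaginary
    parts, for which \<open>h\<close> stands, and the complex integral is reassembled from its
    components.\<close>
  have part: "((\<lambda>t. a * h (F (a * t))) has_integral h (Gamma s)) {0<..}" if h: "bounded_linear h" for h :: "complex \<Rightarrow> real"
  proof -
    have "(h \<circ> F) absolutely_integrable_on {0<..}"
      using F h by (rule absolutely_integrable_linear)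
    moreover have "integral {0<..} (h \<circ> F) = h (Gamma s)"
      using integral_linear[OF _ h, of F "{0<..}"] F int by (auto simp: absolutely_integrable_on_def)
    moreover have "(\<lambda>x. \<bar>a\<bar> * (h \<circ> F) (a * x)) absolutely_integrable_on {0<..} \<and>
           integral {0<..} (\<lambda>x. \<bar>a\<bar> * (h \<circ> F) (a * x)) = h (Gamma s)
     \<longleftrightarrow> (h \<circ> F) absolutely_integrable_on ((\<lambda>t. a * t) ` {0<..}) \<and> integral ((\<lambda>t. a * t) ` {0<..}) (h \<circ> F) = h (Gamma s)"
      using a by (intro has_absolute_integral_change_of_variables_1')
          (auto intro!: derivative_eq_intros inj_onI)
    ultimately show ?thesis
      unfolding img using a by (auto simp: absolutely_integrable_on_def has_integral_iff)
  qed
  have "((\<lambda>t. of_real a * F (a * t)) has_integral Gamma s) {0<..}"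
    unfolding has_integral_componentwise_iff[of "\<lambda>t. of_real a * F (a * t)"]
    using part[OF bounded_linear_Re] part[OF bounded_linear_Im] by (simp add: Basis_complex_def inner_complex_def)
  then have "((\<lambda>t. of_real a powr (- s) * (of_real a * F (a * t))) has_integral of_real a powr (- s) * Gamma s) {0<..}"
    by (rule has_integral_mult_right)
  moreover have "of_real a powr (- s) * (of_real a * F (a * t)) = of_real t powr (s - 1) * of_real (exp (- (a * t)))"
    if "t \<in> {0<..}" for t
  proof -
    have "complex_of_real (a * t) powr (s - 1) = of_real a powr (s - 1) * of_real t powr (s - 1)"
      using a that by (simp add: powr_times_real)
    moreover have "complex_of_real a powr (- s) * (of_real a * of_real a powr (s - 1)) = 1"
    proof -
      have "complex_of_real a * of_real a powr (s - 1) = of_real a powr s"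
        using a by (simp add: powr_diff)
      then show ?thesis using a by (simp add: powr_minus)
    qed
    ultimately show ?thesis
      unfolding F_def by (simp add: exp_minus divide_inverse mult.assoc[symmetric])
  qed
  ultimately have "((\<lambda>t. of_real t powr (s - 1) * of_real (exp (- (a * t)))) has_integral of_real a powr (- s) * Gamma s) {0<..}"
    by (rule has_integral_eq[rotated])
  then show ?thesis by (simp add: mult.commute)
qed

lemma integrable_powr_exp:
  fixes x a :: real
  assumes "x > 0" "a > 0"
  shows "(\<lambda>t. t powr (x - 1) * exp (- (a * t))) integrable_on {0<..}"
proof -
  have "((\<lambda>t. Re (of_real t powr (of_real x - 1) * of_real (exp (- (a * t))))) has_integral
           Re (Gamma (of_real x) * of_real a powr (- of_real x))) {0<..}"
    using assms by (intro has_integral_Re has_integral_Gamma_scaled) auto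
  moreover have "Re (of_real t powr (of_real x - 1) * of_real (exp (- (a * t)))) = t powr (x - 1) * exp (- (a * t))"
    if "t \<in> {0<..}" for t
  proof -
    have "complex_of_real t powr (of_real x - 1) = of_real (t powr (x - 1))"
      using that powr_of_real[of t "x - 1"] by simp
    then show ?thesis by (simp only: of_real_mult[symmetric] Re_complex_of_real)
  qed
  ultimately show ?thesis
    by (rule has_integral_integrable[OF has_integral_eq[rotated]])
qed

text \<open>The hypothesis \<open>bound\<close> concerns all partial sums and not only
  \<open>K\<close>: it is the dominating function under which the termwise Gamma integrals converge,
  even where the Dirichlet series is not absolutely convergent. The parameter \<open>q\<close>
  measures the singularity at \<open>0\<close> and forces \<open>Re s > q\<close>; \<open>r\<close>
  provides decay at infinity.\<close>

lemma
  fixes s :: complex and c a :: "nat \<Rightarrow> real" and K :: "real \<Rightarrow> real"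
  assumes s: "Re s > q" "q \<ge> 0" and a: "\<And>n. a n > 0" and r: "r > 0"
    and K: "\<And>t. t > 0 \<Longrightarrow> (\<lambda>n. c n * exp (- (a n * t))) sums K t"
    and bound: "\<And>N t. t > 0 \<Longrightarrow> \<bar>\<Sum>n<N. c n * exp (- (a n * t))\<bar> \<le> A * (t powr (- q) * exp (- (r * t)))"
  shows mellin_integrable: "(\<lambda>t. of_real t powr (s - 1) * of_real (K t)) integrable_on {0<..}"
    and mellin_sums: "(\<lambda>n. of_real (c n) * of_real (a n) powr (- s)) sums
          (integral {0<..} (\<lambda>t. of_real t powr (s - 1) * of_real (K t)) / Gamma s)"
proof -
  define f where "f N t = complex_of_real t powr (s - 1) * of_real (\<Sum>n<N. c n * exp (- (a n * t)))" for N t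
  have f: "(f N has_integral (\<Sum>n<N. of_real (c n) * (Gamma s * of_real (a n) powr (- s)))) {0<..}" for N
  proof -
    have "((\<lambda>t. \<Sum>n<N. of_real (c n) * (complex_of_real t powr (s - 1) * of_real (exp (- (a n * t))))) has_integral
        (\<Sum>n<N. of_real (c n) * (Gamma s * of_real (a n) powr (- s)))) {0<..}"
      using s a by (intro has_integral_sum has_integral_mult_right has_integral_Gamma_scaled) auto
    then show ?thesis
      by (rule has_integral_eq[rotated]) (simp add: f_def sum_distrib_left mult_ac)
  qed
  have dom: "(\<lambda>t. A * (t powr (Re s - q - 1) * exp (- (r * t)))) integrable_on {0<..}"
    using s r by (intro integrable_on_mult_right integrable_powr_exp) auto
  have le: "norm (f N t) \<le> A * (t powr (Re s - q - 1) * exp (- (r * t)))" if "t \<in> {0<..}" for N t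
  proof -
    have t: "t > 0" using that by simp
    have "norm (f N t) = t powr (Re s - 1) * \<bar>\<Sum>n<N. c n * exp (- (a n * t))\<bar>"
      using t unfolding f_def norm_mult norm_of_real by (simp add: norm_of_real_powr)
    also have "\<dots> \<le> t powr (Re s - 1) * (A * (t powr (- q) * exp (- (r * t))))"
      by (intro mult_left_mono bound t) auto
    also have "\<dots> = A * ((t powr (Re s - 1) * t powr (- q)) * exp (- (r * t)))" by simp
    also have "t powr (Re s - 1) * t powr (- q) = t powr (Re s - q - 1)"
      by (simp add: powr_add[symmetric] algebra_simps)
    finally show ?thesis .
  qed
  have conv: "(\<lambda>N. f N t) \<longlonglongrightarrow> of_real t powr (s - 1) * of_real (K t)" if "t \<in> {0<..}" for t
    using that K[of t] unfolding f_def sums_def by (intro tendsto_intros) auto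
  note dc = dominated_convergence[OF has_integral_integrable[OF f] dom le conv]
  show "(\<lambda>t. of_real t powr (s - 1) * of_real (K t)) integrable_on {0<..}"
    by (rule dc(1))
  have Gamma: "Gamma s \<noteq> 0"
    using s by (intro Gamma_neq_0) auto
  have "(\<lambda>N. (\<Sum>n<N. of_real (c n) * (Gamma s * of_real (a n) powr (- s))) / Gamma s) \<longlonglongrightarrow>
        integral {0<..} (\<lambda>t. of_real t powr (s - 1) * of_real (K t)) / Gamma s"
    using dc(2) Gamma unfolding integral_unique[OF f] by (intro tendsto_divide tendsto_const)
  then show "(\<lambda>n. of_real (c n) * of_real (a n) powr (- s)) sums
          (integral {0<..} (\<lambda>t. of_real t powr (s - 1) * of_real (K t)) / Gamma s)"
    using Gamma unfolding sums_def sum_divide_distrib by simp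
qed

text \<open>Termwise integration of a Mittag-Leffler series against the damping. The exponent
  \<open>p\<close> is the power of \<open>t\<close> in its numerators, \<open>1\<close> for
  \<open>coth\<close>, \<open>1 / sinh\<close> and \<open>tanh\<close> and \<open>0\<close> for
  \<open>1 / cosh\<close>, and it moves the argument of the transform to \<open>s + p\<close>. After
  division by \<open>mellin_const (s + p)\<close> each term is a difference of a power of
  \<open>b n\<close> and a power of \<open>y\<close>; the sum \<open>T\<close>, which is the
  expansion at the real point \<open>y\<close>, supplies exactly what cancels the second
  one.\<close>

lemma partial_fractions_mellin_sums:
  fixes s :: complex and c b :: "nat \<Rightarrow> real" and K :: "real \<Rightarrow> real" and p :: nat
  assumes q: "0 < Re s - q" "Re s - q < 2"
    and s: "0 < Re s + real p" "Re s + real p < 4" "s + of_nat p \<noteq> 2"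
    and b: "\<And>n. b n > 0" and y: "y > 0" and ne_y: "\<And>n. b n \<noteq> y"
    and K: "\<And>t. t > 0 \<Longrightarrow> (\<lambda>n. c n * (t ^ p / (t\<^sup>2 + (b n)\<^sup>2))) sums K t"
    and bound: "\<And>N t. t > 0 \<Longrightarrow> \<bar>\<Sum>n<N. c n * (t ^ p / (t\<^sup>2 + (b n)\<^sup>2))\<bar> \<le> A * t powr (- q)"
    and T: "(\<lambda>n. of_real (c n) / of_real (y\<^sup>2 - (b n)\<^sup>2)) sums (T :: complex)"
  shows "(\<lambda>n. of_real (c n) * of_real (b n) powr (s + of_nat p - 2) / of_real (y\<^sup>2 - (b n)\<^sup>2)) sums
         (integral {0<..} (\<lambda>t. of_real t powr (s - 1) * of_real (K t / (t\<^sup>2 + y\<^sup>2))) / mellin_const (s + of_nat p)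
          + of_real y powr (s + of_nat p - 2) * T)"
proof -
  define f where "f N t = complex_of_real t powr (s - 1) * of_real ((\<Sum>n<N. c n * (t ^ p / (t\<^sup>2 + (b n)\<^sup>2))) / (t\<^sup>2 + y\<^sup>2))" for N t
  define I where "I = (\<lambda>n. (of_real (b n) powr (s + of_nat p - 2) - of_real y powr (s + of_nat p - 2)) / of_real (y\<^sup>2 - (b n)\<^sup>2) * mellin_const (s + of_nat p))"
  have M: "mellin_const (s + of_nat p) \<noteq> 0"
    using s by (intro mellin_const_neq_0) auto
  have f: "(f N has_integral (\<Sum>n<N. of_real (c n) * I n)) {0<..}" for N
  proof -
    have "((\<lambda>t. \<Sum>n<N. of_real (c n) * (complex_of_real t powr (s + of_nat p - 1) / of_real ((t\<^sup>2 + (b n)\<^sup>2) * (t\<^sup>2 + y\<^sup>2)))) has_integral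
        (\<Sum>n<N. of_real (c n) * I n)) {0<..}"
      unfolding I_def using s b y ne_y
      by (intro has_integral_sum has_integral_mult_right has_integral_powr_over_two_quadratics) auto
    then show ?thesis
    proof (rule has_integral_eq[rotated])
      fix t :: real assume "t \<in> {0<..}"
      then have t: "t > 0" by simp
      have "complex_of_real t powr (s + of_nat p - 1) = of_real t powr (s - 1) * of_real t ^ p"
        using powr_add_of_nat[OF t, of "s - 1" p] by (simp add: algebra_simps)
      then show "(\<Sum>n<N. of_real (c n) * (complex_of_real t powr (s + of_nat p - 1) / of_real ((t\<^sup>2 + (b n)\<^sup>2) * (t\<^sup>2 + y\<^sup>2)))) = f N t"
        unfolding f_def sum_divide_distrib of_real_sum sum_distrib_left by (simp add: mult_ac)
    qed
  qed
  have dom: "(\<lambda>t. A * (t powr (Re s - q - 1) / (t\<^sup>2 + y\<^sup>2))) integrable_on {0<..}"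
    using q y by (intro integrable_on_mult_right integrable_powr_over_quadratic) auto
  have le: "norm (f N t) \<le> A * (t powr (Re s - q - 1) / (t\<^sup>2 + y\<^sup>2))" if "t \<in> {0<..}" for N t
  proof -
    have t: "t > 0" using that by simp
    have "norm (f N t) = t powr (Re s - 1) * (\<bar>\<Sum>n<N. c n * (t ^ p / (t\<^sup>2 + (b n)\<^sup>2))\<bar> / (t\<^sup>2 + y\<^sup>2))"
      using t y unfolding f_def norm_mult norm_of_real abs_divide by (simp add: norm_of_real_powr add_nonneg_nonneg)
    also have "\<dots> \<le> t powr (Re s - 1) * (A * t powr (- q) / (t\<^sup>2 + y\<^sup>2))"
      by (intro mult_left_mono divide_right_mono bound t) auto
    also have "\<dots> = A * ((t powr (Re s - 1) * t powr (- q)) / (t\<^sup>2 + y\<^sup>2))" by simp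
    also have "t powr (Re s - 1) * t powr (- q) = t powr (Re s - q - 1)"
      by (simp add: powr_add[symmetric] algebra_simps)
    finally show ?thesis .
  qed
  have conv: "(\<lambda>N. f N t) \<longlonglongrightarrow> of_real t powr (s - 1) * of_real (K t / (t\<^sup>2 + y\<^sup>2))" if "t \<in> {0<..}" for t
  proof -
    have "t\<^sup>2 + y\<^sup>2 \<noteq> 0" using y by (simp add: sum_power2_eq_zero_iff)
    then show ?thesis
      using that K[of t] unfolding f_def sums_def by (intro tendsto_intros) auto
  qed
  note dc = dominated_convergence[OF has_integral_integrable[OF f] dom le conv]
  have "(\<lambda>n. of_real (c n) * I n) sums (integral {0<..} (\<lambda>t. of_real t powr (s - 1) * of_real (K t / (t\<^sup>2 + y\<^sup>2))))"
    using dc(2) unfolding sums_def integral_unique[OF f] .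
  from sums_add[OF sums_divide[OF this, of "mellin_const (s + of_nat p)"] sums_mult[OF T, of "of_real y powr (s + of_nat p - 2)"]]
  have "(\<lambda>n. of_real (c n) * I n / mellin_const (s + of_nat p) + of_real y powr (s + of_nat p - 2) * (of_real (c n) / of_real (y\<^sup>2 - (b n)\<^sup>2))) sums
     (integral {0<..} (\<lambda>t. of_real t powr (s - 1) * of_real (K t / (t\<^sup>2 + y\<^sup>2))) / mellin_const (s + of_nat p)
          + of_real y powr (s + of_nat p - 2) * T)" .
  moreover have "of_real (c n) * I n / mellin_const (s + of_nat p) + of_real y powr (s + of_nat p - 2) * (of_real (c n) / of_real (y\<^sup>2 - (b n)\<^sup>2))
     = of_real (c n) * of_real (b n) powr (s + of_nat p - 2) / of_real (y\<^sup>2 - (b n)\<^sup>2)" for n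
  proof -
    have "of_real (c n) * I n / mellin_const (s + of_nat p) =
        of_real (c n) * ((of_real (b n) powr (s + of_nat p - 2) - of_real y powr (s + of_nat p - 2)) / of_real (y\<^sup>2 - (b n)\<^sup>2))"
      using M by (simp add: I_def)
    moreover have "u * ((B - Y) / D) + Y * (u / D) = u * B / D" for u B Y D :: complex
      by (simp add: diff_divide_distrib right_diff_distrib)
    ultimately show ?thesis by (simp only:)
  qed
  ultimately show "(\<lambda>n. of_real (c n) * of_real (b n) powr (s + of_nat p - 2) / of_real (y\<^sup>2 - (b n)\<^sup>2)) sums
         (integral {0<..} (\<lambda>t. of_real t powr (s - 1) * of_real (K t / (t\<^sup>2 + y\<^sup>2))) / mellin_const (s + of_nat p)
          + of_real y powr (s + of_nat p - 2) * T)"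
    by simp
qed

section \<open>Removing the damping\<close>

text \<open>A bounded factor need not preserve gauge integrability, so the product is shown to be
  measurable and dominated by a multiple of the bound on \<open>K\<close>, the factor being at most
  \<open>1 / y^2\<close>.\<close>

lemma integrable_mellin_over_quadratic:
  fixes s :: complex and K :: "real \<Rightarrow> real"
  assumes int: "(\<lambda>t. of_real t powr (s - 1) * of_real (K t)) integrable_on {0<..}"
    and bound: "\<And>t. t > 0 \<Longrightarrow> \<bar>K t\<bar> \<le> A * (t powr (- q) * exp (- (r * t)))"
    and q: "Re s > q" and r: "r > 0" and y: "y > 0"
  shows "(\<lambda>t. of_real t powr (s - 1) * of_real (K t / (t\<^sup>2 + y\<^sup>2))) integrable_on {0<..}"
proof (rule measurable_bounded_by_integrable_imp_integrable)
  have pos: "t\<^sup>2 + y\<^sup>2 > 0" for t :: real using y by (intro add_nonneg_pos) auto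
  have "(\<lambda>t. complex_of_real (1 / (t\<^sup>2 + y\<^sup>2))) \<in> borel_measurable (lebesgue_on {0<..})"
    using pos by (intro continuous_imp_measurable_on_sets_lebesgue continuous_intros) (auto simp: less_imp_neq[symmetric])
  then have "(\<lambda>t. (of_real t powr (s - 1) * of_real (K t)) * complex_of_real (1 / (t\<^sup>2 + y\<^sup>2))) \<in> borel_measurable (lebesgue_on {0<..})"
    by (intro borel_measurable_times integrable_imp_measurable[OF int])
  then show "(\<lambda>t. complex_of_real t powr (s - 1) * of_real (K t / (t\<^sup>2 + y\<^sup>2))) \<in> borel_measurable (lebesgue_on {0<..})"
    by simp
  show "(\<lambda>t. A / y\<^sup>2 * (t powr (Re s - q - 1) * exp (- (r * t)))) integrable_on {0<..}"
    using q r by (intro integrable_on_mult_right integrable_powr_exp) auto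
  fix t :: real assume "t \<in> {0<..}"
  then have t: "t > 0" by simp
  have "norm (complex_of_real t powr (s - 1) * of_real (K t / (t\<^sup>2 + y\<^sup>2))) = t powr (Re s - 1) * (\<bar>K t\<bar> / (t\<^sup>2 + y\<^sup>2))"
    using t less_imp_le[OF pos[of t]] by (simp only: norm_mult norm_of_real norm_of_real_powr abs_divide) simp
  also have "\<dots> \<le> t powr (Re s - 1) * ((A * (t powr (- q) * exp (- (r * t)))) / y\<^sup>2)"
    using y t by (intro mult_left_mono frac_le bound order_trans[OF abs_ge_zero bound]) auto
  also have "\<dots> = A / y\<^sup>2 * ((t powr (Re s - 1) * t powr (- q)) * exp (- (r * t)))" by simp
  also have "t powr (Re s - 1) * t powr (- q) = t powr (Re s - q - 1)"
    by (simp add: powr_add[symmetric] algebra_simps)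
  finally show "norm (complex_of_real t powr (s - 1) * of_real (K t / (t\<^sup>2 + y\<^sup>2))) \<le> A / y\<^sup>2 * (t powr (Re s - q - 1) * exp (- (r * t)))" .
qed simp

text \<open>The damping factor differs from \<open>1\<close> by \<open>t^2 / (t^2 + y^2)\<close>,
  which is at most \<open>t^2 / y^2\<close>. The error is therefore at most \<open>1 / y^2\<close>
  times a real Mellin integral with exponent raised by two, finite because of the exponential decay
  of \<open>K\<close>.\<close>

lemma tendsto_mollified_mellin:
  fixes s :: complex and K :: "real \<Rightarrow> real"
  assumes int: "(\<lambda>t. of_real t powr (s - 1) * of_real (K t)) integrable_on {0<..}"
    and bound: "\<And>t. t > 0 \<Longrightarrow> \<bar>K t\<bar> \<le> A * (t powr (- q) * exp (- (r * t)))"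
    and q: "Re s > q" and r: "r > 0"
  shows "((\<lambda>y. of_real (y\<^sup>2) * integral {0<..} (\<lambda>t. of_real t powr (s - 1) * of_real (K t / (t\<^sup>2 + y\<^sup>2)))) \<longlongrightarrow>
            integral {0<..} (\<lambda>t. of_real t powr (s - 1) * of_real (K t))) at_infinity"
proof -
  let ?f = "\<lambda>t. complex_of_real t powr (s - 1) * of_real (K t)"
  let ?g = "\<lambda>y t. complex_of_real t powr (s - 1) * of_real (K t / (t\<^sup>2 + y\<^sup>2))"
  let ?h = "\<lambda>t. A * (t powr (Re s + 2 - q - 1) * exp (- (r * t)))"
  have h: "?h integrable_on {0<..}"
    using q r by (intro integrable_on_mult_right integrable_powr_exp) auto
  have main: "norm (of_real (y\<^sup>2) * integral {0<..} (?g y) - integral {0<..} ?f) \<le> integral {0<..} ?h * inverse (y\<^sup>2)"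
    if y: "y \<noteq> 0" for y :: real
  proof -
    \<comment> \<open>Only \<open>y^2\<close> enters \<open>?g\<close>, so negative \<open>y\<close>
      is covered through its absolute value.\<close>
    have "(?g \<bar>y\<bar>) integrable_on {0<..}" using y by (intro integrable_mellin_over_quadratic[OF int bound q r]) auto
    then have g: "(?g y) integrable_on {0<..}" by simp
    have d: "((\<lambda>t. of_real (y\<^sup>2) * ?g y t - ?f t) has_integral (of_real (y\<^sup>2) * integral {0<..} (?g y) - integral {0<..} ?f)) {0<..}"
      using g int by (intro has_integral_diff has_integral_mult_right integrable_integral)
    have "norm (integral {0<..} (\<lambda>t. of_real (y\<^sup>2) * ?g y t - ?f t)) \<le> integral {0<..} (\<lambda>t. ?h t * inverse (y\<^sup>2))"
    proof (rule integral_norm_bound_integral)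
      show "(\<lambda>t. of_real (y\<^sup>2) * ?g y t - ?f t) integrable_on {0<..}" using d by blast
      show "(\<lambda>t. ?h t * inverse (y\<^sup>2)) integrable_on {0<..}" using h by (rule integrable_on_mult_left)
      fix t :: real assume "t \<in> {0<..}"
      then have t: "t > 0" by simp
      have "of_real (y\<^sup>2) * ?g y t - ?f t = - (of_real t powr (s - 1) * of_real (K t * (t\<^sup>2 / (t\<^sup>2 + y\<^sup>2))))"
      proof -
        have "y\<^sup>2 * (K t / (t\<^sup>2 + y\<^sup>2)) - K t = - (K t * (t\<^sup>2 / (t\<^sup>2 + y\<^sup>2)))"
          using y by (simp add: field_simps sum_power2_eq_zero_iff)
        moreover have "of_real (y\<^sup>2) * ?g y t - ?f t = of_real t powr (s - 1) * of_real (y\<^sup>2 * (K t / (t\<^sup>2 + y\<^sup>2)) - K t)"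
          by (simp add: algebra_simps)
        ultimately show ?thesis by simp
      qed
      then have "norm (of_real (y\<^sup>2) * ?g y t - ?f t) = t powr (Re s - 1) * (\<bar>K t\<bar> * (t\<^sup>2 / (t\<^sup>2 + y\<^sup>2)))"
        using t by (simp only: norm_minus_cancel norm_mult norm_of_real norm_of_real_powr abs_mult)
           (simp add: add_nonneg_nonneg)
      also have "\<dots> \<le> t powr (Re s - 1) * ((A * (t powr (- q) * exp (- (r * t)))) * (t\<^sup>2 / y\<^sup>2))"
        using y t by (intro mult_left_mono mult_mono bound divide_left_mono mult_pos_pos add_nonneg_pos
            order_trans[OF abs_ge_zero bound]) auto
      also have "\<dots> = (A * ((t powr (Re s - 1) * t powr (- q) * t powr 2) * exp (- (r * t)))) * inverse (y\<^sup>2)"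
        using t by (simp add: field_simps)
      also have "t powr (Re s - 1) * t powr (- q) * t powr 2 = t powr (Re s + 2 - q - 1)"
        by (simp add: powr_add[symmetric] algebra_simps)
      finally show "norm (of_real (y\<^sup>2) * ?g y t - ?f t) \<le> ?h t * inverse (y\<^sup>2)" .
    qed
    then show ?thesis unfolding integral_unique[OF d] by simp
  qed
  have "((\<lambda>y::real. integral {0<..} ?h * (inverse y)\<^sup>2) \<longlongrightarrow> integral {0<..} ?h * 0\<^sup>2) at_infinity"
    by (intro tendsto_intros tendsto_inverse_0)
  then have "((\<lambda>y::real. integral {0<..} ?h * inverse (y\<^sup>2)) \<longlongrightarrow> 0) at_infinity"
    by (simp add: power_inverse)
  then have "((\<lambda>y. of_real (y\<^sup>2) * integral {0<..} (?g y) - integral {0<..} ?f) \<longlongrightarrow> 0) at_infinity"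
  proof (rule Lim_null_comparison[rotated])
    show "\<forall>\<^sub>F y in at_infinity. norm (of_real (y\<^sup>2) * integral {0<..} (?g y) - integral {0<..} ?f) \<le> integral {0<..} ?h * inverse (y\<^sup>2)"
      unfolding eventually_at_infinity by (intro exI[of _ 1] allI impI main) auto
  qed
  then show ?thesis by (rule LIM_zero_cancel)
qed

subsection \<open>The Riemann zeta function\<close>

text \<open>The quotient is the integral of \<open>x powr (- z)\<close> over the interval from
  \<open>n + 1\<close> to \<open>n + 2\<close>, so this is the error of approximating that integral
  by the value of the integrand at its left end.\<close>

definition zeta_term :: "nat \<Rightarrow> complex \<Rightarrow> complex" where
  "zeta_term n z = of_nat (Suc n) powr (- z)
     - (of_nat (Suc (Suc n)) powr (1 - z) - of_nat (Suc n) powr (1 - z)) / (1 - z)"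

text \<open>For \<open>Re z > 1\<close> the summand \<open>1 / (z - 1)\<close> is the integral of
  \<open>x powr (- z)\<close> from \<open>1\<close> to infinity. Adding the errors
  \<open>zeta_term\<close> gives the Dirichlet series back, in a form that still converges for
  \<open>Re z > 0\<close>.\<close>

definition zeta_series :: "complex \<Rightarrow> complex" where
  "zeta_series z = 1 / (z - 1) + (\<Sum>n. zeta_term n z)"

text \<open>Two applications of the mean value inequality on the segment from \<open>n + 1\<close>
  to \<open>n + 2\<close>: the first bounds the variation of \<open>w powr (- z)\<close>, the second
  bounds its integrated deviation from the left end. The gain of one power makes the sum converge
  for \<open>Re z > 0\<close>.\<close>

lemma norm_zeta_term_le:
  assumes z: "Re z > 0" "z \<noteq> 1"
  shows "norm (zeta_term n z) \<le> norm z * real (Suc n) powr (- Re z - 1)"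
proof -
  define a b :: complex where "a = of_nat (Suc n)" and "b = of_nat (Suc (Suc n))"
  define B where "B = norm z * real (Suc n) powr (- Re z - 1)"
  have seg: "\<exists>u. w = of_real u \<and> real (Suc n) \<le> u" if w: "w \<in> closed_segment a b" for w
  proof -
    obtain u where u: "0 \<le> u" "w = (1 - u) *\<^sub>R a + u *\<^sub>R b"
      using w unfolding in_segment by blast
    then have "w = of_real (real (Suc n) + u)" by (simp add: a_def b_def scaleR_conv_of_real algebra_simps)
    then show ?thesis using u(1) by (intro exI[of _ "real (Suc n) + u"]) auto
  qed
  have npos: "w \<notin> \<real>\<^sub>\<le>\<^sub>0" if "w \<in> closed_segment a b" for w
    using seg[OF that] by (auto simp: complex_nonpos_Reals_iff)
  have ab: "b - a = 1" "a - b = -1" by (simp_all add: a_def b_def)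
  have z1: "1 - z \<noteq> 0" using z by simp
  have 1: "norm (w powr (- z) - a powr (- z)) \<le> B" if w: "w \<in> closed_segment a b" for w
  proof -
    have "norm (w powr (- z) - a powr (- z)) \<le> B * norm (w - a)"
    proof (rule field_differentiable_bound[where S = "closed_segment a b" and f' = "\<lambda>w. - z * w powr (- z - 1)"])
      fix v assume v: "v \<in> closed_segment a b"
      show "((\<lambda>w. w powr - z) has_field_derivative - z * v powr (- z - 1)) (at v within closed_segment a b)"
        using npos[OF v] by (auto intro!: derivative_eq_intros)
      obtain u where u: "v = of_real u" "real (Suc n) \<le> u" using seg[OF v] by blast
      then have "u > 0" by linarith
      then have "norm (- z * v powr (- z - 1)) = norm z * u powr (- Re z - 1)"
        by (simp add: u(1) norm_mult norm_of_real_powr)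
      also have "\<dots> \<le> B"
        unfolding B_def using u(2) z by (intro mult_left_mono powr_mono2') auto
      finally show "norm (- z * v powr (- z - 1)) \<le> B" .
    qed (use w in auto)
    moreover have "norm (w - a) \<le> 1"
      using segment_bound(1)[OF w] ab by (simp add: norm_minus_commute)
    moreover have "B \<ge> 0" by (simp add: B_def)
    ultimately show ?thesis by (smt (verit) mult_left_le)
  qed
  \<comment> \<open>The function evaluated at \<open>a\<close> and \<open>b\<close> is an
    antiderivative of \<open>w powr (- z) - a powr (- z)\<close>, and its decrease from
    \<open>a\<close> to \<open>b\<close> is \<open>zeta_term n z\<close>.\<close>
  have "norm ((a powr (1 - z) / (1 - z) - a * a powr (- z)) - (b powr (1 - z) / (1 - z) - b * a powr (- z))) \<le> B * norm (a - b)"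
  proof (rule field_differentiable_bound[where S = "closed_segment a b" and f' = "\<lambda>w. w powr (- z) - a powr (- z)"])
    fix v assume v: "v \<in> closed_segment a b"
    have "((\<lambda>w. w powr (1 - z) / (1 - z) - w * a powr (- z)) has_field_derivative (1 - z) * v powr (1 - z - 1) / (1 - z) - a powr (- z)) (at v within closed_segment a b)"
      using npos[OF v] z1 by (auto intro!: derivative_eq_intros)
    then show "((\<lambda>w. w powr (1 - z) / (1 - z) - w * a powr (- z)) has_field_derivative v powr (- z) - a powr (- z)) (at v within closed_segment a b)"
      using z1 by simp
  qed (use 1 in auto)
  moreover have "(a powr (1 - z) / (1 - z) - a * a powr (- z)) - (b powr (1 - z) / (1 - z) - b * a powr (- z)) = zeta_term n z"
  proof -
    have "b * a powr (- z) = a * a powr (- z) + a powr (- z)" using ab by (metis add.commute distrib_right mult_1 diff_add_cancel)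
    then show ?thesis unfolding zeta_term_def a_def[symmetric] b_def[symmetric]
      by (simp add: diff_divide_distrib)
  qed
  ultimately show ?thesis using ab by (simp add: B_def)
qed

lemma summable_real_powr_Suc:
  assumes "e < -1"
  shows "summable (\<lambda>n. real (Suc n) powr e)"
  using assms summable_Suc_iff[of "\<lambda>n. real n powr e"] by (simp add: summable_real_powr_iff)

lemma summable_zeta_term:
  assumes "Re z > 0" "z \<noteq> 1"
  shows "summable (\<lambda>n. zeta_term n z)"
proof (rule summable_comparison_test')
  show "summable (\<lambda>n. norm z * real (Suc n) powr (- Re z - 1))"
    using assms by (intro summable_mult summable_real_powr_Suc) auto
  show "norm (zeta_term n z) \<le> norm z * real (Suc n) powr (- Re z - 1)" for n
    by (rule norm_zeta_term_le[OF assms])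
qed

lemma holomorphic_zeta_series: "zeta_series holomorphic_on ({z. 0 < Re z} - {1})"
proof -
  let ?S = "{z. 0 < Re z} - {1::complex}"
  have op: "open ?S" by (intro open_delete open_halfspace_Re_gt)
  have "(\<lambda>z. \<Sum>n. zeta_term n z) holomorphic_on ?S"
  proof (rule holomorphic_uniform_sequence[OF op])
    show "(\<lambda>z. \<Sum>n<N. zeta_term n z) holomorphic_on ?S" for N
      unfolding zeta_term_def by (intro holomorphic_intros) auto
    fix x assume x: "x \<in> ?S"
    then obtain d where d: "d > 0" "cball x d \<subseteq> ?S" using op open_contains_cball by blast
    \<comment> \<open>A radius of at most \<open>Re x / 2\<close> keeps \<open>Re z\<close> above
      \<open>Re x / 2\<close> on the disc, so one summable majorant serves all its points.\<close>
    define e where "e = min d (Re x / 2)"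
    have e: "e > 0" "cball x e \<subseteq> ?S" "e \<le> Re x / 2"
      using d x by (auto simp: e_def)
    have "uniform_limit (cball x e) (\<lambda>N z. \<Sum>n<N. zeta_term n z) (\<lambda>z. \<Sum>n. zeta_term n z) sequentially"
    proof (rule Weierstrass_m_test)
      show "summable (\<lambda>n. (norm x + e) * real (Suc n) powr (- (Re x / 2) - 1))"
        using x by (intro summable_mult summable_real_powr_Suc) auto
      fix n z assume z: "z \<in> cball x e"
      then have zS: "Re z > 0" "z \<noteq> 1" using e by auto
      have xz: "norm (z - x) \<le> e" using z by (simp add: dist_norm norm_minus_commute)
      have "norm z \<le> norm x + e" using norm_triangle_sub[of z x] xz by linarith
      moreover have "\<bar>Re z - Re x\<bar> \<le> e" using abs_Re_le_cmod[of "z - x"] xz by simp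
      then have "Re x / 2 \<le> Re z" using e(3) by linarith
      ultimately have "norm z * real (Suc n) powr (- Re z - 1) \<le> (norm x + e) * real (Suc n) powr (- (Re x / 2) - 1)"
        using e by (intro mult_mono powr_mono) auto
      then show "norm (zeta_term n z) \<le> (norm x + e) * real (Suc n) powr (- (Re x / 2) - 1)"
        using norm_zeta_term_le[OF zS, of n] by linarith
    qed
    then show "\<exists>d>0. cball x d \<subseteq> ?S \<and> uniform_limit (cball x d) (\<lambda>N z. \<Sum>n<N. zeta_term n z) (\<lambda>z. \<Sum>n. zeta_term n z) sequentially"
      using e by blast
  qed
  then show ?thesis
    unfolding zeta_series_def by (intro holomorphic_intros) auto
qed

text \<open>The integrals inside \<open>zeta_term\<close> telescope. For
  \<open>0 < Re z \<le> 1\<close> the limit replaces the divergent Dirichlet series: the subtracted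
  power is its growth.\<close>

lemma zeta_series_LIMSEQ:
  assumes "Re z > 0" "z \<noteq> 1"
  shows "(\<lambda>N. (\<Sum>n<N. of_nat (Suc n) powr (- z)) - of_nat (Suc N) powr (1 - z) / (1 - z)) \<longlonglongrightarrow> zeta_series z"
proof -
  have "(\<Sum>n<N. of_nat (Suc n) powr (- z)) - of_nat (Suc N) powr (1 - z) / (1 - z)
      = 1 / (z - 1) + (\<Sum>n<N. zeta_term n z)" for N
  proof (induction N)
    case 0
    have "1 / (z - 1) = - (1 / (1 - z))" by (metis minus_diff_eq minus_divide_right)
    then show ?case by simp
  next
    case (Suc N)
    then show ?case by (simp add: zeta_term_def diff_divide_distrib algebra_simps del: of_nat_Suc)
  qed
  then show ?thesis
    unfolding zeta_series_def
    using tendsto_add[OF tendsto_const summable_LIMSEQ[OF summable_zeta_term[OF assms]]] by simp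
qed

lemma zeta_series_sums:
  assumes "Re z > 1"
  shows "(\<lambda>n. of_nat (Suc n) powr (- z)) sums zeta_series z"
proof -
  have "(\<lambda>N. of_nat (Suc N) powr (1 - z)) \<longlonglongrightarrow> 0"
    using assms by (intro tendsto_neg_powr_complex_of_nat filterlim_Suc) auto
  then have "(\<lambda>N. ((\<Sum>n<N. of_nat (Suc n) powr (- z)) - of_nat (Suc N) powr (1 - z) / (1 - z)) + of_nat (Suc N) powr (1 - z) / (1 - z))
     \<longlonglongrightarrow> zeta_series z + 0 / (1 - z)"
    using assms by (intro tendsto_add zeta_series_LIMSEQ tendsto_divide tendsto_const) auto
  then show ?thesis by (simp add: sums_def)
qed

text \<open>Existence in the definite description is witnessed by \<open>c = 0\<close> and
  \<open>zeta_series\<close>. Uniqueness is the identity theorem, since every competing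
  \<open>F\<close> has the same sum on \<open>Re z > 1\<close>.\<close>

lemma riemann_zeta_eq_zeta_series:
  assumes "Re s > 0" "s \<noteq> 1"
  shows "riemann_zeta s = zeta_series s"
  unfolding riemann_zeta_def
proof (rule the_equality)
  show "\<exists>c\<le>1. \<exists>F. c < Re s \<and> F holomorphic_on {z. c < Re z} - {1} \<and>
      (\<forall>z. 1 < Re z \<longrightarrow> (\<lambda>n. of_nat (Suc n) powr - z) sums F z) \<and> zeta_series s = F s"
    using assms holomorphic_zeta_series zeta_series_sums
    by (intro exI[of _ 0] conjI exI[of _ zeta_series]) auto
next
  fix w
  assume "\<exists>c\<le>1. \<exists>F. c < Re s \<and> F holomorphic_on {z. c < Re z} - {1} \<and>
      (\<forall>z. 1 < Re z \<longrightarrow> (\<lambda>n. of_nat (Suc n) powr - z) sums F z) \<and> w = F s"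
  then obtain c F where F: "c \<le> 1" "c < Re s" "F holomorphic_on {z. c < Re z} - {1}"
      "\<And>z. 1 < Re z \<Longrightarrow> (\<lambda>n. of_nat (Suc n) powr - z) sums F z" "w = F s"
    by blast
  \<comment> \<open>The abscissa \<open>c\<close> may have either sign; on this smaller half-plane
    both functions are holomorphic. Deleting one point leaves it connected, and it contains
    \<open>s\<close> as well as the region \<open>Re z > 1\<close>.\<close>
  define S where "S = {z. max c 0 < Re z} - {1}"
  have "F s = zeta_series s"
  proof (rule analytic_continuation_open[where f = F and g = zeta_series and s = "{z. 1 < Re z}" and s' = S])
    show "open {z. 1 < Re z}" by (rule open_halfspace_Re_gt)
    show "open S" unfolding S_def by (intro open_delete open_halfspace_Re_gt)
    have "2 \<in> {z. 1 < Re z}" by simp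
    then show "{z. 1 < Re z} \<noteq> {}" by blast
    show "connected S"
      unfolding S_def
      by (intro connected_open_diff_countable convex_connected convex_halfspace_Re_gt open_halfspace_Re_gt) auto
    show "{z. 1 < Re z} \<subseteq> S" using F(1) by (auto simp: S_def)
    show "F holomorphic_on S"
      using F(3) by (rule holomorphic_on_subset) (auto simp: S_def)
    show "zeta_series holomorphic_on S"
      using holomorphic_zeta_series by (rule holomorphic_on_subset) (auto simp: S_def)
    show "s \<in> S" using assms F(2) by (auto simp: S_def)
    show "F z = zeta_series z" if "z \<in> {z. 1 < Re z}" for z
      using that F(4)[of z] zeta_series_sums[of z] sums_unique2 by blast
  qed
  then show "w = zeta_series s" using F(5) by simp
qed

lemma riemann_zeta_sums:
  assumes "Re s > 1"
  shows "(\<lambda>n. of_nat (Suc n) powr (- s)) sums riemann_zeta s"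
proof -
  have "s \<noteq> 1" using assms by auto
  then show ?thesis
    using zeta_series_sums[OF assms] riemann_zeta_eq_zeta_series[of s] assms by simp
qed

lemma even_powr_complex: "of_nat (2 * n) powr z = 2 powr z * (of_nat n powr z :: complex)"
  using powr_times_real[of "2" "of_nat n" z] by simp

lemma odd_zeta_sum:
  assumes s: "Re s > 1" and sums: "(\<lambda>n. of_nat (2 * n + 1) powr (- s)) sums E"
  shows "E = (1 - 2 powr (- s)) * riemann_zeta s"
proof -
  let ?Z = "\<lambda>N. \<Sum>n<N. of_nat (Suc n) powr (- s)"
  have Z: "?Z \<longlonglongrightarrow> riemann_zeta s" using riemann_zeta_sums[OF s] by (simp add: sums_def)
  have eq: "(\<Sum>n<N. of_nat (2 * n + 1) powr (- s)) = ?Z (2 * N) - 2 powr (- s) * ?Z N" for N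
  proof (induction N)
    case (Suc N)
    have "complex_of_nat (Suc (2 * N + 1)) powr (- s) = 2 powr (- s) * of_nat (Suc N) powr (- s)"
      using even_powr_complex[of "Suc N" "- s"] by simp
    with Suc show ?case by (simp add: algebra_simps del: of_nat_Suc)
  qed simp
  have "(\<lambda>N. ?Z (2 * N) - 2 powr (- s) * ?Z N) \<longlonglongrightarrow> riemann_zeta s - 2 powr (- s) * riemann_zeta s"
    using LIMSEQ_subseq_LIMSEQ[OF Z, of "\<lambda>N. 2 * N"]
    by (intro tendsto_diff tendsto_mult tendsto_const Z) (auto simp: strict_mono_def o_def)
  then show ?thesis
    using sums LIMSEQ_unique unfolding sums_def eq by (fastforce simp: algebra_simps)
qed

text \<open>The alternating sum of \<open>2 * N\<close> terms is
  \<open>?Z (2 * N) - 2 powr (1 - s) * ?Z N\<close>. For \<open>Re s \<le> 1\<close> the sums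
  \<open>?Z\<close> have no limit by themselves, but their growth terms \<open>?R\<close> cancel
  asymptotically in this same combination.\<close>

lemma alternating_zeta_sum:
  assumes s: "Re s > 0" "s \<noteq> 1" and sums: "(\<lambda>n. (-1) ^ n * of_nat (Suc n) powr (- s)) sums E"
  shows "E = (1 - 2 powr (1 - s)) * riemann_zeta s"
proof -
  let ?Z = "\<lambda>N. \<Sum>n<N. of_nat (Suc n) powr (- s)"
  let ?R = "\<lambda>N. complex_of_nat (Suc N) powr (1 - s) / (1 - s)"
  have eq: "(\<Sum>n<2 * N. (-1) ^ n * of_nat (Suc n) powr (- s)) = ?Z (2 * N) - 2 powr (1 - s) * ?Z N" for N
  proof (induction N)
    case (Suc N)
    have "complex_of_nat (Suc (2 * N + 1)) powr (- s) = 2 powr (- s) * of_nat (Suc N) powr (- s)"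
      using even_powr_complex[of "Suc N" "- s"] by simp
    moreover have "2 powr (1 - s) = 2 * 2 powr (- s)"
      by (simp add: powr_diff powr_minus_divide)
    ultimately show ?case using Suc by (simp add: algebra_simps del: of_nat_Suc)
  qed simp
  have "(\<lambda>N. zeta_term (2 * N) s) \<longlonglongrightarrow> 0"
    using LIMSEQ_subseq_LIMSEQ[OF summable_LIMSEQ_zero[OF summable_zeta_term[OF s]], of "\<lambda>N. 2 * N"]
    by (simp add: strict_mono_def o_def)
  moreover have "(\<lambda>N. complex_of_nat (Suc (2 * N)) powr (- s)) \<longlonglongrightarrow> 0"
    using s by (intro tendsto_neg_powr_complex_of_nat filterlim_compose[OF filterlim_Suc]
        mult_nat_left_at_top) auto
  ultimately have "(\<lambda>N. zeta_term (2 * N) s - complex_of_nat (Suc (2 * N)) powr (- s)) \<longlonglongrightarrow> 0 - 0"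
    by (rule tendsto_diff)
  \<comment> \<open>Doubling \<open>Suc N\<close> gives \<open>2 * N + 2\<close>, one more than the
    base \<open>2 * N + 1\<close> in \<open>?R (2 * N)\<close>. The combination of growth terms is
    thus a single increment of the power function, which is \<open>zeta_term\<close> without its
    leading summand.\<close>
  moreover have "zeta_term (2 * N) s - complex_of_nat (Suc (2 * N)) powr (- s) = ?R (2 * N) - 2 powr (1 - s) * ?R N" for N
    using even_powr_complex[of "Suc N" "1 - s"]
    by (simp add: zeta_term_def diff_divide_distrib algebra_simps)
  ultimately have R: "(\<lambda>N. ?R (2 * N) - 2 powr (1 - s) * ?R N) \<longlonglongrightarrow> 0" by simp
  note Z = zeta_series_LIMSEQ[OF s]
  have "(\<lambda>N. ((?Z (2 * N) - ?R (2 * N)) - 2 powr (1 - s) * (?Z N - ?R N)) + (?R (2 * N) - 2 powr (1 - s) * ?R N))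
      \<longlonglongrightarrow> (zeta_series s - 2 powr (1 - s) * zeta_series s) + 0"
    using LIMSEQ_subseq_LIMSEQ[OF Z, of "\<lambda>N. 2 * N"]
    by (intro tendsto_add[OF _ R] tendsto_diff tendsto_mult tendsto_const Z) (auto simp: strict_mono_def o_def)
  then have "(\<lambda>N. ?Z (2 * N) - 2 powr (1 - s) * ?Z N) \<longlonglongrightarrow> (1 - 2 powr (1 - s)) * zeta_series s"
    by (simp add: algebra_simps)
  moreover have "(\<lambda>N. \<Sum>n<2 * N. (-1) ^ n * of_nat (Suc n) powr (- s)) \<longlonglongrightarrow> E"
    using LIMSEQ_subseq_LIMSEQ[OF sums[unfolded sums_def], of "\<lambda>N. 2 * N"] by (simp add: strict_mono_def o_def)
  ultimately show ?thesis
    unfolding eq riemann_zeta_eq_zeta_series[OF s] using LIMSEQ_unique by blast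
qed

subsection \<open>Hyperbolic kernels\<close>

lemma cosh_of_real: "of_real (cosh x) = cosh (complex_of_real x)"
  by (simp add: cosh_field_def flip: exp_of_real)

lemma sinh_of_real: "of_real (sinh x) = sinh (complex_of_real x)"
  by (simp add: sinh_field_def flip: exp_of_real)

lemma cos_imaginary: "cos (\<i> * of_real t) = of_real (cosh t)"
  by (simp add: cosh_of_real cosh_conv_cos)

lemma sin_imaginary: "sin (\<i> * of_real t) = \<i> * of_real (sinh t)"
  by (simp add: sinh_of_real sinh_conv_sin)

lemma imaginary_square: "(\<i> * of_real t)\<^sup>2 - (of_real a)\<^sup>2 = - of_real (t\<^sup>2 + a\<^sup>2)"
  by (simp add: power_mult_distrib)

text \<open>These turn the terms of the four expansions at \<open>\<i> * t\<close> into real ones.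
  The powers \<open>t ^ 1\<close> and \<open>t ^ 0\<close> are kept so that the results match the
  parameter \<open>p\<close> of \<open>partial_fractions_mellin_sums\<close>.\<close>

lemma imaginary_terms:
  "\<i> * (2 * (\<i> * of_real t) / - of_real D) = of_real (2 * (t ^ 1 / D))"
  "\<i> * ((-1) ^ m * (2 * (\<i> * of_real t)) / - of_real D) = of_real (((-1) ^ m * 2) * (t ^ 1 / D))"
  "- ((-1) ^ m * (2 * of_real a) / - of_real D) = (of_real (((-1) ^ m * (2 * a)) * (t ^ 0 / D)) :: complex)"
  by (cases "D = 0"; simp add: field_simps)+

lemma coth_sums:
  assumes "t > 0"
  shows "(\<lambda>n. 2 * (t ^ 1 / (t\<^sup>2 + (pi * real (Suc n))\<^sup>2))) sums (cosh t / sinh t - 1 / t)"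
proof -
  have "sin (\<i> * of_real t) \<noteq> 0" using assms by (simp add: sin_imaginary)
  from sums_mult[OF cot_sums[OF this, unfolded imaginary_square], of \<i>, unfolded imaginary_terms]
  have "(\<lambda>n. complex_of_real (2 * (t ^ 1 / (t\<^sup>2 + (pi * real (Suc n))\<^sup>2)))) sums (\<i> * (cot (\<i> * of_real t) - 1 / (\<i> * of_real t)))"
    .
  also have "\<i> * (cot (\<i> * of_real t) - 1 / (\<i> * of_real t)) = of_real (cosh t / sinh t - 1 / t)"
    using assms by (simp add: cot_def sin_imaginary cos_imaginary field_simps)
  finally show ?thesis unfolding sums_of_real_iff .
qed

lemma csch_sums:
  assumes "t > 0"
  shows "(\<lambda>n. ((-1) ^ Suc n * 2) * (t ^ 1 / (t\<^sup>2 + (pi * real (Suc n))\<^sup>2))) sums (1 / sinh t - 1 / t)"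
proof -
  have "sin (\<i> * of_real t) \<noteq> 0" using assms by (simp add: sin_imaginary)
  from sums_mult[OF csc_sums[OF this, unfolded imaginary_square], of \<i>, unfolded imaginary_terms]
  have "(\<lambda>n. complex_of_real (((-1) ^ Suc n * 2) * (t ^ 1 / (t\<^sup>2 + (pi * real (Suc n))\<^sup>2)))) sums (\<i> * (1 / sin (\<i> * of_real t) - 1 / (\<i> * of_real t)))"
    .
  also have "\<i> * (1 / sin (\<i> * of_real t) - 1 / (\<i> * of_real t)) = of_real (1 / sinh t - 1 / t)"
    using assms by (simp add: sin_imaginary field_simps)
  finally show ?thesis unfolding sums_of_real_iff .
qed

lemma tanh_sums:
  "(\<lambda>n. 2 * (t ^ 1 / (t\<^sup>2 + (pi * (real n + 1/2))\<^sup>2))) sums tanh t"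
proof -
  have "cos (\<i> * of_real t) \<noteq> 0" by (simp add: cos_imaginary)
  from sums_mult[OF tan_sums[OF this, unfolded imaginary_square], of \<i>, unfolded imaginary_terms]
  have "(\<lambda>n. complex_of_real (2 * (t ^ 1 / (t\<^sup>2 + (pi * (real n + 1/2))\<^sup>2)))) sums (\<i> * (- tan (\<i> * of_real t)))"
    .
  also have "\<i> * (- tan (\<i> * of_real t)) = of_real (tanh t)"
    by (simp add: tan_def tanh_def sin_imaginary cos_imaginary)
  finally show ?thesis unfolding sums_of_real_iff .
qed

lemma sech_sums:
  "(\<lambda>n. ((-1) ^ n * (2 * (pi * (real n + 1/2)))) * (t ^ 0 / (t\<^sup>2 + (pi * (real n + 1/2))\<^sup>2))) sums (1 / cosh t)"
proof -
  have "cos (\<i> * of_real t) \<noteq> 0" by (simp add: cos_imaginary)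
  from sums_minus[OF sec_sums[OF this, unfolded imaginary_square], unfolded imaginary_terms(3)[where t = t]]
  have "(\<lambda>n. complex_of_real (((-1) ^ n * (2 * (pi * (real n + 1/2)))) * (t ^ 0 / (t\<^sup>2 + (pi * (real n + 1/2))\<^sup>2)))) sums (- (- 1 / cos (\<i> * of_real t)))"
    .
  also have "- (- 1 / cos (\<i> * of_real t)) = of_real (1 / cosh t)"
    by (simp add: cos_imaginary)
  finally show ?thesis unfolding sums_of_real_iff .
qed

text \<open>Splitting off the first term leaves the negative of an alternating sum for the shifted
  sequence, hence the induction over arbitrary \<open>u\<close>. Unlike the Leibniz criterion for
  the limit, the bounds hold for every \<open>N\<close> and need no convergence to
  \<open>0\<close>.\<close>

lemma alternating_partial_sum_bounds:
  fixes u :: "nat \<Rightarrow> real"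
  assumes "\<And>n. 0 \<le> u n" "decseq u"
  shows "0 \<le> (\<Sum>n<N. (-1) ^ n * u n)" "(\<Sum>n<N. (-1) ^ n * u n) \<le> u 0"
proof -
  have "0 \<le> (\<Sum>n<N. (-1) ^ n * u n) \<and> (\<Sum>n<N. (-1) ^ n * u n) \<le> u 0"
    using assms
  proof (induction N arbitrary: u)
    case (Suc N)
    have "0 \<le> (\<Sum>n<N. (-1) ^ n * u (Suc n)) \<and> (\<Sum>n<N. (-1) ^ n * u (Suc n)) \<le> u (Suc 0)"
      using Suc.prems by (intro Suc.IH) (auto simp: decseq_Suc_iff)
    moreover have "u (Suc 0) \<le> u 0" using Suc.prems(2) by (simp add: decseq_Suc_iff)
    moreover have "(\<Sum>n<Suc N. (-1) ^ n * u n) = u 0 - (\<Sum>n<N. (-1) ^ n * u (Suc n))"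
      by (simp only: sum.lessThan_Suc_shift) (simp add: sum_negf)
    ultimately show ?case by linarith
  qed simp
  then show "0 \<le> (\<Sum>n<N. (-1) ^ n * u n)" "(\<Sum>n<N. (-1) ^ n * u n) \<le> u 0" by auto
qed

lemma abs_nonneg_partial_sum_le:
  fixes u :: "nat \<Rightarrow> real"
  assumes "\<And>n. 0 \<le> u n" "u sums S"
  shows "\<bar>\<Sum>n<N. u n\<bar> \<le> S"
  using assms sum_le_suminf[of u "{..<N}"] by (simp add: sums_iff sum_nonneg)

lemma mollified_mellin_sums:
  fixes s :: complex and c a :: "nat \<Rightarrow> real" and K :: "real \<Rightarrow> real"
  assumes s: "Re s > q" "q \<ge> 0" and a: "\<And>n. a n > 0" and r: "r > 0"
    and K: "\<And>t. t > 0 \<Longrightarrow> (\<lambda>n. c n * exp (- (a n * t))) sums K t"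
    and bound: "\<And>N t. t > 0 \<Longrightarrow> \<bar>\<Sum>n<N. c n * exp (- (a n * t))\<bar> \<le> A * (t powr (- q) * exp (- (r * t)))"
  obtains D where "\<And>y. y > 0 \<Longrightarrow> (\<lambda>t. of_real t powr (s - 1) * of_real (K t / (t\<^sup>2 + y\<^sup>2))) integrable_on {0<..}"
    and "(\<lambda>n. of_real (c n) * of_real (a n) powr (- s)) sums D"
    and "((\<lambda>y. of_real (y\<^sup>2) * integral {0<..} (\<lambda>t. of_real t powr (s - 1) * of_real (K t / (t\<^sup>2 + y\<^sup>2)))) \<longlongrightarrow>
            Gamma s * D) at_infinity"
proof -
  let ?M = "integral {0<..} (\<lambda>t. complex_of_real t powr (s - 1) * of_real (K t))"
  have "Gamma s \<noteq> 0"
    using s by (intro Gamma_neq_0) auto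
  then have M: "?M = Gamma s * (?M / Gamma s)" by simp
  \<comment> \<open>The uniform bound on the partial sums passes to their limit.\<close>
  have K_bound: "\<bar>K t\<bar> \<le> A * (t powr (- q) * exp (- (r * t)))" if "t > 0" for t
    using tendsto_rabs[OF K[OF that, unfolded sums_def]] bound[OF that]
    by (intro Lim_bounded[of _ _ 0]) auto
  note int = mellin_integrable[OF s a r K bound]
  have "((\<lambda>y. of_real (y\<^sup>2) * integral {0<..} (\<lambda>t. of_real t powr (s - 1) * of_real (K t / (t\<^sup>2 + y\<^sup>2)))) \<longlongrightarrow> ?M) at_infinity"
    by (intro tendsto_mollified_mellin[OF int K_bound s(1) r])
  then show ?thesis
    using that[OF integrable_mellin_over_quadratic[OF int K_bound s(1) r] mellin_sums[OF s a r K bound]] M by metis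
qed

text \<open>For \<open>p = 0\<close> and \<open>p = 1\<close> these are the damped transforms of
  \<open>1\<close> and \<open>1 / t\<close>, the corrections between kernels and Mittag-Leffler
  sums.\<close>

lemma has_integral_powr_over_quadratic_shift:
  fixes s :: complex and p :: nat
  assumes "0 < Re s - real p" "Re s - real p < 2" "y > 0"
  shows "((\<lambda>t. of_real t powr (s - 1) * of_real (1 / t ^ p / (t\<^sup>2 + y\<^sup>2))) has_integral
     of_real y powr (s - 2) / of_real y ^ p * mellin_const (s - of_nat p)) {0<..}"
proof -
  have "((\<lambda>t. of_real t powr (s - of_nat p - 1) / of_real (t\<^sup>2 + y\<^sup>2)) has_integral
     of_real y powr (s - of_nat p - 2) * mellin_const (s - of_nat p)) {0<..}"
    using assms by (intro has_integral_powr_over_quadratic) auto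
  also have "of_real y powr (s - of_nat p - 2) = of_real y powr (s - 2) / of_real y ^ p"
    using powr_diff_of_nat[OF assms(3), of "s - 2" p] by (simp add: algebra_simps)
  finally show ?thesis
  proof (rule has_integral_eq[rotated])
    fix t :: real assume "t \<in> {0<..}"
    then have "complex_of_real t powr (s - of_nat p - 1) = of_real t powr (s - 1) / of_real t ^ p"
      using powr_diff_of_nat[of t "s - 1" p] by (simp add: algebra_simps)
    then show "of_real t powr (s - of_nat p - 1) / of_real (t\<^sup>2 + y\<^sup>2) =
        of_real t powr (s - 1) * of_real (1 / t ^ p / (t\<^sup>2 + y\<^sup>2))" by simp
  qed
qed

lemma mellin_const_plus_1: "mellin_const (s + 1) = of_real pi / (2 * cos (of_real pi * s / 2))"
proof -
  have "of_real pi * (s + 1) / 2 = of_real pi * s / 2 + of_real pi / 2" by (simp add: field_simps)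
  then show ?thesis unfolding mellin_const_def by (simp only: sin_plus_half_pi)
qed

lemma mellin_const_minus_1: "mellin_const (s - 1) = - mellin_const (s + 1)"
  using mellin_const_minus_2[of "s + 1"] by (simp add: algebra_simps)

lemma real_zeros_sin_cos:
  "sin (pi * real (Suc n)) = 0" "cos (pi * (real n + 1/2)) = 0"
proof -
  show "sin (pi * real (Suc n)) = 0" by (rule sin_npi2)
  have "pi * (real n + 1/2) = pi * real n + pi / 2" by (simp add: algebra_simps)
  then show "cos (pi * (real n + 1/2)) = 0" by (simp only: cos_add) simp
qed

section \<open>The kernels as exponential series\<close>

lemma exp_minus_even: "exp (- (real (2 * n + k) * t)) = exp (- (real k * t)) * exp (- (2 * t)) ^ n"
  by (simp add: exp_of_nat_mult[symmetric] exp_add[symmetric] algebra_simps)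

lemma exp_geometric_sums:
  fixes t :: real
  assumes "t > 0" "\<bar>e\<bar> = 1"
  shows "(\<lambda>n. (e ^ n * 2) * exp (- (real (2 * n + k) * t))) sums (2 * exp (- (real k * t)) / (1 - e * exp (- (2 * t))))"
proof -
  have "\<bar>e * exp (- (2 * t))\<bar> < 1" using assms by (simp add: abs_mult)
  then have "(\<lambda>n. (e * exp (- (2 * t))) ^ n) sums (1 / (1 - e * exp (- (2 * t))))"
    by (intro geometric_sums) simp
  from sums_mult[OF this, of "2 * exp (- (real k * t))"] show ?thesis
    unfolding exp_minus_even power_mult_distrib by (simp add: mult_ac)
qed

text \<open>The inequality \<open>exp (2 * t) \<ge> 1 + 2 * t\<close> isolates the singularity
  \<open>1 / t\<close> at the cost of a factor \<open>1 + 2 * t\<close>. That factor is absorbed by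
  \<open>4 * exp (t / 2)\<close>, which uses up half of the decay of
  \<open>exp (- t)\<close>.\<close>

lemma geometric_kernel_le:
  fixes t :: real
  assumes "t > 0" "k \<ge> 1"
  shows "2 * exp (- (real k * t)) / (1 - exp (- (2 * t))) \<le> 4 * (t powr (- 1) * exp (- (1 / 2 * t)))"
proof -
  have "exp (2 * t) \<ge> 1 + 2 * t" by (rule exp_ge_add_one_self)
  then have "exp (- (2 * t)) \<le> 1 / (1 + 2 * t)"
    using assms by (simp add: exp_minus inverse_eq_divide frac_le)
  then have 1: "1 - exp (- (2 * t)) \<ge> 2 * t / (1 + 2 * t)"
    using assms by (simp add: field_simps)
  have "1 + 2 * t \<le> 4 * exp (1 / 2 * t)"
    using exp_ge_add_one_self[of "1 / 2 * t"] assms(1) by linarith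
  moreover have "real k * t \<ge> 1 * t" using assms by (intro mult_right_mono) auto
  then have "exp (- (real k * t)) \<le> exp (- t)" by simp
  ultimately have 2: "exp (- (real k * t)) * (1 + 2 * t) \<le> exp (- t) * (4 * exp (1 / 2 * t))"
    using assms by (intro mult_mono) auto
  have "2 * exp (- (real k * t)) / (1 - exp (- (2 * t))) \<le> 2 * exp (- (real k * t)) / (2 * t / (1 + 2 * t))"
    using 1 assms by (intro divide_left_mono mult_pos_pos) auto
  also have "\<dots> = exp (- (real k * t)) * (1 + 2 * t) / t" using assms by (simp add: field_simps)
  also have "\<dots> \<le> exp (- t) * (4 * exp (1 / 2 * t)) / t"
    using 2 assms by (intro divide_right_mono) auto
  also have "\<dots> = 4 * (exp (- t) * exp (1 / 2 * t)) / t" by simp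
  also have "exp (- t) * exp (1 / 2 * t) = exp (- (1 / 2 * t))"
    by (simp add: exp_add[symmetric])
  also have "4 * exp (- (1 / 2 * t)) / t = 4 * (t powr (- 1) * exp (- (1 / 2 * t)))"
    using assms by (simp add: powr_minus_divide)
  finally show ?thesis .
qed

lemma abs_alternating_exp_partial_sum_le:
  fixes t :: real
  assumes "t > 0"
  shows "\<bar>\<Sum>n<N. ((-1) ^ n * 2) * exp (- (real (2 * n + k) * t))\<bar> \<le> 2 * exp (- (real k * t))"
proof -
  let ?u = "\<lambda>n. 2 * exp (- (real (2 * n + k) * t))"
  have "decseq ?u" using assms by (simp add: decseq_Suc_iff algebra_simps)
  from alternating_partial_sum_bounds[of ?u N, OF _ this]
  show ?thesis by (simp add: mult.assoc)
qed

text \<open>The point \<open>y = 0\<close>, where the closed forms divide by \<open>y^2\<close>, is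
  eventually left behind, so the identity between \<open>E\<close> and \<open>G\<close> is required
  only away from it.\<close>

lemma tendsto_off_zeros:
  fixes G E :: "real \<Rightarrow> complex"
  assumes "(G \<longlongrightarrow> M) at_infinity" and "\<And>y. y \<noteq> 0 \<Longrightarrow> d y \<noteq> 0 \<Longrightarrow> E y = c * G y"
  shows "(E \<longlongrightarrow> c * M) (at_infinity_off_zeros d)"
proof (rule Lim_transform_eventually)
  show "((\<lambda>y. c * G y) \<longlongrightarrow> c * M) (at_infinity_off_zeros d)"
    using assms(1) by (intro tendsto_mult tendsto_const) (rule tendsto_mono[rotated], auto)
  have "eventually (\<lambda>y::real. y \<noteq> 0) at_infinity"
    unfolding eventually_at_infinity by (intro exI[of _ 1]) auto
  then show "\<forall>\<^sub>F y in at_infinity_off_zeros d. c * G y = E y"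
    unfolding eventually_inf_principal by eventually_elim (use assms(2) in auto)
qed

definition mollified_mellin :: "(real \<Rightarrow> real) \<Rightarrow> complex \<Rightarrow> real \<Rightarrow> complex" where
  "mollified_mellin K s y =
     of_real (y\<^sup>2) * integral {0<..} (\<lambda>t. of_real t powr (s - 1) * of_real (K t / (t\<^sup>2 + y\<^sup>2)))"

text \<open>Evenness in \<open>y\<close> lets the formulas proved for \<open>y > 0\<close> extend to
  negative \<open>y\<close>; the sign then shows only in the factors \<open>sgn y\<close>.\<close>

lemma mollified_mellin_abs: "mollified_mellin K s \<bar>y\<bar> = mollified_mellin K s y"
  by (simp add: mollified_mellin_def)

text \<open>All sides are rational functions of \<open>exp (- t)\<close>. The left sides keep the
  factors \<open>1 *\<close> and \<open>(-1) *\<close> and the literal \<open>k\<close> because this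
  is the shape required for \<open>K\<close> by the lemmas on the geometric and alternating
  case.\<close>

lemma hyperbolic_kernels:
  fixes t :: real
  assumes "t > 0"
  shows "2 * exp (- (real 2 * t)) / (1 - 1 * exp (- (2 * t))) = cosh t / sinh t - 1"
    and "2 * exp (- (real 1 * t)) / (1 - 1 * exp (- (2 * t))) = 1 / sinh t"
    and "2 * exp (- (real 2 * t)) / (1 - (-1) * exp (- (2 * t))) = 1 - tanh t"
    and "2 * exp (- (real 1 * t)) / (1 - (-1) * exp (- (2 * t))) = 1 / cosh t"
proof -
  define x where "x = exp (- t)"
  have x: "0 < x" "x < 1" using assms by (auto simp: x_def)
  have e: "exp t = 1 / x" "exp (- t) = x" "exp (- (2 * t)) = x\<^sup>2"
    by (simp_all add: x_def exp_minus inverse_eq_divide power2_eq_square exp_add[symmetric])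
  have x2: "x\<^sup>2 < 1" using x by (simp add: power_less_one_iff)
  have sc: "sinh t = (1 - x\<^sup>2) / (2 * x)" "cosh t = (1 + x\<^sup>2) / (2 * x)"
    using x by (simp_all add: sinh_field_def cosh_field_def e field_simps power2_eq_square)
  have ne: "1 - x\<^sup>2 \<noteq> 0" "1 + x\<^sup>2 \<noteq> 0" "x \<noteq> 0" using x x2 zero_le_power2[of x] by linarith+
  show "2 * exp (- (real 2 * t)) / (1 - 1 * exp (- (2 * t))) = cosh t / sinh t - 1"
    using ne by (simp add: sc e) (simp add: field_simps)
  show "2 * exp (- (real 1 * t)) / (1 - 1 * exp (- (2 * t))) = 1 / sinh t"
    using ne by (simp add: sc e)
  show "2 * exp (- (real 2 * t)) / (1 - (-1) * exp (- (2 * t))) = 1 - tanh t"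
    unfolding tanh_def using ne by (simp add: sc e) (simp add: field_simps)
  show "2 * exp (- (real 1 * t)) / (1 - (-1) * exp (- (2 * t))) = 1 / cosh t"
    using ne by (simp add: sc e)
qed

text \<open>Equivalent to \<open>t * exp (- t) \<le> sinh t\<close>. It bounds all partial sums of
  \<open>coth_sums\<close> at once, since their terms are nonnegative.\<close>

lemma coth_bound:
  fixes t :: real
  assumes "t > 0"
  shows "cosh t / sinh t - 1 / t \<le> 1"
proof -
  have "exp (2 * t) \<ge> 1 + 2 * t" by (rule exp_ge_add_one_self)
  then have "exp (- t) * (1 + 2 * t) \<le> exp (- t) * exp (2 * t)" by (intro mult_left_mono) auto
  also have "\<dots> = exp t" by (simp add: exp_add[symmetric])
  finally have "t * exp (- t) \<le> sinh t" by (simp add: sinh_field_def algebra_simps)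
  then have "t * (cosh t - sinh t) \<le> sinh t" by (simp add: cosh_minus_sinh)
  then show ?thesis using assms by (simp add: field_simps)
qed

text \<open>With positive terms the partial sums are bounded by the kernel itself, which behaves
  like \<open>1 / t\<close> at \<open>0\<close>; hence \<open>q = 1\<close> and
  \<open>Re s > 1\<close>.\<close>

lemma mollified_mellin_LIM_geometric:
  fixes s :: complex and K :: "real \<Rightarrow> real"
  assumes s: "Re s > 1" and k: "k \<ge> 1"
    and K: "\<And>t. t > 0 \<Longrightarrow> 2 * exp (- (real k * t)) / (1 - 1 * exp (- (2 * t))) = K t"
  obtains D where "\<And>y. y > 0 \<Longrightarrow> (\<lambda>t. of_real t powr (s - 1) * of_real (K t / (t\<^sup>2 + y\<^sup>2))) integrable_on {0<..}"
    and "(\<lambda>n. of_real (1 ^ n * 2) * of_real (real (2 * n + k)) powr (- s)) sums D"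
    and "(mollified_mellin K s \<longlongrightarrow> Gamma s * D) at_infinity"
proof -
  have K_sums: "(\<lambda>n. (1 ^ n * 2) * exp (- (real (2 * n + k) * t))) sums K t" if "t > 0" for t
    using exp_geometric_sums[OF that, of 1 k] K[OF that] by simp
  have "\<bar>\<Sum>n<N. (1 ^ n * 2) * exp (- (real (2 * n + k) * t))\<bar> \<le> 4 * (t powr (- 1) * exp (- (1 / 2 * t)))"
    if "t > 0" for N t
    using abs_nonneg_partial_sum_le[OF _ K_sums[OF that], of N] geometric_kernel_le[OF that k] K[OF that]
    by simp
  from mollified_mellin_sums[of 1 s "\<lambda>n. real (2 * n + k)" "1 / 2" "\<lambda>n. 1 ^ n * 2" K 4, OF s _ _ _ K_sums this]
  show ?thesis using k that unfolding mollified_mellin_def[abs_def] by auto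
qed

text \<open>Alternating partial sums stay below their first term, so there is no singularity at
  \<open>0\<close> and \<open>q = 0\<close> is admissible, although the sum of the absolute values
  grows like \<open>1 / t\<close>.\<close>

lemma mollified_mellin_LIM_alternating:
  fixes s :: complex and K :: "real \<Rightarrow> real"
  assumes s: "Re s > 0" and k: "k \<ge> 1"
    and K: "\<And>t. t > 0 \<Longrightarrow> 2 * exp (- (real k * t)) / (1 - (-1) * exp (- (2 * t))) = K t"
  obtains D where "\<And>y. y > 0 \<Longrightarrow> (\<lambda>t. of_real t powr (s - 1) * of_real (K t / (t\<^sup>2 + y\<^sup>2))) integrable_on {0<..}"
    and "(\<lambda>n. of_real ((-1) ^ n * 2) * of_real (real (2 * n + k)) powr (- s)) sums D"
    and "(mollified_mellin K s \<longlongrightarrow> Gamma s * D) at_infinity"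
proof -
  have K_sums: "(\<lambda>n. ((-1) ^ n * 2) * exp (- (real (2 * n + k) * t))) sums K t" if "t > 0" for t
    using exp_geometric_sums[OF that, of "-1" k] K[OF that] by simp
  have "\<bar>\<Sum>n<N. ((-1) ^ n * 2) * exp (- (real (2 * n + k) * t))\<bar> \<le> 2 * (t powr (- 0) * exp (- (real k * t)))"
    if "t > 0" for N t
    using abs_alternating_exp_partial_sum_le[OF that] that by simp
  from mollified_mellin_sums[of 0 s "\<lambda>n. real (2 * n + k)" "real k" "\<lambda>n. (-1) ^ n * 2" K 2, OF s _ _ _ K_sums this]
  show ?thesis using k that unfolding mollified_mellin_def[abs_def] by auto
qed

lemma powr_minus_2:
  assumes "y > 0"
  shows "complex_of_real y powr (s - 2) = of_real y powr s / of_real (y\<^sup>2)"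
  using powr_diff_of_nat[OF assms, of s 2] by simp

lemma cos_half_pi_mult_neq_0:
  fixes s :: complex
  assumes "-1 < Re s" "Re s < 3" "s \<noteq> 1"
  shows "cos (of_real pi * s / 2) \<noteq> 0"
proof -
  have "of_real pi * (s + 1) / 2 = of_real pi * s / 2 + of_real pi / 2" by (simp add: field_simps)
  moreover have "s + 1 \<noteq> 2" using assms(3) by (metis add_right_cancel one_add_one)
  ultimately show ?thesis
    using sin_half_pi_mult_neq_0[of "s + 1"] assms by (simp only: sin_plus_half_pi) auto
qed


section \<open>The series of the theorem in terms of damped transforms\<close>

text \<open>Write \<open>coth t - 1 / t\<close> as \<open>(coth t - 1) - 1 / t + 1\<close>. The
  damped transform of \<open>1 / t\<close> cancels the summand \<open>- 1 / y\<close> in the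
  expansion of \<open>cot y\<close>, and that of \<open>1\<close> contributes the quotient of
  \<open>cos\<close> and \<open>sin\<close> at \<open>pi * s / 2\<close>. The constant
  \<open>1\<close> limits the strip to \<open>Re s < 2\<close>.\<close>

lemma coth_kernel_sums:
  fixes s :: complex
  assumes s: "1 < Re s" "Re s < 2" and y: "y > 0" "sin y \<noteq> 0"
    and int: "(\<lambda>t. of_real t powr (s - 1) * of_real ((cosh t / sinh t - 1) / (t\<^sup>2 + y\<^sup>2))) integrable_on {0<..}"
  shows "(\<lambda>n. of_real (pi * real (Suc n)) powr (s - 1) / of_real (y\<^sup>2 - (pi * real (Suc n))\<^sup>2)) sums
        ((2 * cos (of_real pi * s / 2) * mollified_mellin (\<lambda>t. cosh t / sinh t - 1) s y / of_real pi
          + of_real y powr s * (cos (of_real pi * s / 2) / sin (of_real pi * s / 2) + of_real (cot y))) / (2 * of_real (y\<^sup>2)))"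
proof -
  let ?b = "\<lambda>n. pi * real (Suc n)"
  let ?C = "cos (of_real pi * s / 2)" and ?S = "sin (of_real pi * s / 2)"
  let ?H = "integral {0<..} (\<lambda>t. complex_of_real t powr (s - 1) * of_real ((cosh t / sinh t - 1) / (t\<^sup>2 + y\<^sup>2)))"
  let ?K0 = "\<lambda>t::real. cosh t / sinh t - 1 / t"
  let ?J = "?H - of_real y powr (s - 2) / of_real y ^ 1 * mellin_const (s - of_nat 1) + of_real y powr (s - 2) / of_real y ^ 0 * mellin_const (s - of_nat 0)"
  have y0: "complex_of_real y \<noteq> 0" using y by simp
  have s2: "s \<noteq> 2" "s + 1 \<noteq> 2" "s \<noteq> 1" using s by (auto simp: complex_eq_iff)
  have CS: "?C \<noteq> 0" "?S \<noteq> 0"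
    using cos_half_pi_mult_neq_0[of s] sin_half_pi_mult_neq_0[of s] s s2 by auto
  have bound: "\<bar>\<Sum>n<N. 2 * (t ^ 1 / (t\<^sup>2 + (?b n)\<^sup>2))\<bar> \<le> 1 * t powr (- 0)" if "t > 0" for N t
    using abs_nonneg_partial_sum_le[OF _ coth_sums[OF that], of N] coth_bound[OF that] that by simp
  have "(\<lambda>n. 2 * complex_of_real y / ((of_real y)\<^sup>2 - (of_real (?b n))\<^sup>2)) sums (cot (of_real y) - 1 / of_real y)"
    using y by (intro cot_sums) (simp add: sin_of_real)
  from sums_divide[OF this, of "of_real y"]
  have T: "(\<lambda>n. of_real 2 / of_real (y\<^sup>2 - (?b n)\<^sup>2)) sums ((cot (of_real y) - 1 / of_real y) / complex_of_real y)"
    using y0 by simp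
  have "((\<lambda>t. complex_of_real t powr (s - 1) * of_real ((cosh t / sinh t - 1) / (t\<^sup>2 + y\<^sup>2))
        - of_real t powr (s - 1) * of_real (1 / t ^ 1 / (t\<^sup>2 + y\<^sup>2)) + of_real t powr (s - 1) * of_real (1 / t ^ 0 / (t\<^sup>2 + y\<^sup>2)))
      has_integral ?J) {0<..}"
    using s y by (intro has_integral_add has_integral_diff integrable_integral int has_integral_powr_over_quadratic_shift) auto
  then have "((\<lambda>t. complex_of_real t powr (s - 1) * of_real (?K0 t / (t\<^sup>2 + y\<^sup>2))) has_integral ?J) {0<..}"
    by (rule has_integral_eq[rotated]) (simp add: diff_divide_distrib algebra_simps)
  then have integral_K0: "integral {0<..} (\<lambda>t. complex_of_real t powr (s - 1) * of_real (?K0 t / (t\<^sup>2 + y\<^sup>2))) = ?J"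
    by (rule integral_unique)
  have "?b n \<noteq> y" for n using y(2) real_zeros_sin_cos(1)[of n] by metis
  from partial_fractions_mellin_sums[where q = 0 and s = s and p = 1 and c = "\<lambda>_. 2" and b = ?b and K = ?K0 and A = 1, OF _ _ _ _ _ _ y(1) this coth_sums bound T]
  have "(\<lambda>n. of_real 2 * of_real (?b n) powr (s + of_nat 1 - 2) / of_real (y\<^sup>2 - (?b n)\<^sup>2)) sums
      (?J / mellin_const (s + of_nat 1) + of_real y powr (s + of_nat 1 - 2) * ((cot (of_real y) - 1 / of_real y) / of_real y))"
    using s s2 unfolding integral_K0 by simp
  from sums_mult[OF this, of "1 / 2"]
  have "(\<lambda>n. of_real (?b n) powr (s - 1) / of_real (y\<^sup>2 - (?b n)\<^sup>2)) sums
      (1 / 2 * (?J / mellin_const (s + of_nat 1) + of_real y powr (s + of_nat 1 - 2) * ((cot (of_real y) - 1 / of_real y) / of_real y)))"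
    by (simp add: algebra_simps)
  also have "of_real y powr (s + of_nat 1 - 2) = of_real y powr s / of_real y"
    using y by (simp add: powr_diff)
  also have "1 / 2 * (?J / mellin_const (s + of_nat 1) + of_real y powr s / of_real y * ((cot (of_real y) - 1 / of_real y) / of_real y))
     = (2 * ?C * mollified_mellin (\<lambda>t. cosh t / sinh t - 1) s y / of_real pi
          + of_real y powr s * (?C / ?S + of_real (cot y))) / (2 * of_real (y\<^sup>2))"
  proof -
    \<comment> \<open>Stated for independent variables, so that the simplification is purely
      rational and does not touch the powers or the trigonometric values.\<close>
    have alg: "1 / 2 * ((H - P / Y\<^sup>2 / Y ^ 1 * (- (p / (2 * C))) + P / Y\<^sup>2 / Y ^ 0 * (p / (2 * S))) / (p / (2 * C)) + P / Y * ((c - 1 / Y) / Y))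
       = (2 * C * (Y\<^sup>2 * H) / p + P * (C / S + c)) / (2 * Y\<^sup>2)"
      if "Y \<noteq> 0" "C \<noteq> 0" "S \<noteq> 0" "p \<noteq> 0" for H P Y p C S c :: complex
      using that by (simp add: field_simps power2_eq_square)
    show ?thesis
      unfolding powr_minus_2[OF y(1)] mollified_mellin_def of_nat_1 of_nat_0 diff_0_right mellin_const_minus_1 mellin_const_plus_1
        cot_of_real of_real_power unfolding mellin_const_def
      by (rule alg) (use y0 CS in auto)
  qed
  finally show ?thesis .
qed


text \<open>The kernel differs from its Mittag-Leffler sum only by \<open>1 / t\<close>, whose
  damped transform again cancels \<open>- 1 / y\<close>. No constant correction occurs, and the
  strip extends to \<open>Re s < 3\<close>.\<close>

lemma csch_kernel_sums:
  fixes s :: complex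
  assumes s: "1 < Re s" "Re s < 3" and y: "y > 0" "sin y \<noteq> 0"
    and int: "(\<lambda>t. of_real t powr (s - 1) * of_real (1 / sinh t / (t\<^sup>2 + y\<^sup>2))) integrable_on {0<..}"
  shows "(\<lambda>n. (-1) ^ Suc n * of_real (pi * real (Suc n)) powr (s - 1) / of_real (y\<^sup>2 - (pi * real (Suc n))\<^sup>2)) sums
        ((2 * cos (of_real pi * s / 2) * mollified_mellin (\<lambda>t. 1 / sinh t) s y / of_real pi
          + of_real y powr s / of_real (sin y)) / (2 * of_real (y\<^sup>2)))"
proof -
  let ?b = "\<lambda>n. pi * real (Suc n)"
  let ?C = "cos (of_real pi * s / 2)"
  let ?H = "integral {0<..} (\<lambda>t. complex_of_real t powr (s - 1) * of_real (1 / sinh t / (t\<^sup>2 + y\<^sup>2)))"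
  let ?K0 = "\<lambda>t::real. 1 / sinh t - 1 / t"
  let ?J = "?H - of_real y powr (s - 2) / of_real y ^ 1 * mellin_const (s - of_nat 1)"
  have y0: "complex_of_real y \<noteq> 0" "complex_of_real (sin y) \<noteq> 0" using y by simp_all
  have s2: "s + 1 \<noteq> 2" "s \<noteq> 1" using s by (auto simp: complex_eq_iff)
  have CS: "?C \<noteq> 0"
    using cos_half_pi_mult_neq_0[of s] s s2 by auto
  \<comment> \<open>The terms decrease in \<open>n\<close> and the first is at most
    \<open>2 / t\<close>. A constant bound would confine the argument to \<open>Re s < 2\<close>;
    with \<open>2 / t\<close>, that is \<open>q = 1\<close>, it works on
    \<open>1 < Re s < 3\<close>.\<close>
  have bound: "\<bar>\<Sum>n<N. ((-1) ^ Suc n * 2) * (t ^ 1 / (t\<^sup>2 + (?b n)\<^sup>2))\<bar> \<le> 2 * t powr (- 1)" if t: "t > 0" for N t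
  proof -
    let ?u = "\<lambda>n. 2 * (t / (t\<^sup>2 + (?b n)\<^sup>2))"
    have "decseq ?u"
      unfolding decseq_Suc_iff using t
      by (intro allI mult_left_mono divide_left_mono add_left_mono power_mono mult_pos_pos add_pos_nonneg) auto
    then have "\<bar>\<Sum>n<N. (-1) ^ n * ?u n\<bar> \<le> ?u 0"
      using alternating_partial_sum_bounds[of ?u N] t by simp
    also have "\<dots> \<le> 2 * (t / t\<^sup>2)"
      using t by (intro mult_left_mono divide_left_mono mult_pos_pos add_pos_nonneg) auto
    also have "\<dots> = 2 * t powr (- 1)"
      using t by (simp add: powr_minus_divide power2_eq_square)
    finally show ?thesis by (simp add: sum_negf mult.assoc)
  qed
  have "(\<lambda>n. (-1) ^ Suc n * (2 * complex_of_real y) / ((of_real y)\<^sup>2 - (of_real (?b n))\<^sup>2)) sums (1 / sin (of_real y) - 1 / of_real y)"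
    using y by (intro csc_sums) (simp add: sin_of_real)
  from sums_divide[OF this, of "of_real y"]
  have T: "(\<lambda>n. of_real ((-1) ^ Suc n * 2) / of_real (y\<^sup>2 - (?b n)\<^sup>2)) sums ((1 / sin (of_real y) - 1 / of_real y) / complex_of_real y)"
    using y0 by simp
  have "((\<lambda>t. complex_of_real t powr (s - 1) * of_real (1 / sinh t / (t\<^sup>2 + y\<^sup>2))
        - of_real t powr (s - 1) * of_real (1 / t ^ 1 / (t\<^sup>2 + y\<^sup>2)))
      has_integral ?J) {0<..}"
    using s y by (intro has_integral_diff integrable_integral int has_integral_powr_over_quadratic_shift) auto
  then have "((\<lambda>t. complex_of_real t powr (s - 1) * of_real (?K0 t / (t\<^sup>2 + y\<^sup>2))) has_integral ?J) {0<..}"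
    by (rule has_integral_eq[rotated]) (simp add: diff_divide_distrib algebra_simps)
  then have integral_K0: "integral {0<..} (\<lambda>t. complex_of_real t powr (s - 1) * of_real (?K0 t / (t\<^sup>2 + y\<^sup>2))) = ?J"
    by (rule integral_unique)
  have "?b n \<noteq> y" for n using y(2) real_zeros_sin_cos(1)[of n] by metis
  from partial_fractions_mellin_sums[where q = 1 and s = s and p = 1 and c = "\<lambda>n. (-1) ^ Suc n * 2" and b = ?b and K = ?K0 and A = 2, OF _ _ _ _ _ _ y(1) this csch_sums bound T]
  have "(\<lambda>n. of_real ((-1) ^ Suc n * 2) * of_real (?b n) powr (s + of_nat 1 - 2) / of_real (y\<^sup>2 - (?b n)\<^sup>2)) sums
      (?J / mellin_const (s + of_nat 1) + of_real y powr (s + of_nat 1 - 2) * ((1 / sin (of_real y) - 1 / of_real y) / of_real y))"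
    using s s2 unfolding integral_K0 by simp
  from sums_mult[OF this, of "1 / 2"]
  have "(\<lambda>n. (-1) ^ Suc n * of_real (?b n) powr (s - 1) / of_real (y\<^sup>2 - (?b n)\<^sup>2)) sums
      (1 / 2 * (?J / mellin_const (s + of_nat 1) + of_real y powr (s + of_nat 1 - 2) * ((1 / sin (of_real y) - 1 / of_real y) / of_real y)))"
    by (simp add: algebra_simps)
  also have "of_real y powr (s + of_nat 1 - 2) = of_real y powr s / of_real y"
    using y by (simp add: powr_diff)
  also have "1 / 2 * (?J / mellin_const (s + of_nat 1) + of_real y powr s / of_real y * ((1 / sin (of_real y) - 1 / of_real y) / of_real y))
     = (2 * ?C * mollified_mellin (\<lambda>t. 1 / sinh t) s y / of_real pi
          + of_real y powr s / of_real (sin y)) / (2 * of_real (y\<^sup>2))"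
  proof -
    have alg: "1 / 2 * ((H - P / Y\<^sup>2 / Y ^ 1 * (- (p / (2 * C)))) / (p / (2 * C)) + P / Y * ((1 / c - 1 / Y) / Y))
       = (2 * C * (Y\<^sup>2 * H) / p + P / c) / (2 * Y\<^sup>2)"
      if "Y \<noteq> 0" "C \<noteq> 0" "c \<noteq> 0" "p \<noteq> 0" for H P Y p C c :: complex
      using that by (simp add: field_simps power2_eq_square)
    show ?thesis
      unfolding powr_minus_2[OF y(1)] mollified_mellin_def of_nat_1 mellin_const_minus_1 mellin_const_plus_1
        sin_of_real of_real_power
      by (rule alg) (use y0 CS in \<open>auto simp: sin_of_real\<close>)
  qed
  finally show ?thesis .
qed

text \<open>The Mittag-Leffler sum \<open>tanh t\<close> is \<open>1\<close> minus the kernel, hence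
  the negative sign of the damped transform; there is no pole at \<open>0\<close> to correct. At
  \<open>s = 1\<close> the constant \<open>mellin_const (s + 1)\<close> would have a zero
  denominator.\<close>

lemma tanh_kernel_sums:
  fixes s :: complex
  assumes s: "0 < Re s" "Re s < 2" "s \<noteq> 1" and y: "y > 0" "cos y \<noteq> 0"
    and int: "(\<lambda>t. of_real t powr (s - 1) * of_real ((1 - tanh t) / (t\<^sup>2 + y\<^sup>2))) integrable_on {0<..}"
  shows "(\<lambda>n. of_real (pi * (real n + 1/2)) powr (s - 1) / of_real (y\<^sup>2 - (pi * (real n + 1/2))\<^sup>2)) sums
        ((of_real y powr s * (cos (of_real pi * s / 2) / sin (of_real pi * s / 2) - of_real (tan y))
          - 2 * cos (of_real pi * s / 2) * mollified_mellin (\<lambda>t. 1 - tanh t) s y / of_real pi) / (2 * of_real (y\<^sup>2)))"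
proof -
  let ?b = "\<lambda>n. pi * (real n + 1/2)"
  let ?C = "cos (of_real pi * s / 2)" and ?S = "sin (of_real pi * s / 2)"
  let ?H = "integral {0<..} (\<lambda>t. complex_of_real t powr (s - 1) * of_real ((1 - tanh t) / (t\<^sup>2 + y\<^sup>2)))"
  let ?J = "of_real y powr (s - 2) / of_real y ^ 0 * mellin_const (s - of_nat 0) - ?H"
  have y0: "complex_of_real y \<noteq> 0" using y by simp
  have s2: "s \<noteq> 2" "s + 1 \<noteq> 2" using s by (auto simp: complex_eq_iff)
  have CS: "?C \<noteq> 0" "?S \<noteq> 0"
    using cos_half_pi_mult_neq_0[of s] sin_half_pi_mult_neq_0[of s] s s2 by auto
  have bound: "\<bar>\<Sum>n<N. 2 * (t ^ 1 / (t\<^sup>2 + (?b n)\<^sup>2))\<bar> \<le> 1 * t powr (- 0)" if "t > 0" for N t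
    using abs_nonneg_partial_sum_le[OF _ tanh_sums, of t N] tanh_real_lt_1[of t] that by simp
  have "(\<lambda>n. 2 * complex_of_real y / ((of_real y)\<^sup>2 - (of_real (?b n))\<^sup>2)) sums (- tan (of_real y))"
    using y by (intro tan_sums) (simp add: cos_of_real)
  from sums_divide[OF this, of "of_real y"]
  have T: "(\<lambda>n. of_real 2 / of_real (y\<^sup>2 - (?b n)\<^sup>2)) sums (- tan (of_real y) / complex_of_real y)"
    using y0 by simp
  have "((\<lambda>t. of_real t powr (s - 1) * of_real (1 / t ^ 0 / (t\<^sup>2 + y\<^sup>2)) - complex_of_real t powr (s - 1) * of_real ((1 - tanh t) / (t\<^sup>2 + y\<^sup>2)))
      has_integral ?J) {0<..}"
    using s y by (intro has_integral_diff integrable_integral int has_integral_powr_over_quadratic_shift) auto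
  then have "((\<lambda>t. complex_of_real t powr (s - 1) * of_real (tanh t / (t\<^sup>2 + y\<^sup>2))) has_integral ?J) {0<..}"
    by (rule has_integral_eq[rotated]) (simp add: diff_divide_distrib algebra_simps)
  then have integral_K0: "integral {0<..} (\<lambda>t. complex_of_real t powr (s - 1) * of_real (tanh t / (t\<^sup>2 + y\<^sup>2))) = ?J"
    by (rule integral_unique)
  have pos: "?b n > 0" for n by simp
  have "?b n \<noteq> y" for n using y(2) real_zeros_sin_cos(2)[of n] by metis
  from partial_fractions_mellin_sums[where q = 0 and s = s and p = 1 and c = "\<lambda>_. 2" and b = ?b and K = tanh and A = 1, OF _ _ _ _ _ pos y(1) this tanh_sums bound T]
  have "(\<lambda>n. of_real 2 * of_real (?b n) powr (s + of_nat 1 - 2) / of_real (y\<^sup>2 - (?b n)\<^sup>2)) sums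
      (?J / mellin_const (s + of_nat 1) + of_real y powr (s + of_nat 1 - 2) * (- tan (of_real y) / of_real y))"
    using s s2 unfolding integral_K0 by simp
  from sums_mult[OF this, of "1 / 2"]
  have "(\<lambda>n. of_real (?b n) powr (s - 1) / of_real (y\<^sup>2 - (?b n)\<^sup>2)) sums
      (1 / 2 * (?J / mellin_const (s + of_nat 1) + of_real y powr (s + of_nat 1 - 2) * (- tan (of_real y) / of_real y)))"
    by (simp add: algebra_simps)
  also have "of_real y powr (s + of_nat 1 - 2) = of_real y powr s / of_real y"
    using y by (simp add: powr_diff)
  also have "1 / 2 * (?J / mellin_const (s + of_nat 1) + of_real y powr s / of_real y * (- tan (of_real y) / of_real y))
     = (of_real y powr s * (?C / ?S - of_real (tan y)) - 2 * ?C * mollified_mellin (\<lambda>t. 1 - tanh t) s y / of_real pi) / (2 * of_real (y\<^sup>2))"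
  proof -
    have alg: "1 / 2 * ((P / Y\<^sup>2 / Y ^ 0 * (p / (2 * S)) - H) / (p / (2 * C)) + P / Y * (- c / Y))
       = (P * (C / S - c) - 2 * C * (Y\<^sup>2 * H) / p) / (2 * Y\<^sup>2)"
      if "Y \<noteq> 0" "C \<noteq> 0" "S \<noteq> 0" "p \<noteq> 0" for H P Y p C S c :: complex
      using that by (simp add: field_simps power2_eq_square)
    show ?thesis
      unfolding powr_minus_2[OF y(1)] mollified_mellin_def of_nat_1 of_nat_0 diff_0_right mellin_const_plus_1
        tan_of_real of_real_power unfolding mellin_const_def
      by (rule alg) (use y0 CS in auto)
  qed
  finally show ?thesis .
qed

text \<open>The kernel equals its Mittag-Leffler sum, so no correction arises. The numerators
  contain the pole \<open>?b n\<close> and no power of \<open>t\<close>: hence \<open>p = 0\<close>,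
  which puts \<open>sin\<close> in place of \<open>cos\<close>, and the factor \<open>?b n\<close>
  raises the exponent from \<open>s - 2\<close> to \<open>s - 1\<close>.\<close>

lemma sech_kernel_sums:
  fixes s :: complex
  assumes s: "0 < Re s" "Re s < 2" and y: "y > 0" "cos y \<noteq> 0"
    and int: "(\<lambda>t. of_real t powr (s - 1) * of_real (1 / cosh t / (t\<^sup>2 + y\<^sup>2))) integrable_on {0<..}"
  shows "(\<lambda>n. (-1) ^ n * of_real (pi * (real n + 1/2)) powr (s - 1) / of_real (y\<^sup>2 - (pi * (real n + 1/2))\<^sup>2)) sums
        ((2 * sin (of_real pi * s / 2) * mollified_mellin (\<lambda>t. 1 / cosh t) s y / of_real pi
          - of_real y powr s / of_real (cos y)) / (2 * of_real (y\<^sup>2)))"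
proof -
  let ?b = "\<lambda>n. pi * (real n + 1/2)"
  let ?S = "sin (of_real pi * s / 2)"
  let ?H = "integral {0<..} (\<lambda>t. complex_of_real t powr (s - 1) * of_real (1 / cosh t / (t\<^sup>2 + y\<^sup>2)))"
  have y0: "complex_of_real y \<noteq> 0" "complex_of_real (cos y) \<noteq> 0" using y by simp_all
  have s2: "s \<noteq> 2" using s by (auto simp: complex_eq_iff)
  have CS: "?S \<noteq> 0"
    using sin_half_pi_mult_neq_0[of s] s s2 by auto
  have pos: "?b n > 0" for n by simp
  \<comment> \<open>\<open>2 * a / (t\<^sup>2 + a\<^sup>2)\<close> is not monotone in \<open>a\<close>, but it is a difference of two decreasing functions of \<open>a\<close>.\<close>
  have bound: "\<bar>\<Sum>n<N. ((-1) ^ n * (2 * ?b n)) * (t ^ 0 / (t\<^sup>2 + (?b n)\<^sup>2))\<bar> \<le> 4 / ?b 0 * t powr (- 0)" if t: "t > 0" for N t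
  proof -
    let ?u = "\<lambda>n. 2 / ?b n" and ?v = "\<lambda>n. 2 * t\<^sup>2 / (?b n * (t\<^sup>2 + (?b n)\<^sup>2))"
    have tpos: "t\<^sup>2 + (?b n)\<^sup>2 > 0" for n using t by (intro add_pos_nonneg) auto
    have le: "?b n \<le> ?b (Suc n)" for n by simp
    have u: "decseq ?u"
      unfolding decseq_Suc_iff by (intro allI divide_left_mono le mult_pos_pos pos) auto
    have v: "decseq ?v"
      unfolding decseq_Suc_iff
      by (intro allI divide_left_mono mult_mono add_left_mono power_mono le mult_pos_pos pos tpos less_imp_le[OF pos] less_imp_le[OF tpos]) auto
    have v0: "?v n \<ge> 0" for n
      by (intro divide_nonneg_nonneg mult_nonneg_nonneg less_imp_le[OF pos] less_imp_le[OF tpos]) auto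
    have u0: "?u n \<ge> 0" for n by simp
    have "((-1) ^ n * (2 * ?b n)) * (t ^ 0 / (t\<^sup>2 + (?b n)\<^sup>2)) = (-1) ^ n * ?u n - (-1) ^ n * ?v n" for n
    proof -
      have "2 * b / (t\<^sup>2 + b\<^sup>2) = 2 / b - 2 * t\<^sup>2 / (b * (t\<^sup>2 + b\<^sup>2))" if "b > 0" for b :: real
      proof -
        have "t\<^sup>2 + b\<^sup>2 > 0" using t by (intro add_pos_nonneg) auto
        then show ?thesis using that by (simp add: divide_simps) (simp add: algebra_simps power2_eq_square)
      qed
      note split = this[OF pos[of n]]
      have "((-1) ^ n * (2 * ?b n)) * (t ^ 0 / (t\<^sup>2 + (?b n)\<^sup>2)) = (-1) ^ n * (2 * ?b n / (t\<^sup>2 + (?b n)\<^sup>2))"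
        by simp
      also have "\<dots> = (-1) ^ n * ?u n - (-1) ^ n * ?v n"
        unfolding split by (rule right_diff_distrib)
      finally show ?thesis .
    qed
    then have eq: "(\<Sum>n<N. ((-1) ^ n * (2 * ?b n)) * (t ^ 0 / (t\<^sup>2 + (?b n)\<^sup>2)))
        = (\<Sum>n<N. (-1) ^ n * ?u n) - (\<Sum>n<N. (-1) ^ n * ?v n)"
      by (simp only: sum_subtractf)
    have "?v 0 \<le> 2 * t\<^sup>2 / (?b 0 * t\<^sup>2)"
      using t by (intro divide_left_mono mult_left_mono mult_pos_pos pos tpos) auto
    also have "\<dots> = 2 / ?b 0" using t by simp
    finally have "?v 0 \<le> 2 / ?b 0" .
    then show ?thesis
      unfolding eq using alternating_partial_sum_bounds[OF u0 u, of N] alternating_partial_sum_bounds[OF v0 v, of N] t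
      by simp
  qed
  have "(\<lambda>n. (-1) ^ n * (2 * of_real (?b n)) / ((complex_of_real y)\<^sup>2 - (of_real (?b n))\<^sup>2)) sums (- 1 / cos (of_real y))"
    using y by (intro sec_sums) (simp add: cos_of_real)
  then have T: "(\<lambda>n. of_real ((-1) ^ n * (2 * ?b n)) / of_real (y\<^sup>2 - (?b n)\<^sup>2)) sums (- 1 / cos (complex_of_real y))"
    by simp
  have "?b n \<noteq> y" for n using y(2) real_zeros_sin_cos(2)[of n] by metis
  from partial_fractions_mellin_sums[where q = 0 and s = s and p = 0 and c = "\<lambda>n. (-1) ^ n * (2 * ?b n)" and b = ?b and K = "\<lambda>t. 1 / cosh t" and A = "4 / ?b 0", OF _ _ _ _ _ pos y(1) this sech_sums bound T]
  have "(\<lambda>n. of_real ((-1) ^ n * (2 * ?b n)) * of_real (?b n) powr (s + of_nat 0 - 2) / of_real (y\<^sup>2 - (?b n)\<^sup>2)) sums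
      (?H / mellin_const (s + of_nat 0) + of_real y powr (s + of_nat 0 - 2) * (- 1 / cos (of_real y)))"
    using s s2 by simp
  from sums_mult[OF this, of "1 / 2"]
  have "(\<lambda>n. 1 / 2 * (of_real ((-1) ^ n * (2 * ?b n)) * of_real (?b n) powr (s + of_nat 0 - 2) / of_real (y\<^sup>2 - (?b n)\<^sup>2))) sums
      (1 / 2 * (?H / mellin_const (s + of_nat 0) + of_real y powr (s + of_nat 0 - 2) * (- 1 / cos (of_real y))))" .
  also have "(\<lambda>n. 1 / 2 * (of_real ((-1) ^ n * (2 * ?b n)) * of_real (?b n) powr (s + of_nat 0 - 2) / of_real (y\<^sup>2 - (?b n)\<^sup>2)))
     = (\<lambda>n. (-1) ^ n * of_real (?b n) powr (s - 1) / complex_of_real (y\<^sup>2 - (?b n)\<^sup>2))"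
  proof
    fix n
    have "complex_of_real (?b n) powr (s - 1) = of_real (?b n) powr (s - 2) * of_real (?b n)"
      using powr_add_of_nat[OF pos[of n], of "s - 2" 1] by (simp add: algebra_simps)
    moreover have "1 / 2 * (of_real (e * (2 * b)) * w / D) = of_real e * (w * of_real b) / D" for e b :: real and w D :: complex
      by simp
    ultimately show "1 / 2 * (of_real ((-1) ^ n * (2 * ?b n)) * of_real (?b n) powr (s + of_nat 0 - 2) / of_real (y\<^sup>2 - (?b n)\<^sup>2))
      = (-1) ^ n * of_real (?b n) powr (s - 1) / complex_of_real (y\<^sup>2 - (?b n)\<^sup>2)"
      by (simp only: of_nat_0 add_0_right) simp
  qed
  also have "1 / 2 * (?H / mellin_const (s + of_nat 0) + of_real y powr (s + of_nat 0 - 2) * (- 1 / cos (of_real y)))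
     = (2 * ?S * mollified_mellin (\<lambda>t. 1 / cosh t) s y / of_real pi - of_real y powr s / of_real (cos y)) / (2 * of_real (y\<^sup>2))"
  proof -
    have alg: "1 / 2 * (H / (p / (2 * S)) + P / Y\<^sup>2 * (- 1 / c))
       = (2 * S * (Y\<^sup>2 * H) / p - P / c) / (2 * Y\<^sup>2)"
      if "Y \<noteq> 0" "S \<noteq> 0" "c \<noteq> 0" "p \<noteq> 0" for H P Y p S c :: complex
      using that by (simp add: field_simps power2_eq_square)
    show ?thesis
      unfolding powr_minus_2[OF y(1)] mollified_mellin_def of_nat_0 add_0_right cos_of_real of_real_power
      unfolding mellin_const_def
      by (rule alg) (use y0 CS in \<open>auto simp: cos_of_real\<close>)
  qed
  finally show ?thesis .
qed

subsection \<open>The four representations\<close>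

text \<open>For each of the four pairs \<open>k\<close>, \<open>v\<close> in use, the sine in the
  summand factors into a sign \<open>e m\<close> and a constant \<open>\<tau>\<close>, which is up
  to sign the sine or cosine of \<open>pi * s / 2\<close>. So \<open>g_ksv\<close> is a multiple of
  a series already evaluated.\<close>

lemma g_ksv_eq:
  assumes "\<And>m. sin (of_real (pi * (2 * real (m + (1 - k)) + real k) * v) + of_real pi * s / 2) = e m * \<tau>"
    and "\<And>m. pi * (real (m + (1 - k)) + real k / 2) = b m"
    and "(\<lambda>m. e m * of_real (b m) powr (s - 1) / of_real (y\<^sup>2 - (b m)\<^sup>2)) sums \<sigma>"
  shows "g_ksv k s v y = - of_real (sin (y + pi * real k / 2)) *
           (of_real pi * 2 powr s * of_real (y\<^sup>2) / sin (of_real pi * s)) * (\<tau> * \<sigma>)"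
proof -
  have "(\<Sum>m. of_real (b m) powr (s - 1) * (e m * \<tau>) / of_real (y\<^sup>2 - (b m)\<^sup>2)) = \<tau> * \<sigma>"
    using sums_unique[OF sums_mult[OF assms(3), of \<tau>]] by (simp add: mult_ac)
  then show ?thesis unfolding g_ksv_def Let_def assms(1,2) by simp
qed

lemma sin_of_real_add:
  "sin (complex_of_real x + z) = of_real (sin x) * cos z + of_real (cos x) * sin z"
  by (simp add: sin_add sin_of_real cos_of_real)

lemma sin_double_half: "sin (of_real pi * s) = 2 * sin (of_real pi * s / 2) * cos (of_real pi * s / 2)"
  for s :: complex
  using sin_double[of "of_real pi * s / 2"] by simp

lemma real_values_at_multiples_pi:
  "cos (pi * real n) = (-1) ^ n" "sin (pi * real n) = 0"
  "sin (pi * (real n + 1/2)) = (-1) ^ n"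
proof -
  show "cos (pi * real n) = (-1) ^ n" by (rule cos_npi2)
  show "sin (pi * real n) = 0" by (rule sin_npi2)
  have "pi * (real n + 1/2) = pi * real n + pi / 2" by (simp add: algebra_simps)
  then show "sin (pi * (real n + 1/2)) = (-1) ^ n" by (simp only: sin_add) (simp add: cos_npi2)
qed

lemma two_powr_minus:
  "(2::complex) powr (s - 2) = 2 powr s / 4" "(2::complex) powr (- s) = 1 / 2 powr s"
  by (simp_all add: powr_diff powr_minus_divide)

text \<open>Covers \<open>y = 0\<close>, where \<open>cos y\<close> does not vanish but the
  evaluation through damped transforms requires \<open>y > 0\<close>. At this point the exponent is
  \<open>Re s - 3 < -1\<close>, so the series converges absolutely.\<close>

lemma summable_half_integer_powr:
  fixes s :: complex
  assumes "Re s < 2" "\<And>n. norm (e n :: complex) = 1"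
  shows "summable (\<lambda>n. e n * of_real (pi * (real n + 1/2)) powr (s - 1) / of_real (0\<^sup>2 - (pi * (real n + 1/2))\<^sup>2))"
proof (rule summable_comparison_test')
  show "summable (\<lambda>n. real (Suc n) powr (Re s - 3))"
    using assms by (intro summable_real_powr_Suc) auto
  fix n :: nat
  let ?b = "pi * (real n + 1/2)"
  have b: "?b > 0" by simp
  have "norm (e n * of_real ?b powr (s - 1) / of_real (0\<^sup>2 - ?b\<^sup>2)) = ?b powr (Re s - 1) / ?b powr 2"
    unfolding norm_divide norm_mult norm_of_real norm_of_real_powr[OF b] assms(2)
    using b by (simp only: powr_numeral) simp
  also have "\<dots> = ?b powr (Re s - 3)"
    by (simp only: powr_diff[symmetric]) simp
  also have "\<dots> \<le> real (Suc n) powr (Re s - 3)"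
  proof (rule powr_mono2')
    have "2 * (real n + 1/2) \<le> pi * (real n + 1/2)"
      using pi_ge_two by (intro mult_right_mono) auto
    then show "real (Suc n) \<le> ?b" by simp
  qed (use assms in auto)
  finally show "norm (e n * of_real ?b powr (s - 1) / of_real (0\<^sup>2 - ?b\<^sup>2)) \<le> real (Suc n) powr (Re s - 3)" .
qed

text \<open>The value \<open>\<sigma> y\<close> of the series is such that all terms with
  \<open>\<bar>y\<bar> powr s\<close> cancel in \<open>E y\<close>: it equals \<open>2 / pi\<close>
  times the damped transform for each \<open>y\<close> with \<open>sin y \<noteq> 0\<close>.
  Convergence of \<open>E\<close> is then that of the damped transform, and the Dirichlet series
  over even numbers contributes the factor \<open>2 powr (- s)\<close>.\<close>

lemma
  fixes s :: complex
  assumes s: "1 < Re s" "Re s < 2"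
  defines "sm \<equiv> \<lambda>(y::real) n. of_real (pi * real (Suc n)) powr (s - 1) / complex_of_real (y\<^sup>2 - (pi * real (Suc n))\<^sup>2)"
  defines "E \<equiv> \<lambda>y. 1 / of_real (sin y) *
                 (- (of_real \<bar>y\<bar> powr s * of_real (sin y) / sin (of_real pi * s / 2))
                  - of_real \<bar>y\<bar> powr s * of_real (sgn y) * of_real (cos y) / cos (of_real pi * s / 2)
                  + 2 * of_real (y\<^sup>2) * of_real (sin y) / cos (of_real pi * s / 2) * (\<Sum>n. sm y n))"
  shows coth_case_summable: "sin y \<noteq> 0 \<Longrightarrow> summable (sm y)"
    and coth_case_explicit: "\<exists>L. (E \<longlongrightarrow> L) (at_infinity_off_zeros sin) \<and>
       riemann_zeta s = of_real pi * 2 powr (s - 2) / Gamma s * L"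
    and coth_case_f_minus_g: "\<exists>L. ((\<lambda>y. (f_ksv 0 s 1 y - g_ksv 0 s 1 y) / of_real (sin y)) \<longlongrightarrow> L) (at_infinity_off_zeros sin) \<and>
       riemann_zeta s = 1 / Gamma s * L"
proof -
  let ?K = "\<lambda>t::real. cosh t / sinh t - 1"
  let ?C = "cos (of_real pi * s / 2)" and ?S = "sin (of_real pi * s / 2)"
  have "s \<noteq> 2" "s \<noteq> 1" using s by auto
  then have CS: "?C \<noteq> 0" "?S \<noteq> 0"
    using cos_half_pi_mult_neq_0[of s] sin_half_pi_mult_neq_0[of s] s by auto
  obtain D where int: "\<And>y. y > 0 \<Longrightarrow> (\<lambda>t. of_real t powr (s - 1) * of_real (?K t / (t\<^sup>2 + y\<^sup>2))) integrable_on {0<..}"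
    and D: "(\<lambda>n. of_real (1 ^ n * 2) * of_real (real (2 * n + 2)) powr (- s)) sums D"
    and lim: "(mollified_mellin ?K s \<longlongrightarrow> Gamma s * D) at_infinity"
    using mollified_mellin_LIM_geometric[of s 2 ?K, OF s(1) _ hyperbolic_kernels(1)] by auto
  have "of_real (1 ^ n * 2) * of_real (real (2 * n + 2)) powr (- s) = 2 * 2 powr (- s) * of_nat (Suc n) powr (- s)" for n
    using even_powr_complex[of "Suc n" "- s"] by simp
  then have "(\<lambda>n. 2 * 2 powr (- s) * of_nat (Suc n) powr (- s)) sums D" using D by (simp only:)
  then have D_eq: "D = 2 * 2 powr (- s) * riemann_zeta s"
    using sums_mult[OF riemann_zeta_sums[OF s(1)], of "2 * 2 powr (- s)"] by (rule sums_unique2)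
  define \<sigma> where "\<sigma> y = (2 * ?C * mollified_mellin ?K s y / of_real pi
          + of_real \<bar>y\<bar> powr s * (?C / ?S + of_real (sgn y) * of_real (cos y) / of_real (sin y))) / (2 * of_real (y\<^sup>2))" for y
  have \<sigma>: "sm y sums \<sigma> y" if "sin y \<noteq> 0" for y
  proof -
    have "y \<noteq> 0" using that by auto
    then have y: "\<bar>y\<bar> > 0" "sin \<bar>y\<bar> \<noteq> 0" using that by (auto simp: abs_if)
    have "cot \<bar>y\<bar> = sgn y * cos y / sin y" by (auto simp: cot_def abs_if sgn_if)
    then show ?thesis
      using coth_kernel_sums[OF s y int[OF y(1)]] unfolding sm_def \<sigma>_def mollified_mellin_abs power2_abs by simp
  qed
  show "sin y \<noteq> 0 \<Longrightarrow> summable (sm y)" using \<sigma> sums_summable by blast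
  have E: "E y = 2 / of_real pi * mollified_mellin ?K s y" if "y \<noteq> 0" "sin y \<noteq> 0" for y
  proof -
    have alg: "1 / sy * (- (P * sy / S) - P * g * cy / C + 2 * Y * sy / C * ((2 * C * H / p + P * (C / S + g * cy / sy)) / (2 * Y))) = 2 / p * H"
      if "sy \<noteq> 0" "S \<noteq> 0" "C \<noteq> 0" "Y \<noteq> 0" "p \<noteq> 0" for sy P S g cy C Y H p :: complex
      using that by (simp add: field_simps)
    show ?thesis
      unfolding E_def sums_unique[OF \<sigma>[OF that(2)], symmetric] \<sigma>_def
      by (rule alg) (use that CS in auto)
  qed
  have fg: "(f_ksv 0 s 1 y - g_ksv 0 s 1 y) / of_real (sin y) = (of_real pi * 2 powr (s - 2) * (2 / of_real pi)) * mollified_mellin ?K s y"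
    if "y \<noteq> 0" "sin y \<noteq> 0" for y
  proof -
    \<comment> \<open>For \<open>v = 1\<close> and \<open>k = 0\<close> the phase is a multiple of
      \<open>2 * pi\<close> plus \<open>pi * s / 2\<close>. The resulting factor \<open>?S\<close>
      cancels against \<open>sin (pi * s) = 2 * ?S * ?C\<close>.\<close>
    have "sin (of_real (pi * (2 * real (m + (1 - 0)) + real 0) * 1) + of_real pi * s / 2) = 1 * ?S" for m
      unfolding sin_of_real_add using real_values_at_multiples_pi(1,2)[of "2 * Suc m"] by (simp add: algebra_simps)
    from g_ksv_eq[OF this, of "\<lambda>n. pi * real (Suc n)" y "\<sigma> y"]
    have g: "g_ksv 0 s 1 y = - of_real (sin y) * (of_real pi * 2 powr s * of_real (y\<^sup>2) / (2 * ?S * ?C)) * (?S * \<sigma> y)"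
      using \<sigma>[OF that(2)] by (simp add: sm_def sin_double_half)
    have f: "f_ksv 0 s 1 y = - of_real pi * (2 powr s / 4) * (of_real \<bar>y\<bar> powr s * of_real (sin y) / ?S + of_real \<bar>y\<bar> powr s * of_real (sgn y) * of_real (cos y) / ?C)"
      by (simp add: f_ksv_def two_powr_minus)
    have alg: "(- p * (A / 4) * (P * sy / S + P * g * cy / C) - - sy * (p * A * Y / (2 * S * C)) * (S * x)) / sy
       = p * (A / 4) * (1 / sy * (- (P * sy / S) - P * g * cy / C + 2 * Y * sy / C * x))"
      if "sy \<noteq> 0" "S \<noteq> 0" "C \<noteq> 0" for p A P sy S g cy C Y x :: complex
      using that by (simp add: field_simps)
    have "(f_ksv 0 s 1 y - g_ksv 0 s 1 y) / of_real (sin y) = of_real pi * (2 powr s / 4) * E y"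
      unfolding f g E_def sums_unique[OF \<sigma>[OF that(2)], symmetric] by (rule alg) (use that CS in auto)
    then show ?thesis unfolding E[OF that] two_powr_minus by simp
  qed
  have \<zeta>: "riemann_zeta s = of_real pi * 2 powr (s - 2) / Gamma s * (2 / of_real pi * (Gamma s * D))"
    unfolding D_eq two_powr_minus using Gamma_neq_0[of s] s by simp
  then show "\<exists>L. (E \<longlongrightarrow> L) (at_infinity_off_zeros sin) \<and>
       riemann_zeta s = of_real pi * 2 powr (s - 2) / Gamma s * L"
    using tendsto_off_zeros[where E = E and d = sin, OF lim E] by blast
  have "riemann_zeta s = 1 / Gamma s * ((of_real pi * 2 powr (s - 2) * (2 / of_real pi)) * (Gamma s * D))"
    using \<zeta> by simp
  then show "\<exists>L. ((\<lambda>y. (f_ksv 0 s 1 y - g_ksv 0 s 1 y) / of_real (sin y)) \<longlongrightarrow> L) (at_infinity_off_zeros sin) \<and>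
       riemann_zeta s = 1 / Gamma s * L"
    using tendsto_off_zeros[where E = "\<lambda>y. (f_ksv 0 s 1 y - g_ksv 0 s 1 y) / of_real (sin y)" and d = sin, OF lim fg] by blast
qed

text \<open>The same cancellation as for \<open>coth\<close>, now with odd numbers in the Dirichlet
  series, whence the factor \<open>1 - 2 powr (- s)\<close>. The version with \<open>f_ksv\<close>
  and \<open>g_ksv\<close> avoids \<open>s = 2\<close>, where \<open>sin (pi * s / 2)\<close>
  vanishes in their denominators but not in the explicit expression.\<close>

lemma
  fixes s :: complex
  assumes s: "1 < Re s" "Re s < 3"
  defines "sm \<equiv> \<lambda>(y::real) n. (-1) ^ Suc n * of_real (pi * real (Suc n)) powr (s - 1) / complex_of_real (y\<^sup>2 - (pi * real (Suc n))\<^sup>2)"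
  defines "E \<equiv> \<lambda>y. 1 / of_real (sin y) *
                 (- (of_real \<bar>y\<bar> powr s * of_real (sgn y))
                  + 2 * of_real (y\<^sup>2) * of_real (sin y) * (\<Sum>n. sm y n))"
  shows csch_case_summable: "sin y \<noteq> 0 \<Longrightarrow> summable (sm y)"
    and csch_case_explicit: "\<exists>L. (E \<longlongrightarrow> L) (at_infinity_off_zeros sin) \<and>
       riemann_zeta s = of_real pi * 2 powr (s - 2) / ((2 powr s - 1) * Gamma s * cos (of_real pi * s / 2)) * L"
    and csch_case_f_minus_g: "s \<notin> \<nat> \<Longrightarrow> \<exists>L. ((\<lambda>y. (f_ksv 0 s (1/2) y - g_ksv 0 s (1/2) y) / of_real (sin y)) \<longlongrightarrow> L) (at_infinity_off_zeros sin) \<and>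
       riemann_zeta s = 1 / ((2 powr s - 1) * Gamma s) * L"
proof -
  let ?K = "\<lambda>t::real. 1 / sinh t"
  let ?C = "cos (of_real pi * s / 2)" and ?S = "sin (of_real pi * s / 2)"
  have "s \<noteq> 1" using s by auto
  then have C: "?C \<noteq> 0"
    using cos_half_pi_mult_neq_0[of s] s by auto
  obtain D where int: "\<And>y. y > 0 \<Longrightarrow> (\<lambda>t. of_real t powr (s - 1) * of_real (?K t / (t\<^sup>2 + y\<^sup>2))) integrable_on {0<..}"
    and D: "(\<lambda>n. of_real (1 ^ n * 2) * of_real (real (2 * n + 1)) powr (- s)) sums D"
    and lim: "(mollified_mellin ?K s \<longlongrightarrow> Gamma s * D) at_infinity"
    using mollified_mellin_LIM_geometric[of s 1 ?K, OF s(1) _ hyperbolic_kernels(2)] by auto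
  have "(\<lambda>n. of_nat (2 * n + 1) powr (- s)) sums (D / 2)"
    using sums_divide[OF D, of 2] by simp
  from odd_zeta_sum[OF s(1) this]
  have D_eq: "D = 2 * (1 - 2 powr (- s)) * riemann_zeta s" by (simp add: field_simps)
  define \<sigma> where "\<sigma> y = (2 * ?C * mollified_mellin ?K s y / of_real pi
          + of_real \<bar>y\<bar> powr s * of_real (sgn y) / of_real (sin y)) / (2 * of_real (y\<^sup>2))" for y
  have \<sigma>: "sm y sums \<sigma> y" if "sin y \<noteq> 0" for y
  proof -
    have "y \<noteq> 0" using that by auto
    then have y: "\<bar>y\<bar> > 0" "sin \<bar>y\<bar> \<noteq> 0" using that by (auto simp: abs_if)
    have "P / of_real (sin \<bar>y\<bar>) = P * of_real (sgn y) / of_real (sin y)" for P :: complex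
      using y(1) by (auto simp: abs_if sgn_if)
    then show ?thesis
      using csch_kernel_sums[OF s y int[OF y(1)]] unfolding sm_def \<sigma>_def mollified_mellin_abs power2_abs by simp
  qed
  show "sin y \<noteq> 0 \<Longrightarrow> summable (sm y)" using \<sigma> sums_summable by blast
  have E: "E y = 2 * ?C / of_real pi * mollified_mellin ?K s y" if "y \<noteq> 0" "sin y \<noteq> 0" for y
  proof -
    have alg: "1 / sy * (- (P * g) + 2 * Y * sy * ((2 * C * H / p + P * g / sy) / (2 * Y))) = 2 * C / p * H"
      if "sy \<noteq> 0" "Y \<noteq> 0" "p \<noteq> 0" for sy P g C Y H p :: complex
      using that by (simp add: field_simps)
    show ?thesis
      unfolding E_def sums_unique[OF \<sigma>[OF that(2)], symmetric] \<sigma>_def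
      by (rule alg) (use that in auto)
  qed
  have "norm ((2::complex) powr s) = 2 powr Re s"
    using norm_of_real_powr[of 2 s] by simp
  also have "2 powr Re s > (1::real)" using s by simp
  finally have A: "(2::complex) powr s \<noteq> 1" by auto
  have \<zeta>: "riemann_zeta s = of_real pi * 2 powr (s - 2) / ((2 powr s - 1) * Gamma s * ?C) * (2 * ?C / of_real pi * (Gamma s * D))"
    unfolding D_eq two_powr_minus using Gamma_neq_0[of s] s A C by (simp add: field_simps)
  then show "\<exists>L. (E \<longlongrightarrow> L) (at_infinity_off_zeros sin) \<and>
       riemann_zeta s = of_real pi * 2 powr (s - 2) / ((2 powr s - 1) * Gamma s * ?C) * L"
    using tendsto_off_zeros[where E = E and d = sin, OF lim E] by blast
  assume "s \<notin> \<nat>"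
  then have "s \<noteq> 2" by auto
  then have S: "?S \<noteq> 0" using sin_half_pi_mult_neq_0[of s] s by auto
  have fg: "(f_ksv 0 s (1/2) y - g_ksv 0 s (1/2) y) / of_real (sin y) = (of_real pi * 2 powr (s - 2) / ?C * (2 * ?C / of_real pi)) * mollified_mellin ?K s y"
    if "y \<noteq> 0" "sin y \<noteq> 0" for y
  proof -
    \<comment> \<open>For \<open>v = 1/2\<close> the phase advances by \<open>pi\<close> with each
      term, which produces the alternating sign; the sum starts at \<open>1\<close>, hence
      \<open>Suc m\<close>. The argument \<open>(2 * v - 1) * y\<close> in \<open>f_ksv\<close>
      becomes \<open>0\<close>.\<close>
    have "sin (of_real (pi * (2 * real (m + (1 - 0)) + real 0) * (1/2)) + of_real pi * s / 2) = (-1) ^ Suc m * ?S" for m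
      unfolding sin_of_real_add using real_values_at_multiples_pi(1,2)[of "Suc m"] by (simp add: algebra_simps)
    from g_ksv_eq[OF this, of "\<lambda>n. pi * real (Suc n)" y "\<sigma> y"]
    have g: "g_ksv 0 s (1/2) y = - of_real (sin y) * (of_real pi * 2 powr s * of_real (y\<^sup>2) / (2 * ?S * ?C)) * (?S * \<sigma> y)"
      using \<sigma>[OF that(2)] by (simp add: sm_def sin_double_half)
    have f: "f_ksv 0 s (1/2) y = - of_real pi * (2 powr s / 4) * (of_real \<bar>y\<bar> powr s * of_real (sgn y) / ?C)"
      by (simp add: f_ksv_def two_powr_minus)
    have alg: "(- p * (A / 4) * (P * g / C) - - sy * (p * A * Y / (2 * S * C)) * (S * x)) / sy
       = p * (A / 4) / C * (1 / sy * (- (P * g) + 2 * Y * sy * x))"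
      if "sy \<noteq> 0" "S \<noteq> 0" "C \<noteq> 0" for p A P sy S g C Y x :: complex
      using that by (simp add: field_simps)
    have "(f_ksv 0 s (1/2) y - g_ksv 0 s (1/2) y) / of_real (sin y) = of_real pi * (2 powr s / 4) / ?C * E y"
      unfolding f g E_def sums_unique[OF \<sigma>[OF that(2)], symmetric] by (rule alg) (use that C S in auto)
    then show ?thesis unfolding E[OF that] two_powr_minus by simp
  qed
  have "riemann_zeta s = 1 / ((2 powr s - 1) * Gamma s) * ((of_real pi * 2 powr (s - 2) / ?C * (2 * ?C / of_real pi)) * (Gamma s * D))"
    using \<zeta> by (simp add: mult_ac)
  then show "\<exists>L. ((\<lambda>y. (f_ksv 0 s (1/2) y - g_ksv 0 s (1/2) y) / of_real (sin y)) \<longlongrightarrow> L) (at_infinity_off_zeros sin) \<and>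
       riemann_zeta s = 1 / ((2 powr s - 1) * Gamma s) * L"
    using tendsto_off_zeros[where E = "\<lambda>y. (f_ksv 0 s (1/2) y - g_ksv 0 s (1/2) y) / of_real (sin y)" and d = sin, OF lim fg] by blast
qed

text \<open>Here the Dirichlet series is the alternating zeta series, which reaches
  \<open>Re s > 0\<close> but determines \<open>\<zeta>\<close> only after division by
  \<open>1 - 2 powr (1 - s)\<close>. The zeros of this factor on the line \<open>Re s = 1\<close>
  are excluded.\<close>

lemma
  fixes s :: complex
  assumes s: "0 < Re s" "Re s < 2" and s_nat: "s \<notin> \<nat>" and "2 powr (1 - s) \<noteq> 1"
  defines "sm \<equiv> \<lambda>(y::real) n. of_real (pi * (real n + 1/2)) powr (s - 1) / complex_of_real (y\<^sup>2 - (pi * (real n + 1/2))\<^sup>2)"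
  defines "E \<equiv> \<lambda>y. 1 / of_real (cos y) *
                 (of_real \<bar>y\<bar> powr s * of_real (cos y) / sin (of_real pi * s / 2)
                  - of_real \<bar>y\<bar> powr s * of_real (sgn y) * of_real (sin y) / cos (of_real pi * s / 2)
                  - 2 * of_real (y\<^sup>2) * of_real (cos y) / cos (of_real pi * s / 2) * (\<Sum>n. sm y n))"
  shows tanh_case_summable: "cos y \<noteq> 0 \<Longrightarrow> summable (sm y)"
    and tanh_case_explicit: "\<exists>L. (E \<longlongrightarrow> L) (at_infinity_off_zeros cos) \<and>
       riemann_zeta s = of_real pi * 2 powr (s - 2) / ((1 - 2 powr (1 - s)) * Gamma s) * L"
    and tanh_case_f_minus_g: "\<exists>L. ((\<lambda>y. (f_ksv 1 s 1 y - g_ksv 1 s 1 y) / of_real (cos y)) \<longlongrightarrow> L) (at_infinity_off_zeros cos) \<and>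
       riemann_zeta s = 1 / ((1 - 2 powr (1 - s)) * Gamma s) * L"
proof -
  let ?K = "\<lambda>t::real. 1 - tanh t"
  let ?C = "cos (of_real pi * s / 2)" and ?S = "sin (of_real pi * s / 2)"
  have "s \<noteq> 2" and s1: "s \<noteq> 1" using s s_nat by auto
  then have CS: "?C \<noteq> 0" "?S \<noteq> 0"
    using cos_half_pi_mult_neq_0[of s] sin_half_pi_mult_neq_0[of s] s s1 by auto
  obtain D where int: "\<And>y. y > 0 \<Longrightarrow> (\<lambda>t. of_real t powr (s - 1) * of_real (?K t / (t\<^sup>2 + y\<^sup>2))) integrable_on {0<..}"
    and D: "(\<lambda>n. of_real ((-1) ^ n * 2) * of_real (real (2 * n + 2)) powr (- s)) sums D"
    and lim: "(mollified_mellin ?K s \<longlongrightarrow> Gamma s * D) at_infinity"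
    using mollified_mellin_LIM_alternating[of s 2 ?K, OF s(1) _ hyperbolic_kernels(3)] by auto
  have "of_real ((-1) ^ n * 2) * of_real (real (2 * n + 2)) powr (- s) / (2 * 2 powr (- s)) = (-1) ^ n * of_nat (Suc n) powr (- s)" for n
    using even_powr_complex[of "Suc n" "- s"] by simp
  then have "(\<lambda>n. (-1) ^ n * of_nat (Suc n) powr (- s)) sums (D / (2 * 2 powr (- s)))"
    using sums_divide[OF D, of "2 * 2 powr (- s)"] by simp
  from alternating_zeta_sum[OF s(1) s1 this]
  have D_eq: "D = 2 * 2 powr (- s) * ((1 - 2 powr (1 - s)) * riemann_zeta s)"
    by (simp add: divide_eq_eq mult_ac)
  define \<sigma> where "\<sigma> y = (of_real \<bar>y\<bar> powr s * (?C / ?S - of_real (sgn y) * of_real (sin y) / of_real (cos y))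
     - 2 * ?C * mollified_mellin ?K s y / of_real pi) / (2 * of_real (y\<^sup>2))" for y
  have \<sigma>: "sm y sums \<sigma> y" if "y \<noteq> 0" "cos y \<noteq> 0" for y
  proof -
    have y: "\<bar>y\<bar> > 0" "cos \<bar>y\<bar> \<noteq> 0" using that by (auto simp: abs_if)
    have "tan \<bar>y\<bar> = sgn y * sin y / cos y" by (auto simp: tan_def abs_if sgn_if)
    then show ?thesis
      using tanh_kernel_sums[OF s s1 y int[OF y(1)]] unfolding sm_def \<sigma>_def mollified_mellin_abs power2_abs by simp
  qed
  show "cos y \<noteq> 0 \<Longrightarrow> summable (sm y)"
    using \<sigma>[of y] sums_summable summable_half_integer_powr[of s "\<lambda>_. 1"] s by (cases "y = 0") (auto simp: sm_def)
  have E: "E y = 2 / of_real pi * mollified_mellin ?K s y" if "y \<noteq> 0" "cos y \<noteq> 0" for y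
  proof -
    have alg: "1 / cy * (P * cy / S - P * g * sy / C - 2 * Y * cy / C * ((P * (C / S - g * sy / cy) - 2 * C * H / p) / (2 * Y))) = 2 / p * H"
      if "cy \<noteq> 0" "S \<noteq> 0" "C \<noteq> 0" "Y \<noteq> 0" "p \<noteq> 0" for sy P S g cy C Y H p :: complex
      using that by (simp add: field_simps)
    show ?thesis
      unfolding E_def sums_unique[OF \<sigma>[OF that], symmetric] \<sigma>_def
      by (rule alg) (use that CS in auto)
  qed
  have fg: "(f_ksv 1 s 1 y - g_ksv 1 s 1 y) / of_real (cos y) = (of_real pi * 2 powr (s - 2) * (2 / of_real pi)) * mollified_mellin ?K s y"
    if "y \<noteq> 0" "cos y \<noteq> 0" for y
  proof -
    \<comment> \<open>The phases are odd multiples of \<open>pi\<close> plus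
      \<open>pi * s / 2\<close>, so the constant is \<open>- ?S\<close>.\<close>
    have "sin (of_real (pi * (2 * real (m + (1 - 1)) + real 1) * 1) + of_real pi * s / 2) = 1 * - ?S" for m
      unfolding sin_of_real_add using real_values_at_multiples_pi(1,2)[of "2 * m + 1"] by (simp add: algebra_simps)
    from g_ksv_eq[OF this, of "\<lambda>n. pi * (real n + 1/2)" y "\<sigma> y"]
    have g: "g_ksv 1 s 1 y = - of_real (cos y) * (of_real pi * 2 powr s * of_real (y\<^sup>2) / (2 * ?S * ?C)) * (- ?S * \<sigma> y)"
      using \<sigma>[OF that] by (simp add: sm_def sin_double_half sin_add)
    have f: "f_ksv 1 s 1 y = - of_real pi * (2 powr s / 4) * (of_real \<bar>y\<bar> powr s * (- of_real (cos y)) / ?S + of_real \<bar>y\<bar> powr s * of_real (sgn y) * of_real (sin y) / ?C)"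
      by (simp add: f_ksv_def two_powr_minus sin_diff cos_diff)
    have alg: "(- p * (A / 4) * (P * (- cy) / S + P * g * sy / C) - - cy * (p * A * Y / (2 * S * C)) * (- S * x)) / cy
       = p * (A / 4) * (1 / cy * (P * cy / S - P * g * sy / C - 2 * Y * cy / C * x))"
      if "cy \<noteq> 0" "S \<noteq> 0" "C \<noteq> 0" for p A P sy S g cy C Y x :: complex
      using that by (simp add: field_simps)
    have "(f_ksv 1 s 1 y - g_ksv 1 s 1 y) / of_real (cos y) = of_real pi * (2 powr s / 4) * E y"
      unfolding f g E_def sums_unique[OF \<sigma>[OF that], symmetric] by (rule alg) (use that CS in auto)
    then show ?thesis unfolding E[OF that] two_powr_minus by simp
  qed
  have \<zeta>: "riemann_zeta s = of_real pi * 2 powr (s - 2) / ((1 - 2 powr (1 - s)) * Gamma s) * (2 / of_real pi * (Gamma s * D))"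
    unfolding D_eq two_powr_minus using Gamma_neq_0[of s] s assms(4) by simp
  then show "\<exists>L. (E \<longlongrightarrow> L) (at_infinity_off_zeros cos) \<and>
       riemann_zeta s = of_real pi * 2 powr (s - 2) / ((1 - 2 powr (1 - s)) * Gamma s) * L"
    using tendsto_off_zeros[where E = E and d = cos, OF lim E] by blast
  have "riemann_zeta s = 1 / ((1 - 2 powr (1 - s)) * Gamma s) * ((of_real pi * 2 powr (s - 2) * (2 / of_real pi)) * (Gamma s * D))"
    using \<zeta> by (simp add: mult_ac)
  then show "\<exists>L. ((\<lambda>y. (f_ksv 1 s 1 y - g_ksv 1 s 1 y) / of_real (cos y)) \<longlongrightarrow> L) (at_infinity_off_zeros cos) \<and>
       riemann_zeta s = 1 / ((1 - 2 powr (1 - s)) * Gamma s) * L"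
    using tendsto_off_zeros[where E = "\<lambda>y. (f_ksv 1 s 1 y - g_ksv 1 s 1 y) / of_real (cos y)" and d = cos, OF lim fg] by blast
qed

text \<open>The alternating series over odd numbers is \<open>dirichlet_beta\<close> by definition,
  so no continuation is involved. The version with \<open>f_ksv\<close> and \<open>g_ksv\<close>
  avoids \<open>s = 1\<close>, where they divide by \<open>cos (pi * s / 2) = 0\<close>.\<close>

lemma
  fixes s :: complex
  assumes s: "0 < Re s" "Re s < 2"
  defines "sm \<equiv> \<lambda>(y::real) n. (-1) ^ n * of_real (pi * (real n + 1/2)) powr (s - 1) / complex_of_real (y\<^sup>2 - (pi * (real n + 1/2))\<^sup>2)"
  defines "E \<equiv> \<lambda>y. 1 / of_real (cos y) *
                 (of_real \<bar>y\<bar> powr s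
                  + 2 * of_real (y\<^sup>2) * of_real (cos y) * (\<Sum>n. sm y n))"
  shows sech_case_summable: "cos y \<noteq> 0 \<Longrightarrow> summable (sm y)"
    and sech_case_explicit: "\<exists>L. (E \<longlongrightarrow> L) (at_infinity_off_zeros cos) \<and>
       dirichlet_beta s = of_real pi / (4 * Gamma s * sin (of_real pi * s / 2)) * L"
    and sech_case_f_minus_g: "s \<notin> \<nat> \<Longrightarrow> \<exists>L. ((\<lambda>y. (f_ksv 1 s (1/2) y - g_ksv 1 s (1/2) y) / of_real (cos y)) \<longlongrightarrow> L) (at_infinity_off_zeros cos) \<and>
       dirichlet_beta s = 1 / (2 powr s * Gamma s) * L"
proof -
  let ?K = "\<lambda>t::real. 1 / cosh t"
  let ?C = "cos (of_real pi * s / 2)" and ?S = "sin (of_real pi * s / 2)"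
  have "s \<noteq> 2" using s by auto
  then have S: "?S \<noteq> 0"
    using sin_half_pi_mult_neq_0[of s] s by auto
  obtain D where int: "\<And>y. y > 0 \<Longrightarrow> (\<lambda>t. of_real t powr (s - 1) * of_real (?K t / (t\<^sup>2 + y\<^sup>2))) integrable_on {0<..}"
    and D: "(\<lambda>n. of_real ((-1) ^ n * 2) * of_real (real (2 * n + 1)) powr (- s)) sums D"
    and lim: "(mollified_mellin ?K s \<longlongrightarrow> Gamma s * D) at_infinity"
    using mollified_mellin_LIM_alternating[of s 1 ?K, OF s(1) _ hyperbolic_kernels(4)] by auto
  have "(\<lambda>n. (-1) ^ n * of_nat (2 * n + 1) powr (- s)) sums (D / 2)"
    using sums_divide[OF D, of 2] by simp
  then have "dirichlet_beta s = D / 2"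
    unfolding dirichlet_beta_def by (rule sums_unique[symmetric])
  then have D_eq: "D = 2 * dirichlet_beta s" by (simp add: mult.commute)
  define \<sigma> where "\<sigma> y = (2 * ?S * mollified_mellin ?K s y / of_real pi
          - of_real \<bar>y\<bar> powr s / of_real (cos y)) / (2 * of_real (y\<^sup>2))" for y
  have \<sigma>: "sm y sums \<sigma> y" if "y \<noteq> 0" "cos y \<noteq> 0" for y
  proof -
    have y: "\<bar>y\<bar> > 0" "cos \<bar>y\<bar> \<noteq> 0" using that by (auto simp: abs_if)
    have "cos \<bar>y\<bar> = cos y" by (simp add: abs_if)
    then show ?thesis
      using sech_kernel_sums[OF s y int[OF y(1)]] unfolding sm_def \<sigma>_def mollified_mellin_abs power2_abs by simp
  qed
  show "cos y \<noteq> 0 \<Longrightarrow> summable (sm y)"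
    using \<sigma>[of y] sums_summable summable_half_integer_powr[of s "\<lambda>n. (-1) ^ n"] s
    by (cases "y = 0") (auto simp: sm_def norm_power)
  have E: "E y = 2 * ?S / of_real pi * mollified_mellin ?K s y" if "y \<noteq> 0" "cos y \<noteq> 0" for y
  proof -
    have alg: "1 / cy * (P + 2 * Y * cy * ((2 * S * H / p - P / cy) / (2 * Y))) = 2 * S / p * H"
      if "cy \<noteq> 0" "Y \<noteq> 0" "p \<noteq> 0" for cy P S Y H p :: complex
      using that by (simp add: field_simps)
    show ?thesis
      unfolding E_def sums_unique[OF \<sigma>[OF that], symmetric] \<sigma>_def
      by (rule alg) (use that in auto)
  qed
  have \<beta>: "dirichlet_beta s = of_real pi / (4 * Gamma s * ?S) * (2 * ?S / of_real pi * (Gamma s * D))"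
    unfolding D_eq using Gamma_neq_0[of s] s S by (simp add: field_simps)
  then show "\<exists>L. (E \<longlongrightarrow> L) (at_infinity_off_zeros cos) \<and>
       dirichlet_beta s = of_real pi / (4 * Gamma s * ?S) * L"
    using tendsto_off_zeros[where E = E and d = cos, OF lim E] by blast
  assume "s \<notin> \<nat>"
  then have "s \<noteq> 1" by auto
  then have C: "?C \<noteq> 0" using cos_half_pi_mult_neq_0[of s] s by auto
  have fg: "(f_ksv 1 s (1/2) y - g_ksv 1 s (1/2) y) / of_real (cos y) = (of_real pi * (2 powr s / 4) / ?S * (2 * ?S / of_real pi)) * mollified_mellin ?K s y"
    if "y \<noteq> 0" "cos y \<noteq> 0" for y
  proof -
    \<comment> \<open>The phase is \<open>pi * (m + 1/2)\<close> plus \<open>pi * s / 2\<close>: the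
      quarter period turns the sine into \<open>?C\<close>, and \<open>pi * m\<close> gives the
      sign.\<close>
    have "sin (of_real (pi * (2 * real (m + (1 - 1)) + real 1) * (1/2)) + of_real pi * s / 2) = (-1) ^ m * ?C" for m
      unfolding sin_of_real_add using real_values_at_multiples_pi(3)[of m] real_zeros_sin_cos(2)[of m] by (simp add: algebra_simps)
    from g_ksv_eq[OF this, of "\<lambda>n. pi * (real n + 1/2)" y "\<sigma> y"]
    have g: "g_ksv 1 s (1/2) y = - of_real (cos y) * (of_real pi * 2 powr s * of_real (y\<^sup>2) / (2 * ?S * ?C)) * (?C * \<sigma> y)"
      using \<sigma>[OF that] by (simp add: sm_def sin_double_half sin_add)
    have f: "f_ksv 1 s (1/2) y = - of_real pi * (2 powr s / 4) * (- (of_real \<bar>y\<bar> powr s) / ?S)"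
      by (simp add: f_ksv_def two_powr_minus)
    have alg: "(- p * (A / 4) * (- P / S) - - cy * (p * A * Y / (2 * S * C)) * (C * x)) / cy
       = p * (A / 4) / S * (1 / cy * (P + 2 * Y * cy * x))"
      if "cy \<noteq> 0" "S \<noteq> 0" "C \<noteq> 0" for p A P cy S C Y x :: complex
      using that by (simp add: field_simps)
    have "(f_ksv 1 s (1/2) y - g_ksv 1 s (1/2) y) / of_real (cos y) = of_real pi * (2 powr s / 4) / ?S * E y"
      unfolding f g E_def sums_unique[OF \<sigma>[OF that], symmetric] by (rule alg) (use that C S in auto)
    then show ?thesis unfolding E[OF that] by simp
  qed
  have "dirichlet_beta s = 1 / (2 powr s * Gamma s) * ((of_real pi * (2 powr s / 4) / ?S * (2 * ?S / of_real pi)) * (Gamma s * D))"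
    unfolding D_eq using Gamma_neq_0[of s] s S by simp
  then show "\<exists>L. ((\<lambda>y. (f_ksv 1 s (1/2) y - g_ksv 1 s (1/2) y) / of_real (cos y)) \<longlongrightarrow> L) (at_infinity_off_zeros cos) \<and>
       dirichlet_beta s = 1 / (2 powr s * Gamma s) * L"
    using tendsto_off_zeros[where E = "\<lambda>y. (f_ksv 1 s (1/2) y - g_ksv 1 s (1/2) y) / of_real (cos y)" and d = cos, OF lim fg] by blast
qed

text \<open>Each \<open>\<exists>L\<close> asserts that the limit exists and that its value yields
  the zeta or beta value. The summability clauses make the infinite sums genuine limits, since
  \<open>suminf\<close> also denotes some value for a divergent series. In (c) the conditions on
  \<open>s\<close> keep \<open>sin (pi * s)\<close> and \<open>1 - 2 powr (1 - s)\<close> away from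
  \<open>0\<close>.\<close>

theorem corollary2p3:
  fixes s :: complex
  shows
   \<comment> \<open>(a)\<close>
   "(1 < Re s \<and> Re s < 2 \<longrightarrow>
      (\<exists>L. ((\<lambda>y. (f_ksv 0 s 1 y - g_ksv 0 s 1 y) / of_real (sin y)) \<longlongrightarrow> L) (at_infinity_off_zeros sin)
         \<and> riemann_zeta s = 1 / Gamma s * L)
      \<and> (\<forall>y::real. sin y \<noteq> 0 \<longrightarrow>
           summable (\<lambda>n. of_real (pi * real (Suc n)) powr (s - 1)
                           / of_real (y\<^sup>2 - (pi * real (Suc n))\<^sup>2)))
      \<and> (\<exists>L. ((\<lambda>y. 1 / of_real (sin y) *
                 (- (of_real \<bar>y\<bar> powr s * of_real (sin y) / sin (of_real pi * s / 2))
                  - of_real \<bar>y\<bar> powr s * of_real (sgn y) * of_real (cos y) / cos (of_real pi * s / 2)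
                  + 2 * of_real (y\<^sup>2) * of_real (sin y) / cos (of_real pi * s / 2) *
                    (\<Sum>n. of_real (pi * real (Suc n)) powr (s - 1)
                           / of_real (y\<^sup>2 - (pi * real (Suc n))\<^sup>2))))
              \<longlongrightarrow> L) (at_infinity_off_zeros sin)
         \<and> riemann_zeta s = of_real pi * 2 powr (s - 2) / Gamma s * L))
    \<and>
    \<comment> \<open>(b)\<close>
    (1 < Re s \<and> Re s < 3 \<longrightarrow>
      (s \<notin> \<nat> \<longrightarrow>
        (\<exists>L. ((\<lambda>y. (f_ksv 0 s (1/2) y - g_ksv 0 s (1/2) y) / of_real (sin y)) \<longlongrightarrow> L)
                (at_infinity_off_zeros sin)
           \<and> riemann_zeta s = 1 / ((2 powr s - 1) * Gamma s) * L))
      \<and> (\<forall>y::real. sin y \<noteq> 0 \<longrightarrow>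
           summable (\<lambda>n. (-1) ^ Suc n * of_real (pi * real (Suc n)) powr (s - 1)
                           / of_real (y\<^sup>2 - (pi * real (Suc n))\<^sup>2)))
      \<and> (\<exists>L. ((\<lambda>y. 1 / of_real (sin y) *
                 (- (of_real \<bar>y\<bar> powr s * of_real (sgn y))
                  + 2 * of_real (y\<^sup>2) * of_real (sin y) *
                    (\<Sum>n. (-1) ^ Suc n * of_real (pi * real (Suc n)) powr (s - 1)
                           / of_real (y\<^sup>2 - (pi * real (Suc n))\<^sup>2))))
              \<longlongrightarrow> L) (at_infinity_off_zeros sin)
         \<and> riemann_zeta s = of_real pi * 2 powr (s - 2)
               / ((2 powr s - 1) * Gamma s * cos (of_real pi * s / 2)) * L))
    \<and>
    \<comment> \<open>(c)\<close>
    (0 < Re s \<and> Re s < 2 \<and> s \<notin> \<nat> \<and> 2 powr (1 - s) \<noteq> 1 \<longrightarrow>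
      (\<exists>L. ((\<lambda>y. (f_ksv 1 s 1 y - g_ksv 1 s 1 y) / of_real (cos y)) \<longlongrightarrow> L) (at_infinity_off_zeros cos)
         \<and> riemann_zeta s = 1 / ((1 - 2 powr (1 - s)) * Gamma s) * L)
      \<and> (\<forall>y::real. cos y \<noteq> 0 \<longrightarrow>
           summable (\<lambda>n. of_real (pi * (real n + 1/2)) powr (s - 1)
                           / of_real (y\<^sup>2 - (pi * (real n + 1/2))\<^sup>2)))
      \<and> (\<exists>L. ((\<lambda>y. 1 / of_real (cos y) *
                 (of_real \<bar>y\<bar> powr s * of_real (cos y) / sin (of_real pi * s / 2)
                  - of_real \<bar>y\<bar> powr s * of_real (sgn y) * of_real (sin y) / cos (of_real pi * s / 2)
                  - 2 * of_real (y\<^sup>2) * of_real (cos y) / cos (of_real pi * s / 2) *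
                    (\<Sum>n. of_real (pi * (real n + 1/2)) powr (s - 1)
                           / of_real (y\<^sup>2 - (pi * (real n + 1/2))\<^sup>2))))
              \<longlongrightarrow> L) (at_infinity_off_zeros cos)
         \<and> riemann_zeta s = of_real pi * 2 powr (s - 2)
               / ((1 - 2 powr (1 - s)) * Gamma s) * L))
    \<and>
    \<comment> \<open>(d)\<close>
    (0 < Re s \<and> Re s < 2 \<longrightarrow>
      (s \<notin> \<nat> \<longrightarrow>
        (\<exists>L. ((\<lambda>y. (f_ksv 1 s (1/2) y - g_ksv 1 s (1/2) y) / of_real (cos y)) \<longlongrightarrow> L)
                (at_infinity_off_zeros cos)
           \<and> dirichlet_beta s = 1 / (2 powr s * Gamma s) * L))
      \<and> (\<forall>y::real. cos y \<noteq> 0 \<longrightarrow>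
           summable (\<lambda>n. (-1) ^ n * of_real (pi * (real n + 1/2)) powr (s - 1)
                           / of_real (y\<^sup>2 - (pi * (real n + 1/2))\<^sup>2)))
      \<and> (\<exists>L. ((\<lambda>y. 1 / of_real (cos y) *
                 (of_real \<bar>y\<bar> powr s
                  + 2 * of_real (y\<^sup>2) * of_real (cos y) *
                    (\<Sum>n. (-1) ^ n * of_real (pi * (real n + 1/2)) powr (s - 1)
                           / of_real (y\<^sup>2 - (pi * (real n + 1/2))\<^sup>2))))
              \<longlongrightarrow> L) (at_infinity_off_zeros cos)
         \<and> dirichlet_beta s = of_real pi / (4 * Gamma s * sin (of_real pi * s / 2)) * L))"
proof (intro conjI impI allI; (elim conjE)?)
qed (rule coth_case_f_minus_g coth_case_summable coth_case_explicit
    csch_case_f_minus_g csch_case_summable csch_case_explicit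
    tanh_case_f_minus_g tanh_case_summable tanh_case_explicit
    sech_case_f_minus_g sech_case_summable sech_case_explicit; assumption)+

end
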